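(* Let $\{X_n\}_{n\in\mathbb Z_+}$ be a sequence of separable Fréchet spaces. Then there is a hypercyclic operator on the locally convex direct sum $X=\bigoplus_{n=0}^\infty X_n$ if and only if the set $\{n\in\mathbb Z_+: X_n\text{ is infinite dimensional}\}$ is infinite.
   Context: Conventions: $\mathbb K$ is $\mathbb R$ or $\mathbb C$; all vector spaces (in particular each $X_n$) are non-zero and over $\mathbb K$; all topological spaces are Hausdorff; $\mathbb Z_+=\{0,1,2,\dots\}$. A Fréchet space is a complete metrizable locally convex space. The locally convex direct sum $\bigoplus_n X_n$ is the algebraic direct sum endowed with the strongest locally convex topology which induces the original topology on each $X_n$. A hypercyclic operator on $X$ is a continuous linear operator $T:X\to X$ such that $\{T^kx:k\in\mathbb Z_+\}$ is dense in $X$ for some $x\in X$. *)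

theory Defs
  imports "HOL-Analysis.Analysis" "HOL-Library.Poly_Mapping"
begin

section \<open>Scalars\<close>

text \<open>
  Valued fields that are copies of the reals or of the complex numbers. Compatibility of the
  embedding with the canonical real scalars is automatic, since it is additive and isometric.
\<close>

class real_or_complex = real_normed_field +
  assumes real_or_complex:
    "\<exists>f :: 'a \<Rightarrow> complex.
       (\<forall>x y. f (x + y) = f x + f y) \<and> (\<forall>x y. f (x * y) = f x * f y) \<and>
       (\<forall>x. norm (f x) = norm x) \<and> (range f = \<real> \<or> range f = UNIV)"

instance real :: real_or_complex
  by standard (rule exI[of _ complex_of_real], simp add: Reals_def)

instance complex :: real_or_complex
  by standard (rule exI[of _ "\<lambda>x. x"], simp)


section \<open>Topological vector spaces\<close>

text \<open>
  A vector space is a subspace \<open>topspace T\<close> of an ambient vector space that only supplies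
  the algebraic operations: the ambient type carries no topology of its own.
  All spaces are Hausdorff by convention.
\<close>

definition topological_vector_space ::
    "('k::real_normed_field \<Rightarrow> 'a::ab_group_add \<Rightarrow> 'a) \<Rightarrow> 'a topology \<Rightarrow> bool" where
  "topological_vector_space s T \<longleftrightarrow>
     vector_space s \<and> module.subspace s (topspace T) \<and> Hausdorff_space T \<and>
     continuous_map (prod_topology T T) T (\<lambda>(x, y). x + y) \<and>
     continuous_map (prod_topology euclidean T) T (\<lambda>(c, x). s c x)"

definition convex_wrt ::
    "('k::real_normed_field \<Rightarrow> 'a::ab_group_add \<Rightarrow> 'a) \<Rightarrow> 'a set \<Rightarrow> bool" where
  "convex_wrt s A \<longleftrightarrow>
     (\<forall>x\<in>A. \<forall>y\<in>A. \<forall>t\<in>{0..1}. s (of_real (1 - t)) x + s (of_real t) y \<in> A)"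

definition locally_convex_space ::
    "('k::real_normed_field \<Rightarrow> 'a::ab_group_add \<Rightarrow> 'a) \<Rightarrow> 'a topology \<Rightarrow> bool" where
  "locally_convex_space s T \<longleftrightarrow>
     topological_vector_space s T \<and> neighbourhood_base_of (convex_wrt s) T"

text \<open>
  Completeness refers to the translation-invariant uniformity of the space:
  every Cauchy filter converges.
\<close>

definition cauchy_filter_on :: "'a::ab_group_add topology \<Rightarrow> 'a filter \<Rightarrow> bool" where
  "cauchy_filter_on T F \<longleftrightarrow>
     F \<noteq> bot \<and> F \<le> principal (topspace T) \<and>
     (\<forall>U. openin T U \<and> 0 \<in> U \<longrightarrow> (\<forall>\<^sub>F (x, y) in F \<times>\<^sub>F F. x - y \<in> U))"

definition complete_tvs :: "'a::ab_group_add topology \<Rightarrow> bool" where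
  "complete_tvs T \<longleftrightarrow> (\<forall>F. cauchy_filter_on T F \<longrightarrow> (\<exists>l. limitin T (\<lambda>x. x) l F))"

definition frechet_space ::
    "('k::real_normed_field \<Rightarrow> 'a::ab_group_add \<Rightarrow> 'a) \<Rightarrow> 'a topology \<Rightarrow> bool" where
  "frechet_space s T \<longleftrightarrow> locally_convex_space s T \<and> metrizable_space T \<and> complete_tvs T"

definition finite_dimensional_on ::
    "('k::field \<Rightarrow> 'a::ab_group_add \<Rightarrow> 'a) \<Rightarrow> 'a set \<Rightarrow> bool" where
  "finite_dimensional_on s V \<longleftrightarrow> (\<exists>B. finite B \<and> B \<subseteq> V \<and> module.span s B = V)"

definition hypercyclic_operator ::
    "('k::real_normed_field \<Rightarrow> 'a::ab_group_add \<Rightarrow> 'a) \<Rightarrow> 'a topology \<Rightarrow> ('a \<Rightarrow> 'a) \<Rightarrow> bool" where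
  "hypercyclic_operator s T L \<longleftrightarrow>
     continuous_map T T L \<and>
     (\<forall>x\<in>topspace T. \<forall>y\<in>topspace T. L (x + y) = L x + L y) \<and>
     (\<forall>c. \<forall>x\<in>topspace T. L (s c x) = s c (L x)) \<and>
     (\<exists>x\<in>topspace T. T closure_of {(L ^^ k) x | k. True} = topspace T)"


section \<open>Locally convex direct sums\<close>

text \<open>
  Elements of the external direct sum are finitely supported families; the \<open>n\<close>-th space is
  embedded by \<open>Poly_Mapping.single n\<close>.
\<close>

definition direct_sum :: "(nat \<Rightarrow> 'a::ab_group_add set) \<Rightarrow> (nat \<Rightarrow>\<^sub>0 'a) set" where
  "direct_sum V = {f. \<forall>n. Poly_Mapping.lookup f n \<in> V n}"

definition direct_sum_scale ::
    "('k \<Rightarrow> 'a \<Rightarrow> 'a) \<Rightarrow> 'k \<Rightarrow> (nat \<Rightarrow>\<^sub>0 'a::ab_group_add) \<Rightarrow> (nat \<Rightarrow>\<^sub>0 'a)" where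
  "direct_sum_scale s c f = Poly_Mapping.map (s c) f"

definition admissible_sum_topology ::
    "('k::real_normed_field \<Rightarrow> 'a::ab_group_add \<Rightarrow> 'a) \<Rightarrow> (nat \<Rightarrow> 'a topology) \<Rightarrow>
     (nat \<Rightarrow>\<^sub>0 'a) topology \<Rightarrow> bool" where
  "admissible_sum_topology s X T \<longleftrightarrow>
     topspace T = direct_sum (\<lambda>n. topspace (X n)) \<and>
     locally_convex_space (direct_sum_scale s) T \<and>
     (\<forall>n. embedding_map (X n) T (Poly_Mapping.single n))"

text \<open>
  The strongest admissible topology, obtained as the supremum of all of them; that the supremum
  is itself admissible is shown below.
\<close>

definition direct_sum_topology ::
    "('k::real_normed_field \<Rightarrow> 'a::ab_group_add \<Rightarrow> 'a) \<Rightarrow> (nat \<Rightarrow> 'a topology) \<Rightarrow>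
     (nat \<Rightarrow>\<^sub>0 'a) topology" where
  "direct_sum_topology s X =
     topology_generated_by {U. \<exists>T. admissible_sum_topology s X T \<and> openin T U}"


lemma lookup_direct_sum_scale:
  assumes "vector_space s"
  shows "Poly_Mapping.lookup (direct_sum_scale s c f) n = s c (Poly_Mapping.lookup f n)"
proof -
  interpret vector_space s by fact
  have "s c 0 = 0" by (rule scale_zero_right)
  then show ?thesis
    unfolding direct_sum_scale_def by transfer (simp add: when_def)
qed

lemma vector_space_direct_sum_scale:
  assumes "vector_space s"
  shows "vector_space (direct_sum_scale s)"
proof -
  interpret vector_space s by fact
  show ?thesis
    by unfold_locales
      (auto intro!: poly_mapping_eqI simp: lookup_direct_sum_scale[OF assms] lookup_add
        scale_right_distrib scale_left_distrib)
qed

lemma subspace_direct_sum: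
  assumes "vector_space s" "\<And>n. module.subspace s (V n)"
  shows "module.subspace (direct_sum_scale s) (direct_sum V)"
proof -
  interpret v: vector_space s by fact
  interpret d: vector_space "direct_sum_scale s"
    by (rule vector_space_direct_sum_scale) fact
  show ?thesis
    using assms(2)
    by (auto simp: d.subspace_def v.subspace_def direct_sum_def lookup_add
        lookup_direct_sum_scale[OF assms(1)])
qed

lemma convex_wrt_Int: "convex_wrt s A \<Longrightarrow> convex_wrt s B \<Longrightarrow> convex_wrt s (A \<inter> B)"
  unfolding convex_wrt_def by blast

definition coordinatewise_topology :: "(nat \<Rightarrow> 'a::ab_group_add topology) \<Rightarrow> (nat \<Rightarrow>\<^sub>0 'a) topology" where
  "coordinatewise_topology X =
     pullback_topology (direct_sum (\<lambda>n. topspace (X n))) Poly_Mapping.lookup (product_topology X UNIV)"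

lemma topspace_coordinatewise_topology:
  "topspace (coordinatewise_topology X) = direct_sum (\<lambda>n. topspace (X n))"
  by (auto simp: coordinatewise_topology_def topspace_pullback_topology direct_sum_def)

lemma continuous_map_into_coordinatewise:
  "continuous_map Y (coordinatewise_topology X) f \<longleftrightarrow>
    (\<forall>n. continuous_map Y (X n) (\<lambda>y. Poly_Mapping.lookup (f y) n))" (is "?L \<longleftrightarrow> ?R")
proof
  assume ?L
  have lk: "continuous_map (coordinatewise_topology X) (product_topology X UNIV) (id \<circ> Poly_Mapping.lookup)"
    unfolding coordinatewise_topology_def by (rule continuous_map_pullback) simp
  have "continuous_map Y (product_topology X UNIV) ((id \<circ> Poly_Mapping.lookup) \<circ> f)"
    by (rule continuous_map_compose[OF \<open>?L\<close> lk])
  then show ?R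
    by (simp add: continuous_map_componentwise_UNIV o_def)
next
  assume R: ?R
  have "continuous_map Y (product_topology X UNIV) (Poly_Mapping.lookup \<circ> f)"
    using R by (simp add: continuous_map_componentwise_UNIV o_def)
  moreover have "f \<in> topspace Y \<rightarrow> direct_sum (\<lambda>n. topspace (X n))"
    using R by (force simp: direct_sum_def continuous_map_def)
  ultimately show ?L
    unfolding coordinatewise_topology_def
    by (intro continuous_map_pullback') auto
qed

lemma continuous_map_coordinate:
  "continuous_map (coordinatewise_topology X) (X n) (\<lambda>f. Poly_Mapping.lookup f n)"
  using continuous_map_into_coordinatewise[of "coordinatewise_topology X" X id] by simp

lemma embedding_map_single:
  assumes "continuous_map T (X n) (\<lambda>f. Poly_Mapping.lookup f n)"
    and "continuous_map (X n) T (Poly_Mapping.single n)"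
  shows "embedding_map (X n) T (Poly_Mapping.single n)"
  using assms
  by (intro section_imp_embedding_map) (auto simp: section_map_def retraction_maps_def)

lemma admissible_coordinatewise_topology:
  assumes lc: "\<And>n. locally_convex_space s (X n)"
  shows "admissible_sum_topology s X (coordinatewise_topology X)" (is "admissible_sum_topology s X ?T")
proof -
  have vs: "vector_space s" and sub: "module.subspace s (topspace (X n))"
    and haus: "Hausdorff_space (X n)"
    and add: "continuous_map (prod_topology (X n) (X n)) (X n) (\<lambda>(x, y). x + y)"
    and scl: "continuous_map (prod_topology euclidean (X n)) (X n) (\<lambda>(c, x). s c x)"
    and nb: "neighbourhood_base_of (convex_wrt s) (X n)" for n
    using lc[of n] by (auto simp: locally_convex_space_def topological_vector_space_def)
  interpret v: vector_space s by (rule vs)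
  note lk = lookup_direct_sum_scale[OF vs]
  have co: "continuous_map (prod_topology ?T ?T) (X n) (\<lambda>p. Poly_Mapping.lookup (fst p) n)"
    "continuous_map (prod_topology ?T ?T) (X n) (\<lambda>p. Poly_Mapping.lookup (snd p) n)" for n
    using continuous_map_compose[OF continuous_map_fst continuous_map_coordinate]
      continuous_map_compose[OF continuous_map_snd continuous_map_coordinate]
    by (auto simp: o_def)
  have addT: "continuous_map (prod_topology ?T ?T) ?T (\<lambda>(x, y). x + y)"
    unfolding continuous_map_into_coordinatewise
  proof
    fix n
    have "continuous_map (prod_topology ?T ?T) (X n)
      ((\<lambda>(x, y). x + y) \<circ> (\<lambda>p. (Poly_Mapping.lookup (fst p) n, Poly_Mapping.lookup (snd p) n)))"
      by (rule continuous_map_compose[OF _ add]) (simp add: continuous_map_pairedI co)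
    then show "continuous_map (prod_topology ?T ?T) (X n)
        (\<lambda>y. Poly_Mapping.lookup (case y of (x, y) \<Rightarrow> x + y) n)"
      by (simp add: o_def case_prod_unfold lookup_add)
  qed
  have sclT: "continuous_map (prod_topology euclidean ?T) ?T (\<lambda>(c, x). direct_sum_scale s c x)"
    unfolding continuous_map_into_coordinatewise
  proof
    fix n
    have "continuous_map (prod_topology euclidean ?T) (X n) (\<lambda>p. Poly_Mapping.lookup (snd p) n)"
      using continuous_map_compose[OF continuous_map_snd continuous_map_coordinate]
      by (auto simp: o_def)
    then have "continuous_map (prod_topology euclidean ?T) (X n)
      ((\<lambda>(c, x). s c x) \<circ> (\<lambda>p. (fst p, Poly_Mapping.lookup (snd p) n)))"
      by (intro continuous_map_compose[OF _ scl]) (intro continuous_map_pairedI continuous_map_fst)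
    then show "continuous_map (prod_topology euclidean ?T) (X n)
        (\<lambda>y. Poly_Mapping.lookup (case y of (c, x) \<Rightarrow> direct_sum_scale s c x) n)"
      by (simp add: o_def case_prod_unfold lk)
  qed
  have emb: "embedding_map (X n) ?T (Poly_Mapping.single n)" for n
  proof (rule embedding_map_single[OF continuous_map_coordinate])
    show "continuous_map (X n) ?T (Poly_Mapping.single n)"
      unfolding continuous_map_into_coordinatewise
    proof
      fix m
      have "0 \<in> topspace (X m)" using sub[of m] by (rule v.subspace_0)
      then show "continuous_map (X n) (X m) (\<lambda>y. Poly_Mapping.lookup (Poly_Mapping.single n y) m)"
        by (cases "n = m") (auto simp: lookup_single when_def)
    qed
  qed
  have hausT: "Hausdorff_space ?T"
  proof -
    have "Hausdorff_space (product_topology X UNIV)"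
      using haus by (simp add: Hausdorff_space_product_topology)
    moreover have "continuous_map ?T (product_topology X UNIV) Poly_Mapping.lookup"
      unfolding continuous_map_componentwise_UNIV by (intro allI continuous_map_coordinate)
    moreover have "inj_on Poly_Mapping.lookup (topspace ?T)"
      by (metis (no_types) inj_onI lookup_inject)
    ultimately show ?thesis
      by (rule Hausdorff_space_injective_preimage)
  qed
  have nbT: "neighbourhood_base_of (convex_wrt (direct_sum_scale s)) ?T"
    unfolding neighbourhood_base_of
  proof (intro allI impI, elim conjE)
    fix W f assume W: "openin ?T W" and f: "f \<in> W"
    obtain U where U: "openin (product_topology X UNIV) U"
      "W = Poly_Mapping.lookup -` U \<inter> direct_sum (\<lambda>n. topspace (X n))"
      using W unfolding coordinatewise_topology_def openin_pullback_topology by blast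
    have "Poly_Mapping.lookup f \<in> U" using f U by auto
    then obtain B where B: "finite {i. B i \<noteq> topspace (X i)}" "\<And>i. openin (X i) (B i)"
      "Poly_Mapping.lookup f \<in> Pi\<^sub>E UNIV B" "Pi\<^sub>E UNIV B \<subseteq> U"
      using U(1) unfolding openin_product_topology_alt by auto
    have "\<exists>O' V. openin (X i) O' \<and> convex_wrt s V \<and> Poly_Mapping.lookup f i \<in> O' \<and> O' \<subseteq> V \<and> V \<subseteq> B i
       \<and> (B i = topspace (X i) \<longrightarrow> O' = topspace (X i))" for i
    proof (cases "B i = topspace (X i)")
      case True
      have "convex_wrt s (topspace (X i))"
        using sub[of i] unfolding convex_wrt_def by (auto simp: v.subspace_def)
      then show ?thesis using True B(3) by (intro exI[of _ "topspace (X i)"]) (auto simp: PiE_iff)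
    next
      case False
      then show ?thesis
        using nb[of i] B(2)[of i] B(3) unfolding neighbourhood_base_of by (auto simp: PiE_iff)
    qed
    then obtain P V where PV: "\<And>i. openin (X i) (P i)" "\<And>i. convex_wrt s (V i)"
      "\<And>i. Poly_Mapping.lookup f i \<in> P i" "\<And>i. P i \<subseteq> V i" "\<And>i. V i \<subseteq> B i"
      "\<And>i. B i = topspace (X i) \<Longrightarrow> P i = topspace (X i)"
      by metis
    have fin: "finite {i. P i \<noteq> topspace (X i)}"
      by (rule finite_subset[OF _ B(1)]) (use PV(6) in blast)
    let ?D = "direct_sum (\<lambda>n. topspace (X n))"
    have "openin (product_topology X UNIV) (Pi\<^sub>E UNIV P)"
      using PV(1) fin by (simp add: openin_PiE_gen)
    then have 1: "openin ?T (Poly_Mapping.lookup -` (Pi\<^sub>E UNIV P) \<inter> ?D)"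
      unfolding coordinatewise_topology_def openin_pullback_topology by blast
    have 2: "convex_wrt (direct_sum_scale s) (direct_sum V)"
      using PV(2) unfolding convex_wrt_def direct_sum_def by (simp add: lookup_add lk)
    have VD: "direct_sum V \<subseteq> ?D"
      using PV(5) B(2) openin_subset unfolding direct_sum_def by blast
    have 3: "f \<in> Poly_Mapping.lookup -` (Pi\<^sub>E UNIV P) \<inter> ?D"
      using PV(3) f U(2) by (auto simp: PiE_iff)
    have 4: "Poly_Mapping.lookup -` (Pi\<^sub>E UNIV P) \<inter> ?D \<subseteq> direct_sum V"
      using PV(4) by (auto simp: direct_sum_def PiE_iff)
    have 5: "direct_sum V \<subseteq> W"
      using VD PV(5) B(4) unfolding U(2) direct_sum_def by (auto simp: PiE_iff subset_iff)
    show "\<exists>U V. openin ?T U \<and> convex_wrt (direct_sum_scale s) V \<and> f \<in> U \<and> U \<subseteq> V \<and> V \<subseteq> W"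
      using 1 2 3 4 5 by blast
  qed
  show ?thesis
    unfolding admissible_sum_topology_def locally_convex_space_def topological_vector_space_def
    using vector_space_direct_sum_scale[OF vs] subspace_direct_sum[OF vs sub] hausT addT sclT nbT emb
    by (simp add: topspace_coordinatewise_topology)
qed

lemma openin_direct_sum_topologyI:
  "admissible_sum_topology s X T \<Longrightarrow> openin T U \<Longrightarrow> openin (direct_sum_topology s X) U"
  unfolding direct_sum_topology_def by (rule topology_generated_by_Basis) blast

theorem admissible_direct_sum_topology:
  assumes lc: "\<And>n. locally_convex_space s (X n)"
  shows "admissible_sum_topology s X (direct_sum_topology s X)" (is "admissible_sum_topology s X ?S")
proof -
  let ?C = "coordinatewise_topology X" and ?D = "direct_sum (\<lambda>n. topspace (X n))"
  let ?d = "direct_sum_scale s"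
  have C: "admissible_sum_topology s X ?C"
    by (rule admissible_coordinatewise_topology[OF lc])
  have top: "topspace T = ?D" if "admissible_sum_topology s X T" for T
    using that by (simp add: admissible_sum_topology_def)
  have "\<Union>{U. \<exists>T. admissible_sum_topology s X T \<and> openin T U} = ?D"
    using C top openin_subset by (blast intro: openin_topspace)
  then have topS: "topspace ?S = ?D"
    by (simp add: direct_sum_topology_def)
  have fine: "continuous_map ?S T (\<lambda>x. x)" if "admissible_sum_topology s X T" for T
    using topology_finer_continuous_id[of T ?S] top[OF that] topS openin_direct_sum_topologyI[OF that]
    by (simp add: id_def)
  have into: "continuous_map Y ?S f"
    if "\<And>T. admissible_sum_topology s X T \<Longrightarrow> continuous_map Y T f" for Y and f :: "'c \<Rightarrow> _"
    unfolding direct_sum_topology_def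
  proof (rule continuous_on_generated_topo)
    fix U assume "U \<in> {U. \<exists>T. admissible_sum_topology s X T \<and> openin T U}"
    then show "openin Y (f -` U \<inter> topspace Y)"
      using that by (auto simp: continuous_map_alt)
  next
    have "f ` topspace Y \<subseteq> topspace ?C"
      using that[OF C] by (auto simp: continuous_map_def)
    then show "f ` topspace Y \<subseteq> \<Union> {U. \<exists>T. admissible_sum_topology s X T \<and> openin T U}"
      using C by (blast intro: openin_topspace)
  qed
  have lcT: "vector_space ?d" "module.subspace ?d ?D" "Hausdorff_space T"
    "continuous_map (prod_topology T T) T (\<lambda>(x, y). x + y)"
    "continuous_map (prod_topology euclidean T) T (\<lambda>(c, x). ?d c x)"
    "neighbourhood_base_of (convex_wrt ?d) T"
    "embedding_map (X n) T (Poly_Mapping.single n)"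
    if "admissible_sum_topology s X T" for T n
    using that top[OF that]
    by (auto simp: admissible_sum_topology_def locally_convex_space_def topological_vector_space_def)
  have haus: "Hausdorff_space ?S"
    using lcT(3)[OF C] fine[OF C] by (rule Hausdorff_space_injective_preimage) simp
  have add: "continuous_map (prod_topology ?S ?S) ?S (\<lambda>(x, y). x + y)"
  proof (rule into)
    fix T assume T: "admissible_sum_topology s X T"
    have "continuous_map (prod_topology ?S ?S) T ((\<lambda>(x, y). x + y) \<circ> (\<lambda>(x, y). (x, y)))"
      using fine[OF T]
      by (intro continuous_map_compose[OF _ lcT(4)[OF T]]) (rule continuous_map_prod_top[THEN iffD2], simp)
    then show "continuous_map (prod_topology ?S ?S) T (\<lambda>(x, y). x + y)"
      by (simp add: o_def case_prod_unfold)
  qed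
  have scl: "continuous_map (prod_topology euclidean ?S) ?S (\<lambda>(c, x). ?d c x)"
  proof (rule into)
    fix T assume T: "admissible_sum_topology s X T"
    have "continuous_map (prod_topology euclidean ?S) T ((\<lambda>(c, x). ?d c x) \<circ> (\<lambda>(x, y). (x, y)))"
      using fine[OF T]
      by (intro continuous_map_compose[OF _ lcT(5)[OF T]]) (rule continuous_map_prod_top[THEN iffD2], simp)
    then show "continuous_map (prod_topology euclidean ?S) T (\<lambda>(c, x). ?d c x)"
      by (simp add: o_def case_prod_unfold)
  qed
  have emb: "embedding_map (X n) ?S (Poly_Mapping.single n)" for n
  proof (rule embedding_map_single)
    show "continuous_map ?S (X n) (\<lambda>f. Poly_Mapping.lookup f n)"
      using continuous_map_compose[OF fine[OF C] continuous_map_coordinate] by (simp add: o_def)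
    show "continuous_map (X n) ?S (Poly_Mapping.single n)"
      by (rule into) (use lcT(7) in \<open>auto simp: embedding_map_def homeomorphic_eq_everything_map
            continuous_map_in_subtopology\<close>)
  qed
  have nb: "neighbourhood_base_of (convex_wrt ?d) ?S"
    unfolding neighbourhood_base_of
  proof (intro allI impI, elim conjE)
    fix W f assume W: "openin ?S W" and f: "f \<in> W"
    have "generate_topology_on {U. \<exists>T. admissible_sum_topology s X T \<and> openin T U} W"
      using W unfolding direct_sum_topology_def by (rule openin_topology_generated_by)
    then show "\<exists>U V. openin ?S U \<and> convex_wrt ?d V \<and> f \<in> U \<and> U \<subseteq> V \<and> V \<subseteq> W"
      using f
    proof induction
      case (Int A B)
      obtain U V U' V' where "openin ?S U" "convex_wrt ?d V" "f \<in> U" "U \<subseteq> V" "V \<subseteq> A"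
        "openin ?S U'" "convex_wrt ?d V'" "f \<in> U'" "U' \<subseteq> V'" "V' \<subseteq> B"
        using Int by blast
      then show ?case
        by (intro exI[of _ "U \<inter> U'"] exI[of _ "V \<inter> V'"]) (auto intro: convex_wrt_Int)
    next
      case (UN K)
      then show ?case by (meson UnionE Union_upper subset_trans)
    next
      case (Basis A)
      then obtain T where T: "admissible_sum_topology s X T" "openin T A" by blast
      then show ?case
        using lcT(6)[OF T(1)] Basis(2) openin_direct_sum_topologyI[OF T(1)]
        unfolding neighbourhood_base_of by meson
    qed auto
  qed
  show ?thesis
    unfolding admissible_sum_topology_def locally_convex_space_def topological_vector_space_def
    using lcT(1,2)[OF C] topS haus add scl nb emb by simp
qed

end

theory Submission
  imports Defs
begin

text \<open>
  \<^emph>\<open>Only if.\<close> Let all but finitely many \<open>X\<^sub>n\<close> be finite-dimensional, and split \<open>X = F \<oplus> \<Phi>\<close> with \<open>F\<close>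
  the sum of the infinite-dimensional ones. Metrizability of \<open>F\<close> forces the \<open>\<Phi>\<close>-component of \<open>L\<close> on \<open>F\<close>
  to have finite rank, so the \<open>\<Phi>\<close>-components \<open>g\<^sub>k\<close> of an orbit satisfy a recursion
  \<open>g\<^sub>k\<^sub>+\<^sub>1 = f g\<^sub>k + a\<^sub>k\<close> with \<open>a\<^sub>k\<close> in a fixed finite-dimensional space. If they do not stay in a
  finite-dimensional space, a tail of \<open>(g\<^sub>k)\<close> is linearly independent, and a linear functional on \<open>\<Phi>\<close>
  equal to \<open>1\<close> on that tail (every linear functional on \<open>\<Phi>\<close> is continuous) contradicts density.

  \<^emph>\<open>If.\<close> Group the summands into finite blocks carrying biorthogonal systems \<open>(e\<^sub>n\<^sub>,\<^sub>j, f\<^sub>n\<^sub>,\<^sub>j)\<close> with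
  \<open>e\<^sub>n\<^sub>,\<^sub>j\<close> spanning a dense subspace. The operator sends \<open>e\<^sub>n\<^sub>,\<^sub>j\<^sub>+\<^sub>1\<close> to a small multiple of
  \<open>e\<^sub>n\<^sub>+\<^sub>1\<^sub>,\<^sub>j\<close>, whereas the images of the vectors \<open>e\<^sub>n\<^sub>,\<^sub>0\<close> are free, since changing one of them changes the
  operator on block \<open>n\<close> only by a rank one map. Following the diagonals, the orbit of \<open>e\<^sub>0\<^sub>,\<^sub>0\<close> meets a
  fresh \<open>e\<^sub>n\<^sub>,\<^sub>0\<close> on every diagonal, and its image is chosen so that the orbit next hits a prescribed
  point up to a tiny multiple of \<open>e\<^sub>0\<^sub>,\<^sub>n\<^sub>+\<^sub>1\<close>. All error terms lie in block \<open>0\<close>, so they tend to \<open>0\<close>.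
\<close>

section \<open>The Hahn-Banach theorem\<close>

text \<open>A seminorm on the sum is continuous as soon as it is continuous on each summand, with no
  uniformity over the summands. This cuts both ways. Continuity of an operator is checked on one
  summand at a time, so the free images may be arbitrarily large. Conversely, non-zero vectors in
  ever new blocks cannot be made small by scaling, since some continuous seminorm outgrows any
  prescribed weights; hence the errors of the orbit have to return to block \<open>0\<close>, where
  countably many seminorms suffice. The obstacle is the passage from block \<open>n\<close> to block
  \<open>n + 1\<close>. A series of rank one maps converges in a target seminorm only if the
  functionals that this seminorm sees are bounded by a common source seminorm, and small
  coefficients cannot enforce that: from the space of all scalar sequences to a normed space only
  finite rank is possible. The blocks are therefore cut in such a way that either every block has
  functionals of bounded order, or in every block after block \<open>0\<close> each seminorm
  vanishes on all but finitely many of the spanning vectors.\<close>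

lemma real_or_complex_cases:
  obtains (real) "\<And>c::'k::real_or_complex. \<exists>a. c = of_real a"
  | (complex) i :: "'k::real_or_complex"
    where "i * i = -1" "\<And>c::'k. \<exists>a b. c = of_real a + of_real b * i"
proof -
  obtain f :: "'k \<Rightarrow> complex" where add: "\<And>x y. f (x + y) = f x + f y"
    and mult: "\<And>x y. f (x * y) = f x * f y" and norm: "\<And>x. norm (f x) = norm x"
    and ran: "range f = \<real> \<or> range f = UNIV"
    using real_or_complex by blast
  have "norm (f 1) = 1" using norm by simp
  moreover have "f 1 * f 1 = f 1" using mult[of 1 1] by simp
  ultimately have f1: "f 1 = 1" by auto
  have inj: "x = y" if "f x = f y" for x y
  proof -
    have "f (x - y) + f y = f x" using add[of "x - y" y] by simp
    then have "norm (x - y) = 0" using that norm[of "x - y"] by simp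
    then show ?thesis by simp
  qed
  have real: "f (of_real r) = of_real r" for r
  proof -
    have 1: "cmod (f (of_real r)) = \<bar>r\<bar>" by (simp add: norm)
    \<comment> \<open>The image of \<open>r\<close> lies on the circle of radius |r| around 0 and on
      that of radius |r + 1| around -1. Both centres and \<open>r\<close> are real, so the circles
      meet only in \<open>r\<close>.\<close>
    have "cmod (f (of_real r) + 1) = cmod (f (of_real (r + 1)))" by (simp add: add f1)
    then have 2: "cmod (f (of_real r) + 1) = \<bar>r + 1\<bar>" unfolding norm norm_of_real .
    have "(Re (f (of_real r)))\<^sup>2 + (Im (f (of_real r)))\<^sup>2 = r\<^sup>2"
      using 1 by (metis cmod_power2 power2_abs)
    moreover have "(Re (f (of_real r)) + 1)\<^sup>2 + (Im (f (of_real r)))\<^sup>2 = (r + 1)\<^sup>2"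
      using 2 by (metis add.right_neutral cmod_power2 one_complex.sel plus_complex.sel power2_abs)
    ultimately have "Re (f (of_real r)) = r" "(Im (f (of_real r)))\<^sup>2 = 0"
      by (auto simp: power2_eq_square algebra_simps)
    then show ?thesis by (simp add: complex_eq_iff)
  qed
  show ?thesis
    using ran
  proof
    assume R: "range f = \<real>"
    have "\<exists>a. c = of_real a" for c :: 'k
    proof -
      have "f c \<in> \<real>" using R by blast
      then obtain a where "f c = of_real a" by (rule Reals_cases)
      then show ?thesis using real inj by metis
    qed
    then show ?thesis by (rule that(1))
  next
    assume R: "range f = UNIV"
    then obtain i where i: "f i = \<i>" by (metis surjD)
    have "f (i * i) = f (of_real (-1))" unfolding mult real i by simp
    then have ii: "i * i = -1" using inj by fastforce
    have "\<exists>a b. c = of_real a + of_real b * i" for c :: 'k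
    proof -
      have "f c = f (of_real (Re (f c)) + of_real (Im (f c)) * i)"
        unfolding add mult real i by (simp add: complex_eq_iff)
      then show ?thesis using inj by blast
    qed
    then show ?thesis using that(2) ii by blast
  qed
qed

text \<open>Seminorms are total on the ambient type even though a space is only a subspace of it;
  one that is natural only on the subspace is extended through
  \<open>exists_linear_projection\<close>. Non-negativity follows from the two clauses, see
  \<open>seminorm_nonneg\<close>.\<close>

definition seminorm :: "('k::real_normed_field \<Rightarrow> 'b::ab_group_add \<Rightarrow> 'b) \<Rightarrow> ('b \<Rightarrow> real) \<Rightarrow> bool" where
  "seminorm s p \<longleftrightarrow> (\<forall>x y. p (x + y) \<le> p x + p y) \<and> (\<forall>c x. p (s c x) = norm c * p x)"

definition sublinear :: "(real \<Rightarrow> 'b::ab_group_add \<Rightarrow> 'b) \<Rightarrow> ('b \<Rightarrow> real) \<Rightarrow> bool" where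
  "sublinear s p \<longleftrightarrow> (\<forall>x y. p (x + y) \<le> p x + p y) \<and> (\<forall>t x. t \<ge> 0 \<longrightarrow> p (s t x) = t * p x)"

lemma sublinear_lower_bound:
  assumes "vector_space s" "sublinear s p"
  shows "- p (- x) \<le> p x"
proof -
  interpret vector_space s by fact
  have "p (s 0 0) = 0 * p 0" using assms(2) unfolding sublinear_def by blast
  moreover have "p (x + - x) \<le> p x + p (- x)" using assms(2) unfolding sublinear_def by blast
  ultimately show ?thesis by simp
qed

text \<open>A minimal sublinear functional coincides with all its shifts, which forces it to be additive.\<close>

lemma sublinear_shift:
  fixes s :: "real \<Rightarrow> 'b::ab_group_add \<Rightarrow> 'b" and y :: 'b
  assumes vs: "vector_space s" and p: "sublinear s p"
  defines "q \<equiv> \<lambda>x. INF t\<in>{0..}. p (x + s t y) - t * p y"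
  shows "sublinear s q" "\<And>x t. t \<ge> 0 \<Longrightarrow> q x \<le> p (x + s t y) - t * p y"
proof -
  interpret vector_space s by fact
  have sub: "p (x + y) \<le> p x + p y" and hom: "t \<ge> 0 \<Longrightarrow> p (s t x) = t * p x" for x y t
    using p by (auto simp: sublinear_def)
  have lb: "- p (- x) \<le> p (x + s t y) - t * p y" if "t \<ge> 0" for x t
    using sub[of "x + s t y" "- x"] hom[OF that, of y] by simp
  have bdd: "bdd_below ((\<lambda>t. p (x + s t y) - t * p y) ` {0..})" for x
    by (rule bdd_belowI[of _ "- p (- x)"]) (use lb in auto)
  show up: "q x \<le> p (x + s t y) - t * p y" if "t \<ge> 0" for x t
    unfolding q_def by (rule cINF_lower[OF bdd]) (use that in auto)
  have gl: "z \<le> q x" if "\<And>t. t \<ge> 0 \<Longrightarrow> z \<le> p (x + s t y) - t * p y" for z x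
    unfolding q_def by (rule cINF_greatest) (use that in auto)
  have "q (x + z) \<le> q x + q z" for x z
  proof -
    have "q (x + z) - (p (x + s a y) - a * p y) \<le> p (z + s b y) - b * p y" if "a \<ge> 0" "b \<ge> 0" for a b
    proof -
      have "q (x + z) \<le> p (x + z + s (a + b) y) - (a + b) * p y" by (rule up) (use that in auto)
      also have "x + z + s (a + b) y = (x + s a y) + (z + s b y)"
        by (simp add: scale_left_distrib)
      finally show ?thesis
        using sub[of "x + s a y" "z + s b y"] by (simp add: algebra_simps)
    qed
    then have "q (x + z) - (p (x + s a y) - a * p y) \<le> q z" if "a \<ge> 0" for a
      using that by (intro gl) auto
    then have "q (x + z) - q z \<le> q x"
      by (intro gl) (smt (verit))
    then show ?thesis by simp
  qed
  moreover have "q (s c x) = c * q x" if "c \<ge> 0" for c x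
  proof -
    have le: "q (s c x) \<le> c * q x" if "c > 0" for c x
    proof -
      have "q (s c x) / c \<le> q x"
      proof (rule gl)
        fix t :: real assume "t \<ge> 0"
        then have "q (s c x) \<le> p (s c x + s (c * t) y) - (c * t) * p y"
          using that by (intro up) auto
        also have "s c x + s (c * t) y = s c (x + s t y)" by (simp add: scale_right_distrib)
        finally show "q (s c x) / c \<le> p (x + s t y) - t * p y"
          using that hom[of c "x + s t y"] by (simp add: field_simps)
      qed
      then show ?thesis using that by (simp add: field_simps)
    qed
    show ?thesis
    proof (cases "c = 0")
      case True
      have "q 0 \<le> 0" using up[of 0 0] hom[of 0 0] by simp
      moreover have "0 \<le> q 0" by (rule gl) (use hom in simp)
      ultimately show ?thesis using True by simp
    next
      case False
      then have "c > 0" using that by simp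
      then have "q x \<le> 1 / c * q (s c x)" using le[of "1 / c" "s c x"] by simp
      then show ?thesis using le[OF \<open>c > 0\<close>, of x] \<open>c > 0\<close> by (simp add: field_simps)
    qed
  qed
  ultimately show "sublinear s q" by (simp add: sublinear_def)
qed

text \<open>Zorn's lemma, downwards. On a chain the pointwise infimum is finite because every member
  lies above \<open>- p (- x)\<close>, and it is subadditive because any two members have a common
  lower one in the chain.\<close>

lemma exists_minimal_sublinear:
  fixes s :: "real \<Rightarrow> 'b::ab_group_add \<Rightarrow> 'b"
  assumes vs: "vector_space s" and p: "sublinear s p"
  shows "\<exists>q. sublinear s q \<and> q \<le> p \<and> (\<forall>r. sublinear s r \<and> r \<le> q \<longrightarrow> r = q)"
proof -
  \<comment> \<open>\<open>?P\<close> reverses the order, so that a maximal element for it is a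
    minimal functional.\<close>
  let ?A = "{q. sublinear s q \<and> q \<le> p}" and ?P = "\<lambda>a b :: 'b \<Rightarrow> real. b \<le> a"
  have "\<exists>m\<in>?A. \<forall>a\<in>?A. ?P m a \<longrightarrow> a = m"
  proof (rule predicate_Zorn)
    show "partial_order_on ?A (relation_of ?P ?A)"
      by (rule partial_order_on_relation_ofI) auto
  next
    fix C assume C: "C \<in> Chains (relation_of ?P ?A)"
    then have sub: "C \<subseteq> ?A" by (auto simp: Chains_def relation_of_def)
    have tot: "a \<le> b \<or> b \<le> a" if "a \<in> C" "b \<in> C" for a b
      using C that by (auto simp: Chains_def relation_of_def)
    show "\<exists>u\<in>?A. \<forall>a\<in>C. ?P a u"
    proof (cases "C = {}")
      case True
      then show ?thesis using p by auto
    next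
      case False
      define u where "u x = (INF a\<in>C. a x)" for x
      have lb: "- p (- x) \<le> a x" if "a \<in> C" for a x
        using sublinear_lower_bound[OF vs, of a x] sub that le_funD[of a p "- x"] by fastforce
      have bdd: "bdd_below ((\<lambda>a. a x) ` C)" for x
        by (rule bdd_belowI[of _ "- p (- x)"]) (use lb in auto)
      have up: "u x \<le> a x" if "a \<in> C" for a x
        unfolding u_def by (rule cINF_lower[OF bdd that])
      have gl: "z \<le> u x" if "\<And>a. a \<in> C \<Longrightarrow> z \<le> a x" for z x
        unfolding u_def by (rule cINF_greatest[OF False that])
      have "u (x + y) \<le> u x + u y" for x y
      proof -
        have "u (x + y) - a x \<le> b y" if "a \<in> C" "b \<in> C" for a b
        proof -
          have "\<exists>c\<in>C. c \<le> a \<and> c \<le> b" using tot[OF that] that by blast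
          then obtain c where c: "c \<in> C" "c \<le> a" "c \<le> b" by blast
          then have "c (x + y) \<le> c x + c y" using sub by (auto simp: sublinear_def)
          then show ?thesis
            using up[OF c(1), of "x + y"] c(2,3) by (smt (verit) le_funD)
        qed
        then have "u (x + y) - a x \<le> u y" if "a \<in> C" for a
          using that by (intro gl)
        then have "u (x + y) - u y \<le> u x" by (intro gl) (smt (verit))
        then show ?thesis by simp
      qed
      moreover have "u (s t x) = t * u x" if "t \<ge> 0" for t x
      proof -
        have h: "a (s t x) = t * a x" if "a \<in> C" for a
          using sub that \<open>t \<ge> 0\<close> by (auto simp: sublinear_def)
        show ?thesis
        proof (cases "t = 0")
          case True
          then have "a (s 0 x) = 0" if "a \<in> C" for a using h that by simp
          then have "(\<lambda>a. a (s 0 x)) ` C = {0}" using False by force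
          then show ?thesis using True by (simp add: u_def)
        next
          case f: False
          with that have t: "t > 0" by simp
          have "u (s t x) / t \<le> u x"
          proof (rule gl)
            fix a assume "a \<in> C"
            then show "u (s t x) / t \<le> a x" using up[of a "s t x"] h[of a] t by (simp add: field_simps)
          qed
          moreover have "t * u x \<le> u (s t x)"
          proof (rule gl)
            fix a assume "a \<in> C"
            then show "t * u x \<le> a (s t x)" using h[of a] mult_left_mono[OF up[of a x] that] by simp
          qed
          ultimately show ?thesis using t by (simp add: field_simps)
        qed
      qed
      ultimately have "sublinear s u" by (simp add: sublinear_def)
      moreover have "u \<le> p"
      proof -
        obtain a where a: "a \<in> C" using False by blast
        then have "u \<le> a" using up by (intro le_funI)
        then show ?thesis using a sub by fastforce
      qed
      ultimately show ?thesis using up by (auto simp: le_fun_def)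
    qed
  qed
  then show ?thesis by auto
qed

lemma minimal_sublinear_additive:
  assumes vs: "vector_space s" and q: "sublinear s q"
    and min: "\<And>r. sublinear s r \<Longrightarrow> r \<le> q \<Longrightarrow> r = q"
  shows "q (x + y) = q x + q y"
proof -
  interpret vector_space s by fact
  let ?r = "\<lambda>x. INF t\<in>{0..}. q (x + s t y) - t * q y"
  note r = sublinear_shift[OF vs q, where y = y]
  have "?r \<le> q" using r(2)[of 0] by (auto simp: le_fun_def)
  then have "?r = q" using r(1) by (intro min)
  then have "q x = ?r x" by (metis (no_types))
  \<comment> \<open>Evaluating the shift at \<open>t = 1\<close> yields superadditivity; the other
    inequality is part of sublinearity.\<close>
  then have "q x \<le> q (x + y) - q y" using r(2)[of 1 x] by simp
  then show ?thesis using q by (simp add: sublinear_def) (smt (verit))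
qed

text \<open>Minimising below the shift of \<open>p\<close> by \<open>v\<close>, rather than below
  \<open>p\<close>, produces equality at \<open>v\<close>: the shift is at most
  \<open>p 0 - p v\<close> at \<open>- v\<close>, so \<open>u v \<ge> p v\<close>, and
  \<open>u\<close> lies below \<open>p\<close> anyway.\<close>

theorem Hahn_Banach_real:
  fixes s :: "real \<Rightarrow> 'b::ab_group_add \<Rightarrow> 'b"
  assumes vs: "vector_space s" and p: "sublinear s p"
  obtains u where "\<And>x y. u (x + y) = u x + u y" "\<And>t x. u (s t x) = t * u x"
    "\<And>x. u x \<le> p x" "u v = p v"
proof -
  interpret vector_space s by fact
  note r = sublinear_shift[OF vs p, where y = v]
  let ?r = "\<lambda>x. INF t\<in>{0..}. p (x + s t v) - t * p v"
  obtain u where u: "sublinear s u" "u \<le> ?r" and min: "\<And>w. sublinear s w \<Longrightarrow> w \<le> u \<Longrightarrow> w = u"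
    using exists_minimal_sublinear[OF vs r(1)] by blast
  have add: "u (x + y) = u x + u y" for x y
    by (rule minimal_sublinear_additive[OF vs u(1) min])
  then have u0: "u 0 = 0" by (metis add_cancel_left_left)
  then have neg: "u (- x) = - u x" for x
    using add[of x "- x"] by simp
  have hom: "u (s t x) = t * u x" for t x
  proof (cases "t \<ge> 0")
    case True
    then show ?thesis using u(1) by (simp add: sublinear_def)
  next
    case False
    then have "u (s (- t) x) = - t * u x" using u(1) unfolding sublinear_def by (metis less_eq_real_def neg_0_le_iff_le not_le)
    then show ?thesis by (simp add: neg)
  qed
  have le: "u x \<le> p x" for x
    using le_funD[OF u(2), of x] r(2)[of 0 x] by simp
  have "p (s 0 0) = 0 * p 0" using p unfolding sublinear_def by blast
  then have p0: "p 0 = 0" by simp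
  have "u (- v) \<le> - p v"
    using le_funD[OF u(2), of "- v"] r(2)[of 1 "- v"] p0 by simp
  then have "u v = p v" using le[of v] neg[of v] by simp
  then show ?thesis using that add hom le by blast
qed

section \<open>Seminorms over real or complex scalars and the Hahn-Banach theorem for them\<close>

locale rc_vector_space = vector_space scale
  for scale :: "'k::real_or_complex \<Rightarrow> 'b::ab_group_add \<Rightarrow> 'b"
begin

lemma seminorm_add: "seminorm scale p \<Longrightarrow> p (x + y) \<le> p x + p y"
  and seminorm_scale: "seminorm scale p \<Longrightarrow> p (scale c x) = norm c * p x"
  by (auto simp: seminorm_def)

lemma seminorm_zero: "seminorm scale p \<Longrightarrow> p 0 = 0"
  using seminorm_scale[of p 0 0] by simp

lemma seminorm_minus: "seminorm scale p \<Longrightarrow> p (- x) = p x"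
  using seminorm_scale[of p "-1" x] by simp

lemma seminorm_nonneg: "seminorm scale p \<Longrightarrow> 0 \<le> p x"
  using seminorm_add[of p x "- x"] seminorm_minus[of p x] seminorm_zero[of p] by simp

lemma seminorm_diff: "seminorm scale p \<Longrightarrow> p (x - y) \<le> p x + p y"
  using seminorm_add[of p x "- y"] seminorm_minus[of p y] by simp

lemma seminorm_diff_commute: "seminorm scale p \<Longrightarrow> p (x - y) = p (y - x)"
  using seminorm_minus[of p "x - y"] by simp

lemma seminorm_triangle: "seminorm scale p \<Longrightarrow> p (x - z) \<le> p (x - y) + p (y - z)"
  using seminorm_add[of p "x - y" "y - z"] by simp

lemma seminorm_sum:
  assumes "seminorm scale p"
  shows "p (sum g A) \<le> (\<Sum>i\<in>A. p (g i))"
proof (induction A rule: infinite_finite_induct)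
  case (insert i A)
  then show ?case using seminorm_add[OF assms, of "g i" "sum g A"] by simp
qed (simp_all add: seminorm_zero[OF assms])

lemma seminorm_plus_fun: "seminorm scale p \<Longrightarrow> seminorm scale q \<Longrightarrow> seminorm scale (\<lambda>x. p x + q x)"
  using add_mono[OF seminorm_add[of p] seminorm_add[of q]]
  by (simp add: seminorm_def distrib_left add.commute add.left_commute)

lemma seminorm_mult_fun: "seminorm scale p \<Longrightarrow> C \<ge> 0 \<Longrightarrow> seminorm scale (\<lambda>x. C * p x)"
  using mult_left_mono[OF seminorm_add[of p]]
  by (simp add: seminorm_def distrib_left mult.left_commute)

lemma seminorm_zero_fun: "seminorm scale (\<lambda>x. 0)"
  unfolding seminorm_def by simp

lemma seminorm_sum_fun:
  "(\<And>i. i \<in> A \<Longrightarrow> seminorm scale (P i)) \<Longrightarrow> seminorm scale (\<lambda>x. \<Sum>i\<in>A. P i x)"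
proof (induction A rule: infinite_finite_induct)
  case (insert i A)
  then show ?case using seminorm_plus_fun[of "P i" "\<lambda>x. \<Sum>i\<in>A. P i x"] by simp
qed (auto simp: seminorm_zero_fun)

lemma seminorm_compose:
  assumes "seminorm s' q" "Vector_Spaces.linear scale s' L"
  shows "seminorm scale (\<lambda>x. q (L x))"
proof -
  interpret L: Vector_Spaces.linear scale s' L by fact
  show ?thesis using assms(1) by (auto simp: seminorm_def L.add L.scale)
qed

text \<open>A real functional that equals \<open>p\<close> at \<open>v\<close> is made linear over
  \<open>'k\<close>, by \<open>u x - i * u (i x)\<close> in the complex case, and then divided by
  its value at \<open>v\<close>; hence the constant \<open>1 / norm (g v)\<close> for
  \<open>C\<close>.\<close>

theorem Hahn_Banach:
  assumes p: "seminorm scale p" and v: "p v \<noteq> 0"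
  obtains f C where "Vector_Spaces.linear scale (*) f" "f v = 1" "\<And>x. norm (f x) \<le> C * p x"
proof -
  let ?r = "\<lambda>t. scale (of_real t)"
  interpret R: vector_space ?r
    by unfold_locales (auto simp: scale_right_distrib scale_left_distrib)
  have "sublinear ?r p"
    using p by (auto simp: sublinear_def seminorm_def)
  then obtain u where add: "\<And>x y. u (x + y) = u x + u y" and hom: "\<And>t x. u (?r t x) = t * u x"
    and le: "\<And>x. u x \<le> p x" and uv: "u v = p v"
    by (rule Hahn_Banach_real[OF R.vector_space_axioms, of p v]) blast
  \<comment> \<open>The last clause stands for \<open>u\<close> being the real part of
    \<open>g\<close>. It says so only where \<open>g\<close> has real values, which makes sense for
    both kinds of scalars and is enough to bound \<open>g\<close>.\<close>
  have "\<exists>g::'b \<Rightarrow> 'k. (\<forall>x y. g (x + y) = g x + g y) \<and> (\<forall>c x. g (scale c x) = c * g x) \<and>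
    (\<forall>x t. g x = of_real t \<longrightarrow> t = u x)"
  proof (rule real_or_complex_cases[where 'k = 'k])
    assume K: "\<And>c::'k. \<exists>a. c = of_real a"
    have "of_real (u (scale c x)) = c * of_real (u x)" for c x
    proof -
      obtain a where "c = of_real a" using K by blast
      then show ?thesis by (simp add: hom)
    qed
    then show ?thesis
      by (intro exI[of _ "\<lambda>x. of_real (u x)"]) (simp add: add)
  next
    fix i :: 'k assume ii: "i * i = -1" and K: "\<And>c. \<exists>a b. c = of_real a + of_real b * i"
    define g :: "'b \<Rightarrow> 'k" where "g x = of_real (u x) - i * of_real (u (scale i x))" for x
    have ga: "g (x + y) = g x + g y" for x y
      by (simp add: g_def add scale_right_distrib algebra_simps)
    have gr: "g (?r t x) = of_real t * g x" for t x
    proof -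
      have "u (scale i (?r t x)) = t * u (scale i x)"
        using hom[of t "scale i x"] by (simp add: mult.commute)
      then show ?thesis by (simp add: g_def hom algebra_simps)
    qed
    have neg: "u (- x) = - u x" for x using hom[of "-1" x] by simp
    have gi: "g (scale i x) = i * g x" for x
    proof -
      have "g (scale i x) = of_real (u (scale i x)) - i * of_real (u (scale (i * i) x))"
        by (simp add: g_def)
      also have "\<dots> = of_real (u (scale i x)) + i * of_real (u x)"
        by (simp add: ii neg)
      also have "\<dots> = i * of_real (u x) - (i * i) * of_real (u (scale i x))" by (simp add: ii)
      finally show ?thesis by (simp add: g_def algebra_simps)
    qed
    have gs: "g (scale c x) = c * g x" for c x
    proof -
      obtain a b where c: "c = of_real a + of_real b * i" using K by blast
      have "g (scale c x) = g (?r a x) + g (?r b (scale i x))"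
        by (simp add: c scale_left_distrib ga)
      then show ?thesis unfolding gr gi by (simp add: c algebra_simps)
    qed
    \<comment> \<open>A non-zero imaginary part would express \<open>i\<close> as a real scalar, and
      a real square is not -1.\<close>
    have "t = u x" if "g x = of_real t" for x t
    proof (rule ccontr)
      assume "t \<noteq> u x"
      define y where "y = u (scale i x)"
      have e: "i * of_real y = of_real (u x - t)" using that by (simp add: g_def y_def algebra_simps)
      then have "y \<noteq> 0" using \<open>t \<noteq> u x\<close> by auto
      then have "i = of_real ((u x - t) / y)" using e by (simp add: field_simps)
      then have "of_real ((u x - t) / y * ((u x - t) / y)) = (of_real (-1) :: 'k)"
        using ii by (metis of_real_1 of_real_minus of_real_mult)
      then have "(u x - t) / y * ((u x - t) / y) = -1" by (simp only: of_real_eq_iff)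
      then show False by (metis not_square_less_zero zero_less_one neg_less_0_iff_less)
    qed
    then show ?thesis using ga gs by (intro exI[of _ g]) blast
  qed
  then obtain g :: "'b \<Rightarrow> 'k" where ga: "\<And>x y. g (x + y) = g x + g y"
    and gs: "\<And>c x. g (scale c x) = c * g x" and gu: "\<And>x t. g x = of_real t \<Longrightarrow> t = u x"
    by blast
  have gle: "norm (g x) \<le> p x" for x
  proof (cases "g x = 0")
    case True
    then show ?thesis using seminorm_nonneg[OF p] by simp
  next
    case False
    \<comment> \<open>Multiplying \<open>x\<close> by this phase makes the value of \<open>g\<close>
      real and non-negative, so that it is a value of \<open>u\<close>.\<close>
    define c where "c = of_real (norm (g x)) / g x"
    have c: "norm c = 1" using False by (simp add: c_def norm_divide)
    have "g (scale c x) = of_real (norm (g x))" using False by (simp add: gs c_def)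
    then have "norm (g x) = u (scale c x)" by (rule gu)
    also have "\<dots> \<le> p x" using le[of "scale c x"] c by (simp add: seminorm_scale[OF p])
    finally show ?thesis .
  qed
  have gv: "g v \<noteq> 0"
  proof
    assume "g v = 0"
    then have "u v = 0" using gu[of v 0] by simp
    then show False using uv v by simp
  qed
  show ?thesis
  proof (rule that)
    show "Vector_Spaces.linear scale (*) (\<lambda>x. g x / g v)"
      by (intro Vector_Spaces.linear.intro module_hom.intro module_hom_axioms.intro
          vector_space_axioms module_axioms) (unfold_locales, auto simp: ga gs add_divide_distrib algebra_simps)
    show "norm (g x / g v) \<le> 1 / norm (g v) * p x" for x
      using gle[of x] gv by (simp add: norm_divide divide_simps)
  qed (use gv in auto)
qed

end

section \<open>Biorthogonal systems\<close>

lemma (in vector_space) linear_to_iff: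
  assumes "vector_space s'"
  shows "Vector_Spaces.linear scale s' f \<longleftrightarrow>
    (\<forall>x y. f (x + y) = f x + f y) \<and> (\<forall>c x. f (scale c x) = s' c (f x))"
proof
  assume "Vector_Spaces.linear scale s' f"
  then interpret Vector_Spaces.linear scale s' f .
  show "(\<forall>x y. f (x + y) = f x + f y) \<and> (\<forall>c x. f (scale c x) = s' c (f x))"
    using add scale by blast
next
  assume f: "(\<forall>x y. f (x + y) = f x + f y) \<and> (\<forall>c x. f (scale c x) = s' c (f x))"
  interpret s': vector_space s' by fact
  show "Vector_Spaces.linear scale s' f"
    by unfold_locales (use f in auto)
qed

context rc_vector_space
begin

abbreviation functional :: "('b \<Rightarrow> 'k) \<Rightarrow> bool" where
  "functional \<equiv> Vector_Spaces.linear scale (*)"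

lemma vector_space_mult: "vector_space ((*) :: 'k \<Rightarrow> 'k \<Rightarrow> 'k)"
  by unfold_locales (auto simp: algebra_simps)

lemma functional_iff:
  "functional f \<longleftrightarrow> (\<forall>x y. f (x + y) = f x + f y) \<and> (\<forall>c x. f (scale c x) = c * f x)"
  by (rule linear_to_iff[OF vector_space_mult])

lemma functional_add: "functional f \<Longrightarrow> f (x + y) = f x + f y"
  and functional_scale: "functional f \<Longrightarrow> f (scale c x) = c * f x"
  by (simp_all add: functional_iff)

lemma functional_sum: "functional f \<Longrightarrow> f (sum g A) = (\<Sum>i\<in>A. f (g i))"
  by (rule module_hom.sum) (rule Vector_Spaces.linear.axioms)

lemma functional_diff: "functional f \<Longrightarrow> f (x - y) = f x - f y"
  by (rule module_hom.diff) (rule Vector_Spaces.linear.axioms)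

lemma functional_zero: "functional f \<Longrightarrow> f 0 = 0"
  by (rule module_hom.zero) (rule Vector_Spaces.linear.axioms)

text \<open>For a biorthogonal system this is the projection onto the common kernel of the first
  \<open>k\<close> functionals along the span of the first \<open>k\<close> vectors.\<close>

definition remainder :: "(nat \<Rightarrow> 'b) \<Rightarrow> (nat \<Rightarrow> 'b \<Rightarrow> 'k) \<Rightarrow> nat \<Rightarrow> 'b \<Rightarrow> 'b" where
  "remainder e f k x = x - (\<Sum>l<k. scale (f l x) (e l))"

lemma remainder_in:
  assumes "subspace V" "\<And>l. l < k \<Longrightarrow> e l \<in> V" "x \<in> V"
  shows "remainder e f k x \<in> V"
  unfolding remainder_def
  using assms by (intro subspace_diff subspace_sum subspace_scale) auto

lemma functional_remainder:
  assumes "\<And>l. l < k \<Longrightarrow> functional (f l)"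
    and "\<And>i l. i < k \<Longrightarrow> l < k \<Longrightarrow> f i (e l) = (if i = l then 1 else 0)" and "j < k"
  shows "f j (remainder e f k x) = 0"
proof -
  have "f j (remainder e f k x) = f j x - (\<Sum>l<k. f l x * f j (e l))"
    using assms by (simp add: remainder_def functional_diff functional_sum functional_scale)
  also have "(\<Sum>l<k. f l x * f j (e l)) = (\<Sum>l<k. if l = j then f j x else 0)"
    by (rule sum.cong) (auto simp: assms)
  finally show ?thesis using assms(3) by simp
qed

text \<open>
  \<open>\<mu>'\<close> is the least index of a seminorm that does not vanish on the common kernel of the previous
  functionals, and \<open>v\<close> is the next vector of a dense sequence to be approximated.
\<close>

lemma exists_biorthogonal_extension:
  fixes e :: "nat \<Rightarrow> 'b" and f :: "nat \<Rightarrow> 'b \<Rightarrow> 'k" and p :: "nat \<Rightarrow> 'b \<Rightarrow> real" and \<mu> :: "nat \<Rightarrow> nat"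
  assumes V: "subspace V" and p: "\<And>m. seminorm scale (p m)"
    and mono: "\<And>m n x. m \<le> n \<Longrightarrow> p m x \<le> p n x"
    and sep: "\<And>x. x \<in> V \<Longrightarrow> (\<And>m. p m x = 0) \<Longrightarrow> x = 0"
    and inf: "\<not> finite_dimensional_on scale V"
    and e: "\<And>l. l < k \<Longrightarrow> e l \<in> V" and f: "\<And>l. l < k \<Longrightarrow> functional (f l)"
    and bd: "\<And>l. l < k \<Longrightarrow> \<exists>C. \<forall>x. norm (f l x) \<le> C * p (\<mu> l) x"
    and bi: "\<And>i l. i < k \<Longrightarrow> l < k \<Longrightarrow> f i (e l) = (if i = l then 1 else 0)"
    and van: "\<And>l x m. l < k \<Longrightarrow> x \<in> V \<Longrightarrow> (\<And>i. i < l \<Longrightarrow> f i x = 0) \<Longrightarrow> m < \<mu> l \<Longrightarrow> p m x = 0"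
    and v: "v \<in> V" and \<epsilon>: "\<epsilon> > 0"
  obtains e' f' \<mu>' z where "e' \<in> V" "functional f'" "\<exists>C. \<forall>x. norm (f' x) \<le> C * p \<mu>' x"
    "f' e' = 1" "\<And>l. l < k \<Longrightarrow> f' (e l) = 0" "\<And>l. l < k \<Longrightarrow> f l e' = 0"
    "\<And>x m. x \<in> V \<Longrightarrow> (\<And>i. i < k \<Longrightarrow> f i x = 0) \<Longrightarrow> m < \<mu>' \<Longrightarrow> p m x = 0"
    "p \<mu>' e' \<noteq> 0" "p k (v - z) < \<epsilon>" "z - e' \<in> span (e ` {..<k})"
proof -
  define K where "K = {x \<in> V. \<forall>i<k. f i x = 0}"
  let ?r = "remainder e f k"
  have K: "subspace K"
    using V f unfolding K_def subspace_def
    by (auto simp: functional_add functional_scale functional_zero)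
  have rK: "?r x \<in> K" if "x \<in> V" for x
    using remainder_in[OF V e that] functional_remainder[OF f bi] by (auto simp: K_def)
  have "\<exists>x\<in>K. x \<noteq> 0"
  proof (rule ccontr)
    assume "\<not> (\<exists>x\<in>K. x \<noteq> 0)"
    then have r0: "?r x = 0" if "x \<in> V" for x using rK that by blast
    have "V \<subseteq> span (e ` {..<k})"
    proof
      fix x assume "x \<in> V"
      then have "x = (\<Sum>l<k. scale (f l x) (e l))" using r0 by (simp add: remainder_def)
      also have "\<dots> \<in> span (e ` {..<k})" by (intro span_sum span_scale span_base) auto
      finally show "x \<in> span (e ` {..<k})" .
    qed
    moreover have "span (e ` {..<k}) \<subseteq> V" using e by (intro span_minimal V) auto
    ultimately have "finite_dimensional_on scale V"
      unfolding finite_dimensional_on_def using e by (intro exI[of _ "e ` {..<k}"]) auto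
    then show False using inf by simp
  qed
  then obtain x0 m0 where x0: "x0 \<in> K" "p m0 x0 \<noteq> 0"
    using sep unfolding K_def by blast
  define \<mu>' where "\<mu>' = (LEAST m. \<exists>x\<in>K. p m x \<noteq> 0)"
  have "\<exists>x\<in>K. p \<mu>' x \<noteq> 0"
    unfolding \<mu>'_def by (rule LeastI[of _ m0]) (use x0 in blast)
  then obtain h where h: "h \<in> K" "p \<mu>' h \<noteq> 0" by blast
  have less: "p m x = 0" if "m < \<mu>'" "x \<in> K" for m x
    using not_less_Least[of m "\<lambda>m. \<exists>x\<in>K. p m x \<noteq> 0"] that unfolding \<mu>'_def by blast
  \<comment> \<open>Multiples of \<open>h\<close> up to \<open>t\<close> move a vector by less than
    \<epsilon> in \<open>p k\<close>.\<close>
  define t where "t = \<epsilon> / (1 + p k h)"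
  have pk: "p k h \<ge> 0" by (rule seminorm_nonneg[OF p])
  have t: "t > 0" using \<epsilon> pk by (simp add: t_def)
  have tb: "t * p k h < \<epsilon>" using \<epsilon> pk by (simp add: t_def field_simps)
  \<comment> \<open>The remainder of \<open>v\<close> may be null for \<open>p \<mu>'\<close>; a
    small multiple of \<open>h\<close> repairs this. If two different multiples failed, subtracting
    them would make \<open>h\<close> null.\<close>
  have "\<exists>c. 0 < c \<and> c \<le> t \<and> p \<mu>' (?r v + scale (of_real c) h) \<noteq> 0"
  proof (rule ccontr)
    assume "\<not> ?thesis"
    then have *: "p \<mu>' (?r v + scale (of_real c) h) = 0" if "0 < c" "c \<le> t" for c
      using that by blast
    define u where "u = t / 2"
    have u: "0 < u" "u \<le> t" "t - u = u" using t by (auto simp: u_def)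
    have "p \<mu>' ((?r v + scale (of_real t) h) - (?r v + scale (of_real u) h)) \<le> 0"
      using seminorm_diff[OF p, of \<mu>' "?r v + scale (of_real t) h" "?r v + scale (of_real u) h"]
        *[OF t] *[OF u(1,2)] by simp
    moreover have "(?r v + scale (of_real t) h) - (?r v + scale (of_real u) h) = scale (of_real u) h"
      unfolding add_diff_cancel_left scale_left_diff_distrib[symmetric] of_real_diff[symmetric] u(3) ..
    ultimately have "u * p \<mu>' h \<le> 0"
      using u(1) seminorm_scale[OF p, of \<mu>' "of_real u" h] by simp
    then show False using u(1) h(2) seminorm_nonneg[OF p, of \<mu>' h] by (simp add: mult_le_0_iff)
  qed
  then obtain c where c: "0 < c" "c \<le> t" "p \<mu>' (?r v + scale (of_real c) h) \<noteq> 0" by blast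
  define e' where "e' = ?r v + scale (of_real c) h"
  have e'K: "e' \<in> K"
    unfolding e'_def by (intro subspace_add[OF K] subspace_scale[OF K] rK v h)
  obtain g D where g: "functional g" "g e' = 1" and gD: "\<And>x. norm (g x) \<le> D * p \<mu>' x"
    using Hahn_Banach[OF p c(3)] unfolding e'_def by blast
  have g': "norm (g x) \<le> \<bar>D\<bar> * p \<mu>' x" for x
    by (rule order_trans[OF gD mult_right_mono]) (simp_all add: seminorm_nonneg[OF p])
  have re': "?r e' = e'"
    using e'K by (simp add: remainder_def K_def)
  have rfun: "?r (x + y) = ?r x + ?r y" "?r (scale a x) = scale a (?r x)" for x y a
    using f by (auto simp: remainder_def functional_add functional_scale scale_left_distrib
        sum.distrib scale_right_diff_distrib scale_sum_right)
  have re: "?r (e l) = 0" if "l < k" for l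
  proof -
    have "(\<Sum>i<k. scale (f i (e l)) (e i)) = (\<Sum>i<k. if i = l then e l else 0)"
      by (rule sum.cong) (auto simp: bi that)
    then show ?thesis using that by (simp add: remainder_def)
  qed
  obtain C where C: "\<And>l x. l < k \<Longrightarrow> norm (f l x) \<le> C l * p (\<mu> l) x"
    using bd by metis
  \<comment> \<open>\<open>h\<close> lies in the kernel of all earlier functionals, where
    \<open>p m\<close> vanishes for \<open>m < \<mu> l\<close>, but \<open>p \<mu>' h\<close> is
    non-zero.\<close>
  have \<mu>le: "\<mu> l \<le> \<mu>'" if "l < k" for l
    using van[OF that, of h \<mu>'] h that by (force simp: K_def)
  have Cb: "norm (f l x) \<le> \<bar>C l\<bar> * p \<mu>' x" if "l < k" for l x
  proof -
    have "norm (f l x) \<le> \<bar>C l\<bar> * p (\<mu> l) x"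
      using C[OF that, of x] seminorm_nonneg[OF p, of "\<mu> l" x] by (meson abs_ge_self mult_right_mono order_trans)
    also have "\<dots> \<le> \<bar>C l\<bar> * p \<mu>' x"
      by (intro mult_left_mono mono \<mu>le that) simp
    finally show ?thesis .
  qed
  \<comment> \<open>The new functional is \<open>g\<close> composed with the remainder, which kills
    the earlier \<open>e l\<close>. It stays bounded by \<open>p \<mu>'\<close> because the earlier
    orders do not exceed \<open>\<mu>'\<close>.\<close>
  let ?C = "\<bar>D\<bar> * (1 + (\<Sum>l<k. \<bar>C l\<bar> * p \<mu>' (e l)))"
  have "norm (g (?r x)) \<le> ?C * p \<mu>' x" for x
  proof -
    have "p \<mu>' (?r x) \<le> p \<mu>' x + p \<mu>' (\<Sum>l<k. scale (f l x) (e l))"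
      unfolding remainder_def by (rule seminorm_diff[OF p])
    also have "p \<mu>' (\<Sum>l<k. scale (f l x) (e l)) \<le> (\<Sum>l<k. norm (f l x) * p \<mu>' (e l))"
      using seminorm_sum[OF p, of \<mu>' "\<lambda>l. scale (f l x) (e l)" "{..<k}"] by (simp add: seminorm_scale[OF p])
    also have "\<dots> \<le> (\<Sum>l<k. \<bar>C l\<bar> * p \<mu>' x * p \<mu>' (e l))"
      by (intro sum_mono mult_right_mono Cb seminorm_nonneg[OF p]) auto
    finally have "p \<mu>' (?r x) \<le> (1 + (\<Sum>l<k. \<bar>C l\<bar> * p \<mu>' (e l))) * p \<mu>' x"
      by (simp add: sum_distrib_right sum_distrib_left algebra_simps)
    then have "\<bar>D\<bar> * p \<mu>' (?r x) \<le> ?C * p \<mu>' x" by (simp add: mult_left_mono mult.assoc)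
    then show ?thesis using g'[of "?r x"] by linarith
  qed
  moreover have "functional (\<lambda>x. g (?r x))"
    using g(1) by (simp add: functional_iff rfun)
  moreover have "g (?r e') = 1" using re' g(2) by simp
  moreover have "g (?r (e l)) = 0" if "l < k" for l
    using re[OF that] functional_zero[OF g(1)] by simp
  moreover have "p m x = 0" if "x \<in> V" "\<And>i. i < k \<Longrightarrow> f i x = 0" "m < \<mu>'" for x m
    using less[OF that(3), of x] that by (simp add: K_def)
  \<comment> \<open>The witness for \<open>z\<close> is \<open>v\<close> shifted by the multiple of
    \<open>h\<close>; it differs from \<open>e'\<close> only by a combination of earlier
    vectors.\<close>
  moreover have "p k (v - (v + scale (of_real c) h)) < \<epsilon>"
  proof -
    have "p k (v - (v + scale (of_real c) h)) = c * p k h"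
      using c(1) by (simp add: seminorm_minus[OF p] seminorm_scale[OF p])
    also have "\<dots> \<le> t * p k h" using c(2) pk by (rule mult_right_mono)
    finally show ?thesis using tb by simp
  qed
  moreover have "(v + scale (of_real c) h) - e' \<in> span (e ` {..<k})"
  proof -
    have "(v + scale (of_real c) h) - e' = (\<Sum>l<k. scale (f l v) (e l))"
      by (simp add: e'_def remainder_def)
    also have "\<dots> \<in> span (e ` {..<k})" by (intro span_sum span_scale span_base) auto
    finally show ?thesis .
  qed
  ultimately show ?thesis
    using e'K c(3) by (intro that[of e' "\<lambda>x. g (?r x)" \<mu>' "v + scale (of_real c) h"])
      (auto simp: K_def e'_def)
qed

text \<open>The orders \<open>\<mu>\<close> record which seminorm bounds each functional. Choosing
  them minimal at each stage makes them monotone and makes remainders null below the current order;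
  both facts decide later which series operators are continuous.\<close>

theorem exists_biorthogonal_system:
  fixes p :: "nat \<Rightarrow> 'b \<Rightarrow> real"
  assumes V: "subspace V" and p: "\<And>m. seminorm scale (p m)"
    and mono: "\<And>m n x. m \<le> n \<Longrightarrow> p m x \<le> p n x"
    and sep: "\<And>x. x \<in> V \<Longrightarrow> (\<And>m. p m x = 0) \<Longrightarrow> x = 0"
    and inf: "\<not> finite_dimensional_on scale V"
    and D: "countable D" "D \<subseteq> V" and dense: "\<And>x m \<epsilon>. x \<in> V \<Longrightarrow> \<epsilon> > 0 \<Longrightarrow> \<exists>d\<in>D. p m (x - d) < \<epsilon>"
  obtains e :: "nat \<Rightarrow> 'b" and f :: "nat \<Rightarrow> 'b \<Rightarrow> 'k" and \<mu> :: "nat \<Rightarrow> nat" and Z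
  where "\<And>k. e k \<in> V" "\<And>k. functional (f k)" "\<And>k. \<exists>C. \<forall>x. norm (f k x) \<le> C * p (\<mu> k) x"
    "\<And>j k. f j (e k) = (if j = k then 1 else 0)" "mono \<mu>"
    "\<And>k m x. x \<in> V \<Longrightarrow> m < \<mu> k \<Longrightarrow> p m (remainder e f k x) = 0"
    "countable Z" "Z \<subseteq> span (range e)"
    "\<And>x m \<epsilon>. x \<in> V \<Longrightarrow> \<epsilon> > 0 \<Longrightarrow> \<exists>z\<in>Z. p m (x - z) < \<epsilon>"
proof -
  have "D \<noteq> {}" using dense[of 0 1 0] subspace_0[OF V] by auto
  then have v: "range (from_nat_into D) = D" using D(1) by (rule range_from_nat_into)
  define v where "v = from_nat_into D"
  note v = v[folded v_def]
  \<comment> \<open>The pairing lets every vector of the dense sequence reappear at infinitely many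
    stages, hence with arbitrarily small error in arbitrarily strong seminorms.\<close>
  define d where "d k = v (fst (prod_decode k))" for k
  have d: "d k \<in> V" for k using v D(2) by (auto simp: d_def)
  define E F M where "E = (\<lambda>r :: 'b \<times> ('b \<Rightarrow> 'k) \<times> nat \<times> 'b. fst r)"
    and "F = (\<lambda>r :: 'b \<times> ('b \<Rightarrow> 'k) \<times> nat \<times> 'b. fst (snd r))"
    and "M = (\<lambda>r :: 'b \<times> ('b \<Rightarrow> 'k) \<times> nat \<times> 'b. fst (snd (snd r)))"
  define S where "S = (\<lambda>r :: 'b \<times> ('b \<Rightarrow> 'k) \<times> nat \<times> 'b. snd (snd (snd r)))"
  define P where "P h k r \<longleftrightarrow> E r \<in> V \<and> functional (F r) \<and> (\<exists>C. \<forall>x. norm (F r x) \<le> C * p (M r) x) \<and>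
    F r (E r) = 1 \<and> (\<forall>l<k. F r (E (h l)) = 0 \<and> F (h l) (E r) = 0) \<and>
    (\<forall>x\<in>V. (\<forall>i<k. F (h i) x = 0) \<longrightarrow> (\<forall>m<M r. p m x = 0)) \<and> p (M r) (E r) \<noteq> 0 \<and>
    p k (d k - S r) < 1 / real (Suc k) \<and> S r - E r \<in> span ((\<lambda>l. E (h l)) ` {..<k})" for h k r
  have "\<exists>h. \<forall>k. P h k (h k)"
  \<comment> \<open>A stage is a tuple of vector, functional, order and approximant, and depends on
    all earlier stages.\<close>
  proof (rule dependent_wellorder_choice)
    fix r and f g :: "nat \<Rightarrow> 'b \<times> ('b \<Rightarrow> 'k) \<times> nat \<times> 'b" and x :: nat
    assume eq: "\<And>y. y < x \<Longrightarrow> f y = g y"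
    have "(\<lambda>l. E (f l)) ` {..<x} = (\<lambda>l. E (g l)) ` {..<x}"
      using eq by (intro image_cong) auto
    then show "P f x r = P g x r"
      using eq unfolding P_def by simp
  next
    fix k and h :: "nat \<Rightarrow> 'b \<times> ('b \<Rightarrow> 'k) \<times> nat \<times> 'b"
    assume "\<And>y. y < k \<Longrightarrow> P h y (h y)"
    then have P: "\<And>y. y < k \<Longrightarrow> P h y (h y)" by blast
    have bi: "F (h i) (E (h l)) = (if i = l then 1 else 0)" if "i < k" "l < k" for i l
      using P[OF that(1)] P[OF that(2)] unfolding P_def by (metis linorder_neqE_nat)
    show "\<exists>r. P h k r"
    proof (rule exists_biorthogonal_extension[OF V p mono sep inf,
          where k = k and e = "\<lambda>l. E (h l)" and f = "\<lambda>l. F (h l)" and \<mu> = "\<lambda>l. M (h l)"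
          and v = "d k" and \<epsilon> = "1 / real (Suc k)"])
      fix e' f' \<mu>' z
      assume *: "e' \<in> V" "functional f'" "\<exists>C. \<forall>x. norm (f' x) \<le> C * p \<mu>' x"
        "f' e' = 1" "\<And>l. l < k \<Longrightarrow> f' (E (h l)) = 0" "\<And>l. l < k \<Longrightarrow> F (h l) e' = 0"
        "\<And>x m. x \<in> V \<Longrightarrow> (\<And>i. i < k \<Longrightarrow> F (h i) x = 0) \<Longrightarrow> m < \<mu>' \<Longrightarrow> p m x = 0"
        "p \<mu>' e' \<noteq> 0" "p k (d k - z) < 1 / real (Suc k)" "z - e' \<in> span ((\<lambda>l. E (h l)) ` {..<k})"
      show ?thesis
        by (rule exI[of _ "(e', f', \<mu>', z)"]) (use * in \<open>simp add: P_def E_def F_def M_def S_def\<close>)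
    qed (use P bi d in \<open>auto simp: P_def\<close>)
  qed
  then obtain h where P: "\<And>k. P h k (h k)" by blast
  define e f \<mu> where "e k = E (h k)" and "f k = F (h k)" and "\<mu> k = M (h k)" for k
  define z where "z k = S (h k)" for k
  note defs = P_def e_def[symmetric] f_def[symmetric] \<mu>_def[symmetric] z_def[symmetric]
  have bi: "f j (e k) = (if j = k then 1 else 0)" for j k
    using P[of j] P[of k] unfolding defs by (metis linorder_neqE_nat)
  have fl: "functional (f k)" and eV: "e k \<in> V" for k using P[of k] by (auto simp: defs)
  have van: "p m x = 0" if "x \<in> V" "\<And>i. i < k \<Longrightarrow> f i x = 0" "m < \<mu> k" for x m k
    using P[of k] that by (auto simp: defs)
  \<comment> \<open>By biorthogonality \<open>e k\<close> lies in the kernel of the functionals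
    before \<open>j\<close>, where all seminorms below \<open>\<mu> j\<close> vanish; but
    \<open>p (\<mu> k)\<close> does not vanish at \<open>e k\<close>.\<close>
  have "mono \<mu>"
  proof (rule monoI, rule ccontr)
    fix j k assume "j \<le> k" "\<not> \<mu> j \<le> \<mu> k"
    then have "p (\<mu> k) (e k) = 0" by (intro van[of _ j] eV) (auto simp: bi)
    then show False using P[of k] by (simp add: defs)
  qed
  moreover have "p m (remainder e f k x) = 0" if "x \<in> V" "m < \<mu> k" for x m k
    by (rule van[OF _ _ that(2)]) (use that eV fl bi V in \<open>auto intro!: remainder_in functional_remainder\<close>)
  moreover have "range z \<subseteq> span (range e)"
  proof (rule image_subsetI)
    fix k
    have "z k - e k \<in> span (e ` {..<k})" using P[of k] unfolding defs by (simp add: e_def)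
    also have "\<dots> \<subseteq> span (range e)" by (rule span_mono) auto
    finally have "(z k - e k) + e k \<in> span (range e)"
      by (rule span_add) (auto intro: span_base)
    then show "z k \<in> span (range e)" by simp
  qed
  moreover have "\<exists>y\<in>range z. p m (x - y) < \<epsilon>" if "x \<in> V" "\<epsilon> > 0" for x m \<epsilon>
  proof -
    have "\<exists>d\<in>range v. p m (x - d) < \<epsilon> / 2" unfolding v using that by (intro dense) auto
    then obtain i where i: "p m (x - v i) < \<epsilon> / 2" by blast
    obtain N where N: "1 / real (Suc N) < \<epsilon> / 2" using \<open>\<epsilon> > 0\<close> by (metis half_gt_zero nat_approx_posE)
    define k where "k = prod_encode (i, max N m)"
    have k: "k \<ge> N" "k \<ge> m"
      using le_prod_encode_2[of "max N m" i] by (auto simp: k_def)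
    have "p m (d k - z k) \<le> p k (d k - z k)" by (rule mono[OF k(2)])
    also have "\<dots> < 1 / real (Suc k)" using P[of k] by (simp add: defs)
    also have "\<dots> \<le> 1 / real (Suc N)" using k(1) by (simp add: frac_le)
    finally have "p m (d k - z k) < \<epsilon> / 2" using N by simp
    moreover have "d k = v i" by (simp add: d_def k_def)
    ultimately have "p m (x - z k) < \<epsilon>" using seminorm_triangle[OF p, of m x "z k" "v i"] i by simp
    then show ?thesis by blast
  qed
  moreover have "\<exists>C. \<forall>x. norm (f k x) \<le> C * p (\<mu> k) x" for k using P[of k] by (simp add: defs)
  ultimately show ?thesis
    using that[of e f \<mu> "range z"] eV fl bi by auto
qed

end

section \<open>Locally convex topologies and seminorms\<close>

text \<open>In a topological vector space, a bound on one neighbourhood of 0 already gives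
  continuity everywhere, by homogeneity and the triangle inequality.\<close>

definition continuous_seminorms ::
    "('k::real_normed_field \<Rightarrow> 'b::ab_group_add \<Rightarrow> 'b) \<Rightarrow> 'b topology \<Rightarrow> ('b \<Rightarrow> real) set" where
  "continuous_seminorms s T = {p. seminorm s p \<and> (\<exists>U. openin T U \<and> 0 \<in> U \<and> (\<forall>x\<in>U. p x < 1))}"

text \<open>Unit balls alone serve as neighbourhoods, without radii or finite intersections. This is
  adequate for a family \<open>Q\<close> closed under sums and non-negative multiples, as is assumed
  where the topology is studied.\<close>

definition seminorm_topology ::
    "'b::ab_group_add set \<Rightarrow> ('b \<Rightarrow> real) set \<Rightarrow> 'b topology" where
  "seminorm_topology V Q =
     topology (\<lambda>U. U \<subseteq> V \<and> (\<forall>x\<in>U. \<exists>q\<in>Q. \<forall>y\<in>V. q (y - x) < 1 \<longrightarrow> y \<in> U))"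

lemma openin_prod_preimage:
  assumes "continuous_map (prod_topology S T) R (\<lambda>(x, y). g x y)" "openin R U"
    and "x \<in> topspace S" "y \<in> topspace T" "g x y \<in> U"
  obtains A B where "openin S A" "openin T B" "x \<in> A" "y \<in> B" "\<And>a b. a \<in> A \<Longrightarrow> b \<in> B \<Longrightarrow> g a b \<in> U"
proof -
  have "openin (prod_topology S T) {z \<in> topspace (prod_topology S T). (case z of (x, y) \<Rightarrow> g x y) \<in> U}"
    by (rule openin_continuous_map_preimage[OF assms(1,2)])
  moreover have "(x, y) \<in> {z \<in> topspace (prod_topology S T). (case z of (x, y) \<Rightarrow> g x y) \<in> U}"
    using assms by simp
  ultimately obtain A B where "openin S A" "openin T B" "x \<in> A" "y \<in> B"
    "A \<times> B \<subseteq> {z \<in> topspace (prod_topology S T). (case z of (x, y) \<Rightarrow> g x y) \<in> U}"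
    unfolding openin_prod_topology_alt by meson
  then have "g a b \<in> U" if "a \<in> A" "b \<in> B" for a b using that by (auto dest: subsetD[where c = "(a, b)"])
  then show ?thesis using that \<open>openin S A\<close> \<open>openin T B\<close> \<open>x \<in> A\<close> \<open>y \<in> B\<close> by blast
qed

context rc_vector_space
begin

text \<open>The means of extending to the ambient type what is given only on the carrier of a space:
  Minkowski functionals, and later an operator on the direct sum.\<close>

lemma exists_linear_projection:
  assumes "subspace V"
  obtains \<pi> where "Vector_Spaces.linear scale scale \<pi>" "\<And>x. \<pi> x \<in> V" "\<And>x. x \<in> V \<Longrightarrow> \<pi> x = x"
proof -
  interpret pair: vector_space_pair scale scale ..
  have "\<exists>g. range g \<subseteq> V \<and> Vector_Spaces.linear scale scale g \<and> (\<forall>v\<in>V. g (id v) = v)"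
    by (rule pair.linear_exists_left_inverse_on) (use assms in \<open>simp_all add: linear_to_iff[OF vector_space_axioms]\<close>)
  then show ?thesis using that by auto
qed

text \<open>This is the Minkowski functional of \<open>W\<close>. It is meaningful only on
  \<open>V\<close>, where \<open>W\<close> absorbs, and is therefore precomposed with a projection
  onto \<open>V\<close>.\<close>

lemma exists_minkowski_seminorm:
  assumes V: "subspace V" and conv: "convex_wrt scale W"
    and bal: "\<And>c x. x \<in> W \<Longrightarrow> norm c \<le> 1 \<Longrightarrow> scale c x \<in> W"
    and abs: "\<And>x. x \<in> V \<Longrightarrow> \<exists>t>0. scale (of_real t) x \<in> W"
  obtains p where "seminorm scale p" "\<And>x. x \<in> V \<Longrightarrow> p x < 1 \<Longrightarrow> x \<in> W"
    "\<And>x. x \<in> V \<Longrightarrow> scale 2 x \<in> W \<Longrightarrow> p x < 1"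
proof -
  obtain \<pi> where lin: "Vector_Spaces.linear scale scale \<pi>" and \<pi>V: "\<And>x. \<pi> x \<in> V"
    and \<pi>id: "\<And>x. x \<in> V \<Longrightarrow> \<pi> x = x" using exists_linear_projection[OF V] by blast
  interpret \<pi>: Vector_Spaces.linear scale scale \<pi> by (rule lin)
  define A where "A x = {t. t > 0 \<and> scale (of_real (inverse t)) x \<in> W}" for x
  define g where "g x = Inf (A x)" for x
  have Ane: "A x \<noteq> {}" if x: "x \<in> V" for x
  proof -
    obtain t where "t > 0" "scale (of_real t) x \<in> W" using abs[OF x] by blast
    then have "inverse t \<in> A x" by (simp add: A_def)
    then show ?thesis by blast
  qed
  have bdd: "bdd_below (A x)" for x by (rule bdd_belowI[of _ 0]) (simp add: A_def)
  have up: "g x \<le> t" if "t \<in> A x" for x t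
    unfolding g_def by (rule cInf_lower[OF that bdd])
  have gl: "z \<le> g x" if "x \<in> V" "\<And>t. t \<in> A x \<Longrightarrow> z \<le> t" for x z
    unfolding g_def by (rule cInf_greatest[OF Ane[OF that(1)] that(2)])
  have tri: "g (x + y) \<le> g x + g y" if "x \<in> V" "y \<in> V" for x y
  proof -
    have "g (x + y) \<le> a + b" if a: "a \<in> A x" and b: "b \<in> A y" for a b
    proof (rule up)
      have pos: "a > 0" "b > 0" using a b by (auto simp: A_def)
      \<comment> \<open>The weight for which the convex combination of x / a and y / b is (x + y) /
        (a + b).\<close>
      define r where "r = b / (a + b)"
      have r: "r \<in> {0..1}" "(1 - r) * inverse a = inverse (a + b)" "r * inverse b = inverse (a + b)"
        using pos by (auto simp: r_def field_simps)
      have "scale (of_real (1 - r)) (scale (of_real (inverse a)) x)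
        + scale (of_real r) (scale (of_real (inverse b)) y) \<in> W"
        using conv a b r(1) unfolding convex_wrt_def A_def by blast
      then have "scale (of_real ((1 - r) * inverse a)) x + scale (of_real (r * inverse b)) y \<in> W"
        by (simp only: scale_scale of_real_mult)
      then have "scale (of_real (inverse (a + b))) (x + y) \<in> W"
        unfolding r(2,3) by (simp only: scale_right_distrib)
      then show "a + b \<in> A (x + y)" using pos by (simp add: A_def)
    qed
    then have "g (x + y) - a \<le> b" if "a \<in> A x" "b \<in> A y" for a b
      using that by (simp add: diff_le_eq add.commute)
    then have "g (x + y) - a \<le> g y" if "a \<in> A x" for a
      using that by (intro gl[OF \<open>y \<in> V\<close>])
    then have "g (x + y) - g y \<le> a" if "a \<in> A x" for a
      using that by (simp add: diff_le_eq add.commute)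
    then have "g (x + y) - g y \<le> g x"
      by (intro gl[OF \<open>x \<in> V\<close>])
    then show ?thesis by simp
  qed
  have hom_le: "g (scale c x) \<le> norm c * g x" if x: "x \<in> V" and c: "c \<noteq> 0" for c x
  proof -
    have "g (scale c x) / norm c \<le> g x"
    proof (rule gl[OF x])
      fix t assume t: "t \<in> A x"
      then have tp: "t > 0" by (simp add: A_def)
      have "scale (c / of_real (norm c)) (scale (of_real (inverse t)) x) \<in> W"
        using t c by (intro bal[of "scale (of_real (inverse t)) x"]) (auto simp: A_def norm_divide)
      also have "scale (c / of_real (norm c)) (scale (of_real (inverse t)) x)
        = scale (of_real (inverse (norm c * t))) (scale c x)"
        using c tp by (simp add: field_simps)
      finally have "norm c * t \<in> A (scale c x)" using c tp by (simp add: A_def del: of_real_inverse of_real_mult scale_scale)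
      then show "g (scale c x) / norm c \<le> t" using up c by (simp add: field_simps)
    qed
    then show ?thesis using c by (simp add: field_simps)
  qed
  have hom: "g (scale c x) = norm c * g x" if x: "x \<in> V" for c x
  proof (cases "c = 0")
    case True
    obtain t where "t \<in> A x" using Ane[OF x] by blast
    then have "scale 0 (scale (of_real (inverse t)) x) \<in> W" by (intro bal[of "scale (of_real (inverse t)) x"]) (auto simp: A_def)
    then have "0 \<in> W" by simp
    then have "g 0 \<le> e" if "e > 0" for e using that by (intro up) (simp add: A_def)
    then have "g 0 \<le> 0" by (rule dense_ge)
    moreover have "g 0 \<ge> 0" by (rule gl) (use subspace_0[OF V] in \<open>auto simp: A_def\<close>)
    ultimately show ?thesis using True by simp
  next
    case False
    have "g x \<le> norm (inverse c) * g (scale c x)"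
      using hom_le[of "scale c x" "inverse c"] subspace_scale[OF V x] False by simp
    then have "norm c * g x \<le> g (scale c x)"
      using False by (simp add: norm_inverse norm_divide field_simps)
    then show ?thesis using hom_le[OF x False] by simp
  qed
  have "seminorm scale (\<lambda>x. g (\<pi> x))"
    unfolding seminorm_def using tri hom \<pi>V by (simp add: \<pi>.add \<pi>.scale)
  moreover have "x \<in> W" if x: "x \<in> V" "g x < 1" for x
  proof -
    obtain t where t: "t \<in> A x" "t < 1"
      using cInf_lessD[OF Ane[OF x(1)], of 1] x(2) unfolding g_def by blast
    then have "scale (of_real t) (scale (of_real (inverse t)) x) \<in> W"
      by (intro bal[of "scale (of_real (inverse t)) x"]) (auto simp: A_def)
    then show ?thesis using t(1) by (simp add: A_def)
  qed
  moreover have "g x < 1" if "x \<in> V" "scale 2 x \<in> W" for x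
    using up[of "1/2" x] that by (simp add: A_def)
  ultimately show ?thesis using that[of "\<lambda>x. g (\<pi> x)"] \<pi>id by simp
qed

lemma continuous_map_translation:
  assumes T: "topological_vector_space scale T" and x: "x \<in> topspace T"
  shows "continuous_map T T (\<lambda>y. y - x)"
proof -
  have "continuous_map T T ((\<lambda>(x, y). x + y) \<circ> (\<lambda>y. (y, - x)))"
  proof (rule continuous_map_compose)
    show "continuous_map T (prod_topology T T) (\<lambda>y. (y, - x))"
      using T x by (intro continuous_map_pairedI)
        (auto simp: topological_vector_space_def intro: subspace_neg)
    show "continuous_map (prod_topology T T) T (\<lambda>(x, y). x + y)"
      using T by (simp add: topological_vector_space_def)
  qed
  then show ?thesis by (simp add: o_def)
qed

lemma continuous_map_scale:
  assumes T: "topological_vector_space scale T"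
  shows "continuous_map T T (scale c)"
proof -
  have "continuous_map T T ((\<lambda>(c, x). scale c x) \<circ> (\<lambda>y. (c, y)))"
    by (rule continuous_map_compose[where X' = "prod_topology euclidean T"])
      (use T in \<open>auto simp: topological_vector_space_def intro: continuous_map_pairedI\<close>)
  then show ?thesis by (simp add: o_def)
qed

lemma subspace_topspace: "topological_vector_space scale T \<Longrightarrow> subspace (topspace T)"
  by (simp add: topological_vector_space_def)

lemma tvs_absorbing:
  assumes T: "topological_vector_space scale T" and U: "openin T U" "0 \<in> U"
  obtains \<delta> B where "\<delta> > 0" "openin T B" "0 \<in> B" "\<And>c x. norm c \<le> \<delta> \<Longrightarrow> x \<in> B \<Longrightarrow> scale c x \<in> U"
proof -
  have "continuous_map (prod_topology euclidean T) T (\<lambda>(c, x). scale c x)"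
    using T by (simp add: topological_vector_space_def)
  then obtain A B where AB: "openin euclidean A" "openin T B" "0 \<in> A" "0 \<in> B"
    "\<And>a b. a \<in> A \<Longrightarrow> b \<in> B \<Longrightarrow> scale a b \<in> U"
    by (rule openin_prod_preimage[OF _ U(1), of _ _ _ 0 0])
      (use U(2) subspace_0[OF subspace_topspace[OF T]] in auto)
  obtain \<delta> where "\<delta> > 0" "cball 0 \<delta> \<subseteq> A"
    using AB(1,3) open_contains_cball by (metis open_openin)
  then show ?thesis using that[of \<delta> B] AB by (auto simp: subset_iff)
qed

text \<open>The Minkowski functional is taken of the balanced core \<open>W'\<close> of a convex
  neighbourhood; joint continuity of scaling at 0 makes the core contain a neighbourhood of 0
  again.\<close>

lemma exists_continuous_seminorm:
  assumes T: "locally_convex_space scale T" and U: "openin T U" "0 \<in> U"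
  obtains p where "p \<in> continuous_seminorms scale T" "\<And>x. x \<in> topspace T \<Longrightarrow> p x < 1 \<Longrightarrow> x \<in> U"
proof -
  let ?V = "topspace T"
  have tvs: "topological_vector_space scale T" using T by (simp add: locally_convex_space_def)
  note V = subspace_topspace[OF tvs]
  obtain A W where A: "openin T A" "0 \<in> A" "A \<subseteq> W" and W: "convex_wrt scale W" "W \<subseteq> U"
    using T U unfolding locally_convex_space_def neighbourhood_base_of by meson
  obtain \<delta> B where \<delta>: "\<delta> > 0" "openin T B" "0 \<in> B"
    "\<And>c x. norm c \<le> \<delta> \<Longrightarrow> x \<in> B \<Longrightarrow> scale c x \<in> A" using tvs_absorbing[OF tvs A(1,2)] by blast
  define W' where "W' = {x. \<forall>c. norm c \<le> 1 \<longrightarrow> scale c x \<in> W}"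
  have conv: "convex_wrt scale W'"
    unfolding convex_wrt_def
  proof (intro ballI)
    fix x y and t :: real assume "x \<in> W'" "y \<in> W'" "t \<in> {0..1}"
    then have "scale (of_real (1 - t)) (scale c x) + scale (of_real t) (scale c y) \<in> W" if "norm c \<le> 1" for c
      using W(1) that unfolding convex_wrt_def W'_def by blast
    then have "scale c (scale (of_real (1 - t)) x + scale (of_real t) y) \<in> W" if "norm c \<le> 1" for c
      using that by (simp only: scale_right_distrib scale_left_commute[of c])
    then show "scale (of_real (1 - t)) x + scale (of_real t) y \<in> W'" by (simp add: W'_def del: of_real_diff)
  qed
  have bal: "scale c x \<in> W'" if "x \<in> W'" "norm c \<le> 1" for c x
    using that by (auto simp: W'_def norm_mult mult_le_one)
  have BW: "scale (of_real \<delta>) x \<in> W'" if "x \<in> B" for x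
    unfolding W'_def using \<delta> that A(3) by (auto simp: norm_mult mult_left_le_one_le)
  define N where "N = {y \<in> ?V. scale (of_real (inverse \<delta>)) y \<in> B}"
  have N: "openin T N"
    unfolding N_def by (rule openin_continuous_map_preimage[OF continuous_map_scale[OF tvs] \<delta>(2)])
  have NW: "x \<in> W'" if "x \<in> N" for x
    using BW[of "scale (of_real (inverse \<delta>)) x"] that \<delta>(1) by (simp add: N_def)
  have N0: "0 \<in> N" using \<delta>(3) subspace_0[OF V] by (simp add: N_def)
  have abs: "\<exists>t>0. scale (of_real t) x \<in> W'" if x: "x \<in> ?V" for x
  proof -
    have "continuous_map (prod_topology euclidean T) T (\<lambda>(c, x). scale c x)"
      using tvs by (simp add: topological_vector_space_def)
    then obtain C B where C: "openin euclidean C" "0 \<in> C" "x \<in> B"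
      "\<And>a b. a \<in> C \<Longrightarrow> b \<in> B \<Longrightarrow> scale a b \<in> N"
      by (rule openin_prod_preimage[OF _ N, of _ _ _ 0 x]) (use N0 x in auto)
    obtain r where "r > 0" "cball 0 r \<subseteq> C"
      using C(1,2) open_contains_cball by (metis open_openin)
    then have "scale (of_real r) x \<in> N" by (intro C(3,4)) (auto simp: subset_iff)
    then show ?thesis using NW \<open>r > 0\<close> by blast
  qed
  obtain p where p: "seminorm scale p" "\<And>x. x \<in> ?V \<Longrightarrow> p x < 1 \<Longrightarrow> x \<in> W'"
    "\<And>x. x \<in> ?V \<Longrightarrow> scale 2 x \<in> W' \<Longrightarrow> p x < 1"
    using exists_minkowski_seminorm[OF V conv bal abs] by blast
  have "openin T {y \<in> ?V. scale 2 y \<in> N}"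
    by (rule openin_continuous_map_preimage[OF continuous_map_scale[OF tvs] N])
  then have "p \<in> continuous_seminorms scale T"
    unfolding continuous_seminorms_def using p NW N0 subspace_0[OF V]
    by (intro CollectI conjI exI[of _ "{y \<in> ?V. scale 2 y \<in> N}"]) auto
  moreover have "x \<in> U" if "x \<in> ?V" "p x < 1" for x
  proof -
    have "x \<in> W'" by (rule p(2)[OF that])
    then have "\<forall>c. norm c \<le> 1 \<longrightarrow> scale c x \<in> W" by (simp add: W'_def)
    from spec[OF this, of 1] have "x \<in> W" by simp
    then show ?thesis using W(2) by auto
  qed
  ultimately show ?thesis by (rule that)
qed

lemma openin_iff_continuous_seminorms:
  assumes T: "locally_convex_space scale T"
  shows "openin T U \<longleftrightarrow> U \<subseteq> topspace T \<and>
    (\<forall>x\<in>U. \<exists>p\<in>continuous_seminorms scale T. \<forall>y\<in>topspace T. p (y - x) < 1 \<longrightarrow> y \<in> U)"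
    (is "?L \<longleftrightarrow> ?R")
proof
  have tvs: "topological_vector_space scale T" using T by (simp add: locally_convex_space_def)
  note V = subspace_topspace[OF tvs]
  show ?R if U: ?L
  proof (intro conjI ballI)
    show "U \<subseteq> topspace T" using openin_subset[OF U] .
    fix x assume x: "x \<in> U"
    then have xV: "x \<in> topspace T" using openin_subset[OF U] by blast
    have "- x \<in> topspace T" by (rule subspace_neg[OF V xV])
    then have "openin T {y \<in> topspace T. y - - x \<in> U}"
      by (intro openin_continuous_map_preimage[OF continuous_map_translation[OF tvs] U])
    moreover have "0 \<in> {y \<in> topspace T. y - - x \<in> U}" using x subspace_0[OF V] by simp
    ultimately obtain p where p: "p \<in> continuous_seminorms scale T"
      "\<And>z. z \<in> topspace T \<Longrightarrow> p z < 1 \<Longrightarrow> z \<in> {y \<in> topspace T. y - - x \<in> U}"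
      by (rule exists_continuous_seminorm[OF T]) blast
    have "y \<in> U" if "y \<in> topspace T" "p (y - x) < 1" for y
      using p(2)[of "y - x"] that subspace_diff[OF V that(1) xV] by simp
    then show "\<exists>p\<in>continuous_seminorms scale T. \<forall>y\<in>topspace T. p (y - x) < 1 \<longrightarrow> y \<in> U"
      using p(1) by blast
  qed
  show ?L if U: ?R
  proof (subst openin_subopen, intro ballI)
    fix x assume x: "x \<in> U"
    then obtain p where p: "p \<in> continuous_seminorms scale T" "\<And>y. y \<in> topspace T \<Longrightarrow> p (y - x) < 1 \<Longrightarrow> y \<in> U"
      using U by blast
    obtain A where A: "openin T A" "0 \<in> A" "\<And>x. x \<in> A \<Longrightarrow> p x < 1"
      using p(1) by (auto simp: continuous_seminorms_def)
    have xV: "x \<in> topspace T" using x U by blast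
    have "openin T {y \<in> topspace T. y - x \<in> A}"
      by (rule openin_continuous_map_preimage[OF continuous_map_translation[OF tvs xV] A(1)])
    then show "\<exists>S. openin T S \<and> x \<in> S \<and> S \<subseteq> U"
      using xV A(2,3) p(2) by (intro exI[of _ "{y \<in> topspace T. y - x \<in> A}"]) auto
  qed
qed

lemma continuous_seminorms_add:
  assumes T: "topological_vector_space scale T"
    and p: "p \<in> continuous_seminorms scale T" and q: "q \<in> continuous_seminorms scale T"
  shows "(\<lambda>x. p x + q x) \<in> continuous_seminorms scale T"
proof -
  obtain A B where A: "openin T A" "0 \<in> A" "\<And>x. x \<in> A \<Longrightarrow> p x < 1" and B: "openin T B" "0 \<in> B" "\<And>x. x \<in> B \<Longrightarrow> q x < 1"
    and sp: "seminorm scale p" and sq: "seminorm scale q"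
    using p q by (auto simp: continuous_seminorms_def)
  have "openin T {y \<in> topspace T. scale 2 y \<in> A \<inter> B}"
    by (rule openin_continuous_map_preimage[OF continuous_map_scale[OF T] openin_Int[OF A(1) B(1)]])
  moreover have "p y + q y < 1" if "scale 2 y \<in> A \<inter> B" for y
    using A(3)[of "scale 2 y"] B(3)[of "scale 2 y"] that seminorm_scale[OF sp, of 2 y] seminorm_scale[OF sq, of 2 y]
    by simp
  ultimately show ?thesis
    unfolding continuous_seminorms_def using A(2) B(2) subspace_0[OF subspace_topspace[OF T]]
    by (intro CollectI conjI seminorm_plus_fun[OF sp sq] exI[of _ "{y \<in> topspace T. scale 2 y \<in> A \<inter> B}"]) auto
qed

lemma continuous_seminorms_mult:
  assumes T: "topological_vector_space scale T"
    and p: "p \<in> continuous_seminorms scale T" and C: "C \<ge> 0"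
  shows "(\<lambda>x. C * p x) \<in> continuous_seminorms scale T"
proof -
  obtain A where A: "openin T A" "0 \<in> A" "\<And>x. x \<in> A \<Longrightarrow> p x < 1" and sp: "seminorm scale p"
    using p by (auto simp: continuous_seminorms_def)
  have "openin T {y \<in> topspace T. scale (of_real C) y \<in> A}"
    by (rule openin_continuous_map_preimage[OF continuous_map_scale[OF T] A(1)])
  moreover have "C * p y < 1" if "scale (of_real C) y \<in> A" for y
    using A(3)[OF that] C by (simp add: seminorm_scale[OF sp])
  ultimately show ?thesis
    unfolding continuous_seminorms_def using A(2) subspace_0[OF subspace_topspace[OF T]]
    by (intro CollectI conjI seminorm_mult_fun[OF sp C] exI[of _ "{y \<in> topspace T. scale (of_real C) y \<in> A}"]) auto
qed

lemma continuous_seminorms_mono: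
  assumes p: "p \<in> continuous_seminorms scale T" and q: "seminorm scale q"
    and le: "\<And>x. x \<in> topspace T \<Longrightarrow> q x \<le> p x"
  shows "q \<in> continuous_seminorms scale T"
proof -
  obtain A where A: "openin T A" "0 \<in> A" "\<And>x. x \<in> A \<Longrightarrow> p x < 1"
    using p by (auto simp: continuous_seminorms_def)
  have "q x < 1" if "x \<in> A" for x
    using A(3)[OF that] le[of x] openin_subset[OF A(1)] that by (meson le_less_trans subsetD)
  then show ?thesis using q A(1,2) by (auto simp: continuous_seminorms_def)
qed

lemma continuous_seminorms_zero:
  assumes "topological_vector_space scale T"
  shows "(\<lambda>x. 0) \<in> continuous_seminorms scale T"
  unfolding continuous_seminorms_def using subspace_0[OF subspace_topspace[OF assms]]
  by (auto simp: seminorm_zero_fun)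

lemma continuous_seminorms_sum:
  assumes T: "topological_vector_space scale T"
  shows "(\<And>i. i \<in> A \<Longrightarrow> P i \<in> continuous_seminorms scale T) \<Longrightarrow>
    (\<lambda>x. \<Sum>i\<in>A. P i x) \<in> continuous_seminorms scale T"
proof (induction A rule: infinite_finite_induct)
  case (insert i A)
  then show ?case
    using continuous_seminorms_add[OF T, of "P i" "\<lambda>x. \<Sum>i\<in>A. P i x"] by simp
qed (auto simp: continuous_seminorms_zero[OF T])

lemma continuous_seminormsD: "p \<in> continuous_seminorms scale T \<Longrightarrow> seminorm scale p"
  by (simp add: continuous_seminorms_def)

lemma openin_seminorm_ball:
  assumes T: "locally_convex_space scale T" and p: "p \<in> continuous_seminorms scale T"
    and r: "r > 0" and x: "x \<in> topspace T"
  shows "openin T {y \<in> topspace T. p (y - x) < r}"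
  unfolding openin_iff_continuous_seminorms[OF T]
proof (intro conjI ballI)
  have tvs: "topological_vector_space scale T" using T by (simp add: locally_convex_space_def)
  fix z assume z: "z \<in> {y \<in> topspace T. p (y - x) < r}"
  define e where "e = r - p (z - x)"
  have e: "e > 0" using z by (simp add: e_def)
  show "\<exists>q\<in>continuous_seminorms scale T. \<forall>y\<in>topspace T. q (y - z) < 1 \<longrightarrow>
    y \<in> {y \<in> topspace T. p (y - x) < r}"
  proof (intro bexI ballI impI)
    show "(\<lambda>x. inverse e * p x) \<in> continuous_seminorms scale T"
      using e by (intro continuous_seminorms_mult tvs p) auto
    fix y assume "y \<in> topspace T" "inverse e * p (y - z) < 1"
    moreover have "p (y - x) \<le> p (y - z) + p (z - x)"
      by (rule seminorm_triangle[OF continuous_seminormsD[OF p]])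
    ultimately show "y \<in> {y \<in> topspace T. p (y - x) < r}"
      using e by (simp add: field_simps e_def)
  qed
qed auto

lemma separable_seminorm_dense:
  assumes T: "locally_convex_space scale T" and sep: "separable_space T"
  obtains D where "countable D" "D \<subseteq> topspace T"
    "\<And>x p \<epsilon>. x \<in> topspace T \<Longrightarrow> p \<in> continuous_seminorms scale T \<Longrightarrow> \<epsilon> > 0 \<Longrightarrow> \<exists>d\<in>D. p (x - d) < \<epsilon>"
proof -
  obtain D where D: "countable D" "D \<subseteq> topspace T" "T closure_of D = topspace T"
    using sep by (auto simp: separable_space_def)
  show ?thesis
  proof (rule that[OF D(1,2)])
    fix x p and \<epsilon> :: real
    assume x: "x \<in> topspace T" and p: "p \<in> continuous_seminorms scale T" and \<epsilon>: "\<epsilon> > 0"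
    have "x \<in> T closure_of D" using x D(3) by simp
    moreover have "x \<in> {y \<in> topspace T. p (y - x) < \<epsilon>}"
      using x \<epsilon> seminorm_zero[OF continuous_seminormsD[OF p]] by simp
    ultimately have "\<exists>d. d \<in> D \<and> d \<in> {y \<in> topspace T. p (y - x) < \<epsilon>}"
      using openin_seminorm_ball[OF T p \<epsilon> x] by (simp only: in_closure_of)
    then obtain d where "d \<in> D" "p (d - x) < \<epsilon>" by blast
    then show "\<exists>d\<in>D. p (x - d) < \<epsilon>"
      using seminorm_diff_commute[OF continuous_seminormsD[OF p]] by metis
  qed
qed

text \<open>If \<open>p x\<close> exceeded \<open>q x\<close>, dividing \<open>x\<close> by
  \<open>p x\<close> would give a point where \<open>q\<close> is below 1 but \<open>p\<close>
  equals 1.\<close>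

lemma continuous_seminorm_le_scaled:
  assumes V: "subspace V" and p: "seminorm scale p" and q: "seminorm scale q"
    and le: "\<And>x. x \<in> V \<Longrightarrow> q x < 1 \<Longrightarrow> p x < 1" and x: "x \<in> V"
  shows "p x \<le> q x"
proof (rule ccontr)
  assume "\<not> p x \<le> q x"
  then have px: "p x > q x" "p x > 0" using seminorm_nonneg[OF q, of x] by auto
  define c where "c = inverse (p x)"
  have c: "c > 0" "c * p x = 1" "c * q x < 1" using px by (auto simp: c_def field_simps)
  let ?y = "scale (of_real c) x"
  have "p ?y = 1" "q ?y < 1" using c by (simp_all add: seminorm_scale[OF p] seminorm_scale[OF q])
  then show False using le[OF subspace_scale[OF V x]] by (metis less_irrefl)
qed

text \<open>Seminorms whose unit balls lie in the metric balls of radius 1 / (n + 1) dominate every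
  continuous seminorm, because each neighbourhood of 0 contains such a metric ball. Metrizability
  and completeness enter the development only here.\<close>

theorem frechet_seminorms:
  assumes fr: "frechet_space scale T"
  obtains P :: "nat \<Rightarrow> 'b \<Rightarrow> real" where "\<And>m. P m \<in> continuous_seminorms scale T"
    "\<And>m n x. m \<le> n \<Longrightarrow> P m x \<le> P n x"
    "\<And>p. p \<in> continuous_seminorms scale T \<Longrightarrow> \<exists>m. \<forall>x\<in>topspace T. p x \<le> P m x"
    "\<And>x. x \<in> topspace T \<Longrightarrow> (\<And>m. P m x = 0) \<Longrightarrow> x = 0"
    "\<And>y. (\<And>k. y k \<in> topspace T) \<Longrightarrow> (\<And>m \<epsilon>. \<epsilon> > 0 \<Longrightarrow> \<exists>N. \<forall>i\<ge>N. \<forall>j\<ge>N. P m (y i - y j) < \<epsilon>) \<Longrightarrow>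
       \<exists>l\<in>topspace T. \<forall>m. (\<lambda>k. P m (y k - l)) \<longlonglongrightarrow> 0"
proof -
  let ?V = "topspace T"
  have T: "locally_convex_space scale T" and cpl: "complete_tvs T" and met: "metrizable_space T"
    using fr by (auto simp: frechet_space_def)
  have tvs: "topological_vector_space scale T" and haus: "Hausdorff_space T"
    using T by (auto simp: locally_convex_space_def topological_vector_space_def)
  note V = subspace_topspace[OF tvs]
  obtain M d where "Metric_space M d" and Teq: "T = Metric_space.mtopology M d"
    using met unfolding metrizable_space_def by blast
  interpret Metric_space M d by fact
  have M0: "0 \<in> M" using subspace_0[OF V] by (simp add: Teq)
  have "\<exists>p\<in>continuous_seminorms scale T. \<forall>x\<in>?V. p x < 1 \<longrightarrow> x \<in> mball 0 (inverse (Suc n))" for n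
  proof -
    have "openin T (mball 0 (inverse (Suc n)))" unfolding Teq by (rule openin_mball)
    moreover have "0 \<in> mball 0 (inverse (Suc n))" using M0 by simp
    ultimately show ?thesis by (rule exists_continuous_seminorm[OF T]) blast
  qed
  then obtain p where p: "\<And>n. p n \<in> continuous_seminorms scale T"
    and pb: "\<And>n x. x \<in> ?V \<Longrightarrow> p n x < 1 \<Longrightarrow> x \<in> mball 0 (inverse (Suc n))" by metis
  note sn = continuous_seminormsD
  \<comment> \<open>Partial sums make the family increasing, so that later several bounds can be
    merged by a maximum of indices.\<close>
  define P where "P m x = (\<Sum>n\<le>m. p n x)" for m x
  have P: "P m \<in> continuous_seminorms scale T" for m
    unfolding P_def[abs_def] by (intro continuous_seminorms_sum tvs p)
  have mono: "P m x \<le> P n x" if "m \<le> n" for m n x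
    unfolding P_def by (rule sum_mono2) (use that seminorm_nonneg[OF sn[OF p]] in auto)
  have dom: "\<exists>m. \<forall>x\<in>?V. q x \<le> P m x" if q: "q \<in> continuous_seminorms scale T" for q
  proof -
    obtain U where U: "openin T U" "0 \<in> U" "\<And>x. x \<in> U \<Longrightarrow> q x < 1"
      using q by (auto simp: continuous_seminorms_def)
    obtain r where r: "r > 0" "mball 0 r \<subseteq> U"
      using U(1,2) unfolding Teq openin_mtopology by blast
    obtain n where n: "inverse (real (Suc n)) < r" using reals_Archimedean[OF r(1)] by auto
    have "q x \<le> p n x" if "x \<in> ?V" for x
    proof (rule continuous_seminorm_le_scaled[OF V sn[OF q] sn[OF p] _ that])
      fix x assume "x \<in> ?V" "p n x < 1"
      then have "x \<in> mball 0 r" using pb[of x n] n by auto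
      then show "q x < 1" using r(2) U(3) by blast
    qed
    moreover have "p n x \<le> P n x" for x
      unfolding P_def by (rule member_le_sum) (auto simp: seminorm_nonneg[OF sn[OF p]])
    ultimately show ?thesis by (meson order_trans)
  qed
  have sep: "x = 0" if x: "x \<in> ?V" and z: "\<And>m. P m x = 0" for x
  proof (rule ccontr)
    assume "x \<noteq> 0"
    then obtain U where U: "openin T U" "0 \<in> U" "x \<notin> U"
      using haus x subspace_0[OF V] unfolding Hausdorff_space_def disjnt_iff by metis
    obtain q where q: "q \<in> continuous_seminorms scale T" "\<And>x. x \<in> ?V \<Longrightarrow> q x < 1 \<Longrightarrow> x \<in> U"
      using exists_continuous_seminorm[OF T U(1,2)] by blast
    obtain m where "q x \<le> P m x" using dom[OF q(1)] x by blast
    then show False using q(2)[OF x] z U(3) by simp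
  qed
  have comp: "\<exists>l\<in>?V. \<forall>m. (\<lambda>k. P m (y k - l)) \<longlonglongrightarrow> 0"
    if y: "\<And>k. y k \<in> ?V" and cau: "\<And>m \<epsilon>. \<epsilon> > 0 \<Longrightarrow> \<exists>N. \<forall>i\<ge>N. \<forall>j\<ge>N. P m (y i - y j) < \<epsilon>" for y
  proof -
    let ?F = "filtermap y sequentially"
    \<comment> \<open>Completeness is stated for filters, so it is applied to the image of
      \<open>sequentially\<close> under the sequence.\<close>
    have "cauchy_filter_on T ?F"
      unfolding cauchy_filter_on_def
    proof (intro conjI allI impI)
      show "?F \<noteq> bot" by (simp add: filtermap_bot_iff)
      show "?F \<le> principal ?V"
        by (simp add: le_principal eventually_filtermap y)
      fix U assume "openin T U \<and> 0 \<in> U"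
      then obtain q where q: "q \<in> continuous_seminorms scale T" "\<And>x. x \<in> ?V \<Longrightarrow> q x < 1 \<Longrightarrow> x \<in> U"
        using exists_continuous_seminorm[OF T] by blast
      obtain m where m: "\<And>x. x \<in> ?V \<Longrightarrow> q x \<le> P m x" using dom[OF q(1)] by blast
      obtain N where N: "\<And>i j. i \<ge> N \<Longrightarrow> j \<ge> N \<Longrightarrow> P m (y i - y j) < 1" using cau[of 1 m] by auto
      have *: "y i - y j \<in> U" if "i \<ge> N" "j \<ge> N" for i j
        using q(2)[of "y i - y j"] m[of "y i - y j"] N[OF that] subspace_diff[OF V y y, of i j] by simp
      have "\<forall>\<^sub>F a in ?F. a \<in> y ` {N..}"
        unfolding eventually_filtermap eventually_sequentially by auto
      then have "\<forall>\<^sub>F (a, b) in ?F \<times>\<^sub>F ?F. a \<in> y ` {N..} \<and> b \<in> y ` {N..}"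
        unfolding eventually_prod_filter by (intro exI[of _ "\<lambda>a. a \<in> y ` {N..}"]) auto
      then show "\<forall>\<^sub>F (a, b) in ?F \<times>\<^sub>F ?F. a - b \<in> U"
        by (rule eventually_mono) (use * in auto)
    qed
    then obtain l where l: "limitin T (\<lambda>x. x) l ?F" using cpl unfolding complete_tvs_def by blast
    then have lV: "l \<in> ?V" by (simp add: limitin_def)
    have "(\<lambda>k. P m (y k - l)) \<longlonglongrightarrow> 0" for m
    proof (rule LIMSEQ_I)
      fix e :: real assume e: "e > 0"
      have "l \<in> {x \<in> ?V. P m (x - l) < e}"
        using lV e seminorm_zero[OF sn[OF P]] by simp
      then have "\<forall>\<^sub>F x in ?F. x \<in> {x \<in> ?V. P m (x - l) < e}"
        using l openin_seminorm_ball[OF T P e lV] unfolding limitin_def by blast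
      then show "\<exists>no. \<forall>n\<ge>no. norm (P m (y n - l) - 0) < e"
        using seminorm_nonneg[OF sn[OF P]] unfolding eventually_filtermap eventually_sequentially by fastforce
    qed
    then show ?thesis using lV by blast
  qed
  show ?thesis by (rule that[of P]) (fact P mono dom sep comp)+
qed

end

section \<open>Topologies generated by families of seminorms, and continuity of linear maps\<close>

context rc_vector_space
begin

context
  fixes V and Q :: "('b \<Rightarrow> real) set"
  assumes V: "subspace V" and Q: "\<And>q. q \<in> Q \<Longrightarrow> seminorm scale q" "Q \<noteq> {}"
    and Q_add: "\<And>p q. p \<in> Q \<Longrightarrow> q \<in> Q \<Longrightarrow> (\<lambda>x. p x + q x) \<in> Q"
    and Q_mult: "\<And>q C. q \<in> Q \<Longrightarrow> C \<ge> 0 \<Longrightarrow> (\<lambda>x. C * q x) \<in> Q"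
begin

lemma openin_seminorm_topology:
  "openin (seminorm_topology V Q) U \<longleftrightarrow>
    U \<subseteq> V \<and> (\<forall>x\<in>U. \<exists>q\<in>Q. \<forall>y\<in>V. q (y - x) < 1 \<longrightarrow> y \<in> U)"
proof -
  have "istopology (\<lambda>U. U \<subseteq> V \<and> (\<forall>x\<in>U. \<exists>q\<in>Q. \<forall>y\<in>V. q (y - x) < 1 \<longrightarrow> y \<in> U))"
    unfolding istopology_def
  proof (intro conjI allI impI ballI)
    fix A B x
    assume A: "A \<subseteq> V \<and> (\<forall>x\<in>A. \<exists>q\<in>Q. \<forall>y\<in>V. q (y - x) < 1 \<longrightarrow> y \<in> A)"
      and B: "B \<subseteq> V \<and> (\<forall>x\<in>B. \<exists>q\<in>Q. \<forall>y\<in>V. q (y - x) < 1 \<longrightarrow> y \<in> B)"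
    then show "A \<inter> B \<subseteq> V" by blast
    assume x: "x \<in> A \<inter> B"
    obtain p where p: "p \<in> Q" "\<And>y. y \<in> V \<Longrightarrow> p (y - x) < 1 \<Longrightarrow> y \<in> A"
      using A x by blast
    obtain q where q: "q \<in> Q" "\<And>y. y \<in> V \<Longrightarrow> q (y - x) < 1 \<Longrightarrow> y \<in> B"
      using B x by blast
    have "y \<in> A \<inter> B" if "y \<in> V" "p (y - x) + q (y - x) < 1" for y
      using p(2)[OF that(1)] q(2)[OF that(1)] that(2)
        seminorm_nonneg[OF Q(1)[OF p(1)], of "y - x"] seminorm_nonneg[OF Q(1)[OF q(1)], of "y - x"] by simp
    then show "\<exists>q\<in>Q. \<forall>y\<in>V. q (y - x) < 1 \<longrightarrow> y \<in> A \<inter> B"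
      using Q_add[OF p(1) q(1)] by (intro bexI[of _ "\<lambda>x. p x + q x"]) auto
  next
    fix K x
    assume K: "\<forall>U\<in>K. U \<subseteq> V \<and> (\<forall>x\<in>U. \<exists>q\<in>Q. \<forall>y\<in>V. q (y - x) < 1 \<longrightarrow> y \<in> U)"
    then show "\<Union> K \<subseteq> V" by blast
    assume "x \<in> \<Union> K"
    then obtain U where U: "U \<in> K" "x \<in> U" by blast
    then obtain q where "q \<in> Q" "\<forall>y\<in>V. q (y - x) < 1 \<longrightarrow> y \<in> U" using K by blast
    then show "\<exists>q\<in>Q. \<forall>y\<in>V. q (y - x) < 1 \<longrightarrow> y \<in> \<Union> K"
      using U(1) by (intro bexI[of _ q]) auto
  qed
  then show ?thesis by (simp add: seminorm_topology_def topology_inverse')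
qed

lemma topspace_seminorm_topology: "topspace (seminorm_topology V Q) = V"
proof
  show "topspace (seminorm_topology V Q) \<subseteq> V"
    using openin_topspace[of "seminorm_topology V Q"] by (simp only: openin_seminorm_topology)
  have "openin (seminorm_topology V Q) V"
    using Q(2) by (auto simp: openin_seminorm_topology)
  then show "V \<subseteq> topspace (seminorm_topology V Q)" by (rule openin_subset)
qed

lemma openin_seminorm_topology_ball:
  assumes q: "q \<in> Q" and x: "x \<in> V"
  shows "openin (seminorm_topology V Q) {y \<in> V. q (y - x) < r}"
  unfolding openin_seminorm_topology
proof (intro conjI ballI)
  fix z assume z: "z \<in> {y \<in> V. q (y - x) < r}"
  define e where "e = r - q (z - x)"
  have e: "e > 0" using z by (simp add: e_def)
  show "\<exists>q'\<in>Q. \<forall>y\<in>V. q' (y - z) < 1 \<longrightarrow> y \<in> {y \<in> V. q (y - x) < r}"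
  proof (intro bexI ballI impI)
    show "(\<lambda>x. inverse e * q x) \<in> Q" using e by (intro Q_mult q) auto
    fix y assume "y \<in> V" "inverse e * q (y - z) < 1"
    moreover have "q (y - x) \<le> q (y - z) + q (z - x)" by (rule seminorm_triangle[OF Q(1)[OF q]])
    ultimately show "y \<in> {y \<in> V. q (y - x) < r}" using e by (simp add: field_simps e_def)
  qed
qed auto

lemma continuous_seminorms_seminorm_topology: "Q \<subseteq> continuous_seminorms scale (seminorm_topology V Q)"
proof
  fix q assume q: "q \<in> Q"
  have "openin (seminorm_topology V Q) {y \<in> V. q (y - 0) < 1}"
    by (rule openin_seminorm_topology_ball[OF q subspace_0[OF V]])
  then show "q \<in> continuous_seminorms scale (seminorm_topology V Q)"
    using Q(1)[OF q] subspace_0[OF V] seminorm_zero[OF Q(1)[OF q]] unfolding continuous_seminorms_def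
    by (intro CollectI conjI exI[of _ "{y \<in> V. q (y - 0) < 1}"]) auto
qed

lemma locally_convex_seminorm_topology:
  assumes sep: "\<And>x. x \<in> V \<Longrightarrow> (\<And>q. q \<in> Q \<Longrightarrow> q x = 0) \<Longrightarrow> x = 0"
  shows "locally_convex_space scale (seminorm_topology V Q)"
proof -
  let ?T = "seminorm_topology V Q"
  note op = openin_seminorm_topology and ball = openin_seminorm_topology_ball
  have haus: "Hausdorff_space ?T"
    unfolding Hausdorff_space_def topspace_seminorm_topology
  proof (intro allI impI, elim conjE)
    fix x y assume xy: "x \<in> V" "y \<in> V" "x \<noteq> y"
    then obtain q where q: "q \<in> Q" "q (x - y) \<noteq> 0"
      using sep[of "x - y"] subspace_diff[OF V] by auto
    note sn = Q(1)[OF q(1)]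
    define r where "r = q (x - y) / 2"
    have r: "r > 0" using q(2) seminorm_nonneg[OF sn, of "x - y"] by (simp add: r_def)
    have "z \<notin> {z \<in> V. q (z - y) < r}" if "z \<in> {z \<in> V. q (z - x) < r}" for z
      using seminorm_triangle[OF sn, of x y z] seminorm_diff_commute[OF sn, of x z] that by (auto simp: r_def)
    then show "\<exists>A B. openin ?T A \<and> openin ?T B \<and> x \<in> A \<and> y \<in> B \<and> disjnt A B"
      using ball[OF q(1), of x r] ball[OF q(1), of y r] xy r seminorm_zero[OF sn]
      by (intro exI[of _ "{z \<in> V. q (z - x) < r}"] exI[of _ "{z \<in> V. q (z - y) < r}"]) (auto simp: disjnt_iff)
  qed
  have add: "continuous_map (prod_topology ?T ?T) ?T (\<lambda>(x, y). x + y)"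
    unfolding continuous_map_def topspace_prod_topology topspace_seminorm_topology
  proof (intro conjI allI impI)
    show "(\<lambda>(x, y). x + y) \<in> V \<times> V \<rightarrow> V" using subspace_add[OF V] by auto
    fix U assume U: "openin ?T U"
    show "openin (prod_topology ?T ?T) {z \<in> V \<times> V. (case z of (x, y) \<Rightarrow> x + y) \<in> U}"
      unfolding openin_prod_topology_alt
    proof (intro allI impI)
      fix x y assume "(x, y) \<in> {z \<in> V \<times> V. (case z of (x, y) \<Rightarrow> x + y) \<in> U}"
      then have xy: "x \<in> V" "y \<in> V" "x + y \<in> U" by auto
      obtain q where q: "q \<in> Q" "\<And>z. z \<in> V \<Longrightarrow> q (z - (x + y)) < 1 \<Longrightarrow> z \<in> U"
        using U xy(3) unfolding op by blast
      note sn = Q(1)[OF q(1)]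
      have "a + b \<in> U" if "a \<in> V" "b \<in> V" "q (a - x) < 1 / 2" "q (b - y) < 1 / 2" for a b
      proof (rule q(2)[OF subspace_add[OF V that(1,2)]])
        have "a + b - (x + y) = (a - x) + (b - y)" by simp
        then have "q (a + b - (x + y)) \<le> q (a - x) + q (b - y)"
          using seminorm_add[OF sn, of "a - x" "b - y"] by (simp only:)
        then show "q (a + b - (x + y)) < 1" using that by simp
      qed
      then show "\<exists>A B. openin ?T A \<and> openin ?T B \<and> x \<in> A \<and> y \<in> B \<and>
          A \<times> B \<subseteq> {z \<in> V \<times> V. (case z of (x, y) \<Rightarrow> x + y) \<in> U}"
        using ball[OF q(1), of x "1/2"] ball[OF q(1), of y "1/2"] xy seminorm_zero[OF sn]
        by (intro exI[of _ "{z \<in> V. q (z - x) < 1/2}"] exI[of _ "{z \<in> V. q (z - y) < 1/2}"]) auto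
    qed
  qed
  have scl: "continuous_map (prod_topology euclidean ?T) ?T (\<lambda>(c, x). scale c x)"
    unfolding continuous_map_def topspace_prod_topology topspace_seminorm_topology topspace_euclidean
  proof (intro conjI allI impI)
    show "(\<lambda>(c, x). scale c x) \<in> UNIV \<times> V \<rightarrow> V" using subspace_scale[OF V] by auto
    fix U assume U: "openin ?T U"
    show "openin (prod_topology euclidean ?T) {z \<in> UNIV \<times> V. (case z of (c, y) \<Rightarrow> scale c y) \<in> U}"
      unfolding openin_prod_topology_alt
    proof (intro allI impI)
      fix c x assume "(c, x) \<in> {z \<in> UNIV \<times> V. (case z of (c, y) \<Rightarrow> scale c y) \<in> U}"
      then have cx: "x \<in> V" "scale c x \<in> U" by auto
      obtain q where q: "q \<in> Q" "\<And>z. z \<in> V \<Longrightarrow> q (z - scale c x) < 1 \<Longrightarrow> z \<in> U"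
        using U cx(2) unfolding op by blast
      note sn = Q(1)[OF q(1)]
      \<comment> \<open>The error splits as \<open>scale a (b - x) + scale (a - c) x\<close>. The
        two constants bound the first part by 1/2 and the second by less than 1/2 in total; the
        added terms keep the denominators positive.\<close>
      define \<delta> where "\<delta> = 1 / (2 * (q x + 1))"
      define \<eta> where "\<eta> = 1 / (2 * (norm c + \<delta>))"
      have qx: "q x \<ge> 0" by (rule seminorm_nonneg[OF sn])
      have \<delta>: "\<delta> > 0" using qx by (simp add: \<delta>_def)
      have ncd: "norm c + \<delta> > 0" using \<delta> by (simp add: add_nonneg_pos)
      have \<eta>: "\<eta> > 0" using ncd by (simp add: \<eta>_def)
      have "scale a b \<in> U" if "a \<in> ball c \<delta>" "b \<in> V" "q (b - x) < \<eta>" for a b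
      proof (rule q(2)[OF subspace_scale[OF V that(2)]])
        have ac: "norm (a - c) < \<delta>" using that(1) by (simp add: dist_norm norm_minus_commute)
        then have na: "norm a \<le> norm c + \<delta>" using norm_triangle_ineq2[of a c] by linarith
        have "scale a b - scale c x = scale a (b - x) + scale (a - c) x"
          by (simp add: scale_right_diff_distrib scale_left_diff_distrib)
        then have "q (scale a b - scale c x) \<le> norm a * q (b - x) + norm (a - c) * q x"
          using seminorm_add[OF sn, of "scale a (b - x)" "scale (a - c) x"] by (simp add: seminorm_scale[OF sn])
        also have "\<dots> \<le> (norm c + \<delta>) * q (b - x) + \<delta> * q x"
          using na ac qx seminorm_nonneg[OF sn, of "b - x"] by (intro add_mono mult_right_mono) auto
        also have "\<dots> < (norm c + \<delta>) * \<eta> + \<delta> * (q x + 1)"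
          using that(3) ncd \<delta> by (intro add_strict_mono mult_strict_left_mono) auto
        also have "\<dots> = 1"
        proof -
          have "(norm c + \<delta>) * \<eta> = 1 / 2" unfolding \<eta>_def using ncd by (simp add: field_simps)
          moreover have "\<delta> * (q x + 1) = 1 / 2" unfolding \<delta>_def using qx by (simp add: field_simps)
          ultimately show ?thesis by simp
        qed
        finally show "q (scale a b - scale c x) < 1" .
      qed
      then show "\<exists>A B. openin euclidean A \<and> openin ?T B \<and> c \<in> A \<and> x \<in> B \<and>
          A \<times> B \<subseteq> {z \<in> UNIV \<times> V. (case z of (c, y) \<Rightarrow> scale c y) \<in> U}"
        using ball[OF q(1), of x \<eta>] cx \<delta> \<eta> seminorm_zero[OF sn]
        by (intro exI[of _ "ball c \<delta>"] exI[of _ "{z \<in> V. q (z - x) < \<eta>}"]) auto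
    qed
  qed
  have nb: "neighbourhood_base_of (convex_wrt scale) ?T"
    unfolding neighbourhood_base_of
  proof (intro allI impI, elim conjE)
    fix W x assume W: "openin ?T W" "x \<in> W"
    then have x: "x \<in> V" unfolding op by blast
    obtain q where q: "q \<in> Q" "\<And>y. y \<in> V \<Longrightarrow> q (y - x) < 1 \<Longrightarrow> y \<in> W"
      using W unfolding op by blast
    note sn = Q(1)[OF q(1)]
    have "convex_wrt scale {y \<in> V. q (y - x) < 1}"
      unfolding convex_wrt_def
    proof (intro ballI CollectI conjI)
      fix a b and t :: real
      assume a: "a \<in> {y \<in> V. q (y - x) < 1}" and b: "b \<in> {y \<in> V. q (y - x) < 1}" and t: "t \<in> {0..1}"
      show "scale (of_real (1 - t)) a + scale (of_real t) b \<in> V"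
        using a b by (intro subspace_add[OF V] subspace_scale[OF V]) auto
      have nt: "norm (of_real (1 - t) :: 'k) = 1 - t" "norm (of_real t :: 'k) = t"
        using t by (simp_all only: norm_of_real) auto
      have "x = scale (of_real (1 - t)) x + scale (of_real t) x"
        by (simp add: scale_left_distrib[symmetric])
      then have "scale (of_real (1 - t)) a + scale (of_real t) b - x =
          scale (of_real (1 - t)) (a - x) + scale (of_real t) (b - x)"
        by (simp only: scale_right_diff_distrib) (simp add: algebra_simps)
      then have "q (scale (of_real (1 - t)) a + scale (of_real t) b - x)
          \<le> (1 - t) * q (a - x) + t * q (b - x)"
        using seminorm_add[OF sn, of "scale (of_real (1 - t)) (a - x)" "scale (of_real t) (b - x)"]
        by (simp only: seminorm_scale[OF sn] nt)
      also have "\<dots> < 1"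
        by (rule convex_bound_lt) (use a b t in auto)
      finally show "q (scale (of_real (1 - t)) a + scale (of_real t) b - x) < 1" .
    qed
    then show "\<exists>A B. openin ?T A \<and> convex_wrt scale B \<and> x \<in> A \<and> A \<subseteq> B \<and> B \<subseteq> W"
      using ball[OF q(1) x, of 1] x q(2) seminorm_zero[OF sn]
      by (intro exI[of _ "{y \<in> V. q (y - x) < 1}"]) auto
  qed
  show ?thesis
    unfolding locally_convex_space_def topological_vector_space_def topspace_seminorm_topology
    using V haus add scl nb vector_space_axioms by simp
qed

end

lemma continuous_map_linearI:
  assumes vs': "vector_space scale'" and lin: "Vector_Spaces.linear scale scale' f"
    and T: "locally_convex_space scale T" and T': "locally_convex_space scale' T'"
    and into: "\<And>x. x \<in> topspace T \<Longrightarrow> f x \<in> topspace T'"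
    and bd: "\<And>q. q \<in> continuous_seminorms scale' T' \<Longrightarrow> (\<lambda>x. q (f x)) \<in> continuous_seminorms scale T"
  shows "continuous_map T T' f"
proof -
  interpret r': rc_vector_space scale' using vs' by (simp add: rc_vector_space_def)
  interpret f: Vector_Spaces.linear scale scale' f by (rule lin)
  show ?thesis
    unfolding continuous_map_def
  proof (intro conjI allI impI)
    show "f \<in> topspace T \<rightarrow> topspace T'" using into by auto
    fix U assume U: "openin T' U"
    show "openin T {x \<in> topspace T. f x \<in> U}"
      unfolding openin_iff_continuous_seminorms[OF T]
    proof (intro conjI ballI)
      fix x assume x: "x \<in> {x \<in> topspace T. f x \<in> U}"
      then obtain q where q: "q \<in> continuous_seminorms scale' T'"
        "\<And>y. y \<in> topspace T' \<Longrightarrow> q (y - f x) < 1 \<Longrightarrow> y \<in> U"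
        using U unfolding r'.openin_iff_continuous_seminorms[OF T'] by blast
      have "y \<in> {x \<in> topspace T. f x \<in> U}" if "y \<in> topspace T" "q (f (y - x)) < 1" for y
        using that q(2)[OF into[OF that(1)]] by (simp add: f.diff)
      then show "\<exists>p\<in>continuous_seminorms scale T. \<forall>y\<in>topspace T. p (y - x) < 1 \<longrightarrow> y \<in> {x \<in> topspace T. f x \<in> U}"
        using bd[OF q(1)] by (intro bexI[of _ "\<lambda>x. q (f x)"]) auto
    qed auto
  qed
qed

lemma continuous_seminorms_compose:
  assumes vs': "vector_space scale'" and lin: "Vector_Spaces.linear scale scale' f"
    and f: "continuous_map T T' f" and T: "topological_vector_space scale T"
    and q: "q \<in> continuous_seminorms scale' T'"
  shows "(\<lambda>x. q (f x)) \<in> continuous_seminorms scale T"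
proof -
  interpret f: Vector_Spaces.linear scale scale' f by (rule lin)
  obtain U where U: "openin T' U" "0 \<in> U" "\<And>x. x \<in> U \<Longrightarrow> q x < 1" and sq: "seminorm scale' q"
    using q by (auto simp: continuous_seminorms_def)
  have "openin T {x \<in> topspace T. f x \<in> U}" by (rule openin_continuous_map_preimage[OF f U(1)])
  then show ?thesis
    unfolding continuous_seminorms_def
    using seminorm_compose[OF sq lin] U(2,3) subspace_0[OF subspace_topspace[OF T]]
    by (intro CollectI conjI exI[of _ "{x \<in> topspace T. f x \<in> U}"]) (auto simp: f.zero)
qed

lemma continuous_seminorms_separating:
  assumes T: "locally_convex_space scale T" and x: "x \<in> topspace T" "x \<noteq> 0"
  obtains p where "p \<in> continuous_seminorms scale T" "p x \<noteq> 0"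
proof -
  have tvs: "topological_vector_space scale T" and haus: "Hausdorff_space T"
    using T by (auto simp: locally_convex_space_def topological_vector_space_def)
  obtain U where U: "openin T U" "0 \<in> U" "x \<notin> U"
    using haus x subspace_0[OF subspace_topspace[OF tvs]] unfolding Hausdorff_space_def disjnt_iff by metis
  obtain q where q: "q \<in> continuous_seminorms scale T" "\<And>x. x \<in> topspace T \<Longrightarrow> q x < 1 \<Longrightarrow> x \<in> U"
    using exists_continuous_seminorm[OF T U(1,2)] by blast
  then have "q x \<noteq> 0" using x U(3) by force
  then show ?thesis using q(1) that by blast
qed

lemma in_closure_of_seminorms:
  assumes T: "locally_convex_space scale T" and A: "A \<subseteq> topspace T"
  shows "x \<in> T closure_of A \<longleftrightarrow> x \<in> topspace T \<and> (\<forall>p\<in>continuous_seminorms scale T. \<exists>a\<in>A. p (a - x) < 1)"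
    (is "_ \<longleftrightarrow> ?R")
proof
  assume L: "x \<in> T closure_of A"
  then have x: "x \<in> topspace T" by (simp add: in_closure_of)
  have "\<exists>a\<in>A. p (a - x) < 1" if p: "p \<in> continuous_seminorms scale T" for p
  proof -
    have "openin T {y \<in> topspace T. p (y - x) < 1}" by (rule openin_seminorm_ball[OF T p _ x]) simp
    moreover have "x \<in> {y \<in> topspace T. p (y - x) < 1}"
      using x seminorm_zero[OF continuous_seminormsD[OF p]] by simp
    ultimately have "\<exists>d. d \<in> A \<and> d \<in> {y \<in> topspace T. p (y - x) < 1}"
      using L by (simp only: in_closure_of)
    then show ?thesis by blast
  qed
  then show ?R using x by blast
next
  assume R: ?R
  show "x \<in> T closure_of A"
    unfolding in_closure_of
  proof (intro conjI allI impI)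
    show "x \<in> topspace T" using R by blast
    fix U assume "x \<in> U \<and> openin T U"
    then obtain p where p: "p \<in> continuous_seminorms scale T" "\<And>y. y \<in> topspace T \<Longrightarrow> p (y - x) < 1 \<Longrightarrow> y \<in> U"
      unfolding openin_iff_continuous_seminorms[OF T] by blast
    then obtain a where "a \<in> A" "p (a - x) < 1" using R by blast
    then show "\<exists>y. y \<in> A \<and> y \<in> U" using p(2) A by blast
  qed
qed

end

section \<open>The topology of the direct sum\<close>

locale locally_convex_sequence = rc_vector_space s
  for s :: "'k::real_or_complex \<Rightarrow> 'a::ab_group_add \<Rightarrow> 'a" +
  fixes X :: "nat \<Rightarrow> 'a topology"
  assumes lc: "locally_convex_space s (X n)"
begin

abbreviation "V n \<equiv> topspace (X n)"
abbreviation "W \<equiv> direct_sum V"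
abbreviation "d \<equiv> direct_sum_scale s"
abbreviation "S \<equiv> direct_sum_topology s X"
abbreviation "single \<equiv> Poly_Mapping.single :: nat \<Rightarrow> 'a \<Rightarrow> _"
abbreviation "lookup \<equiv> Poly_Mapping.lookup :: (nat \<Rightarrow>\<^sub>0 'a) \<Rightarrow> nat \<Rightarrow> 'a"

sublocale sum: rc_vector_space d
  using vector_space_direct_sum_scale[OF vector_space_axioms] by (simp add: rc_vector_space_def)

lemmas lookup_d = lookup_direct_sum_scale[OF vector_space_axioms]

lemma tvs: "topological_vector_space s (X n)"
  using lc by (simp add: locally_convex_space_def)

lemmas V = subspace_topspace[OF tvs]

lemma lc_S: "locally_convex_space d S" and topspace_S: "topspace S = W"
  and embedding_single: "embedding_map (X n) S (single n)"
  using admissible_direct_sum_topology[of s X, OF lc] by (auto simp: admissible_sum_topology_def)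

lemma tvs_S: "topological_vector_space d S"
  using lc_S by (simp add: locally_convex_space_def)

lemma subspace_W: "sum.subspace W"
  using sum.subspace_topspace[OF tvs_S] by (simp add: topspace_S)

lemma single_in_W: "x \<in> V n \<Longrightarrow> single n x \<in> W"
  using subspace_0[OF V] by (auto simp: direct_sum_def lookup_single when_def)

lemma linear_single: "Vector_Spaces.linear s d (single n)"
  by (auto simp: linear_to_iff[OF sum.vector_space_axioms] single_add lookup_d lookup_single when_def
      intro!: poly_mapping_eqI)

lemma linear_lookup: "Vector_Spaces.linear d s (\<lambda>x. lookup x n)"
  by (auto simp: sum.linear_to_iff[OF vector_space_axioms] lookup_add lookup_d)

lemma sum_single_lookup: "finite A \<Longrightarrow> Poly_Mapping.keys x \<subseteq> A \<Longrightarrow> x = (\<Sum>n\<in>A. single n (lookup x n))"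
  by (auto intro!: poly_mapping_eqI simp: lookup_sum lookup_single when_def sum.delta in_keys_iff subset_iff)

text \<open>The converse direction rests on maximality of the topology: all seminorms with
  continuous restrictions generate an admissible topology, which is therefore coarser than
  \<open>S\<close>.\<close>

lemma continuous_seminorms_S:
  "q \<in> continuous_seminorms d S \<longleftrightarrow>
    seminorm d q \<and> (\<forall>n. (\<lambda>x. q (single n x)) \<in> continuous_seminorms s (X n))"
proof
  assume q: "q \<in> continuous_seminorms d S"
  have "continuous_map (X n) S (single n)" for n
    using embedding_single[of n] by (auto simp: embedding_map_def homeomorphic_eq_everything_map
            continuous_map_in_subtopology)
  then show "seminorm d q \<and> (\<forall>n. (\<lambda>x. q (single n x)) \<in> continuous_seminorms s (X n))"
    using continuous_seminorms_compose[OF sum.vector_space_axioms linear_single _ tvs q]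
      sum.continuous_seminormsD[OF q] by blast
next
  define Q where "Q = {q. seminorm d q \<and> (\<forall>n. (\<lambda>x. q (single n x)) \<in> continuous_seminorms s (X n))}"
  let ?T = "seminorm_topology W Q"
  have Q: "seminorm d q" if "q \<in> Q" for q using that by (simp add: Q_def)
  have Qne: "Q \<noteq> {}"
    using sum.seminorm_zero_fun continuous_seminorms_zero[OF tvs] by (auto simp: Q_def)
  have Qadd: "(\<lambda>x. p x + q x) \<in> Q" if "p \<in> Q" "q \<in> Q" for p q
    using that by (auto simp: Q_def sum.seminorm_plus_fun intro!: continuous_seminorms_add[OF tvs])
  have Qmult: "(\<lambda>x. C * q x) \<in> Q" if "q \<in> Q" "C \<ge> 0" for q C
    using that by (auto simp: Q_def sum.seminorm_mult_fun intro!: continuous_seminorms_mult[OF tvs])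
  note facts = subspace_W Q Qne Qadd Qmult
  \<comment> \<open>Seminorms of a single coordinate belong to \<open>Q\<close>; they separate
    points and make the coordinate maps continuous.\<close>
  have Ql: "(\<lambda>x. p (lookup x n)) \<in> Q" if p: "p \<in> continuous_seminorms s (X n)" for p n
  proof -
    have "(\<lambda>x. p (lookup (single m x) n)) \<in> continuous_seminorms s (X m)" for m
    proof (cases "m = n")
      case True
      then show ?thesis using p by simp
    next
      case False
      then show ?thesis
        using continuous_seminorms_zero[OF tvs] seminorm_zero[OF continuous_seminormsD[OF p]]
        by (simp add: lookup_single when_def)
    qed
    then show ?thesis
      using sum.seminorm_compose[OF continuous_seminormsD[OF p] linear_lookup] by (simp add: Q_def)
  qed
  have lcT: "locally_convex_space d ?T"
  proof (rule sum.locally_convex_seminorm_topology)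
    fix x assume x: "x \<in> W" "\<And>q. q \<in> Q \<Longrightarrow> q x = 0"
    show "x = 0"
    proof (rule poly_mapping_eqI, rule ccontr)
      fix n assume "lookup x n \<noteq> lookup 0 n"
      then have "lookup x n \<in> V n" "lookup x n \<noteq> 0" using x by (auto simp: direct_sum_def)
      then obtain p where "p \<in> continuous_seminorms s (X n)" "p (lookup x n) \<noteq> 0"
        by (rule continuous_seminorms_separating[OF lc])
      then show False using x(2)[OF Ql] by simp
    qed
  qed (fact facts)+
  have topT: "topspace ?T = W" by (rule sum.topspace_seminorm_topology) (fact facts)+
  have QT: "Q \<subseteq> continuous_seminorms d ?T"
    by (rule sum.continuous_seminorms_seminorm_topology) (fact facts)+
  have opT: "openin ?T U \<longleftrightarrow> U \<subseteq> W \<and> (\<forall>x\<in>U. \<exists>q\<in>Q. \<forall>y\<in>W. q (y - x) < 1 \<longrightarrow> y \<in> U)" for U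
    by (rule sum.openin_seminorm_topology) (fact facts)+
  have look: "continuous_map ?T (X n) (\<lambda>x. lookup x n)" for n
    by (rule sum.continuous_map_linearI[OF vector_space_axioms linear_lookup lcT lc])
      (use Ql QT topT in \<open>auto simp: direct_sum_def\<close>)
  have sing: "continuous_map (X n) ?T (single n)" for n
    unfolding continuous_map_def topT
  proof (intro conjI allI impI)
    show "single n \<in> V n \<rightarrow> W" using single_in_W by auto
    fix U assume U: "openin ?T U"
    show "openin (X n) {x \<in> V n. single n x \<in> U}"
      unfolding openin_iff_continuous_seminorms[OF lc]
    proof (intro conjI ballI)
      fix x assume x: "x \<in> {x \<in> V n. single n x \<in> U}"
      then obtain q where q: "q \<in> Q" "\<And>y. y \<in> W \<Longrightarrow> q (y - single n x) < 1 \<Longrightarrow> y \<in> U"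
        using U unfolding opT by blast
      show "\<exists>p\<in>continuous_seminorms s (X n). \<forall>y\<in>V n. p (y - x) < 1 \<longrightarrow> y \<in> {x \<in> V n. single n x \<in> U}"
        using q single_in_W[of _ n] by (intro bexI[of _ "\<lambda>x. q (single n x)"]) (auto simp: single_diff Q_def)
    qed auto
  qed
  have adm: "admissible_sum_topology s X ?T"
    unfolding admissible_sum_topology_def
    by (intro conjI allI topT lcT embedding_map_single look sing)
  assume "seminorm d q \<and> (\<forall>n. (\<lambda>x. q (single n x)) \<in> continuous_seminorms s (X n))"
  then have "q \<in> continuous_seminorms d ?T" using QT by (auto simp: Q_def)
  then show "q \<in> continuous_seminorms d S"
    using openin_direct_sum_topologyI[OF adm] unfolding continuous_seminorms_def by blast
qed

text \<open>Since seminorms are tested on one summand at a time, the bounds for \<open>L\<close> on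
  different summands need not be related to each other.\<close>

lemma continuous_map_S:
  assumes lin: "Vector_Spaces.linear d d L" and into: "\<And>x. x \<in> W \<Longrightarrow> L x \<in> W"
    and bd: "\<And>q n. q \<in> continuous_seminorms d S \<Longrightarrow> (\<lambda>x. q (L (single n x))) \<in> continuous_seminorms s (X n)"
  shows "continuous_map S S L"
  by (rule sum.continuous_map_linearI[OF sum.vector_space_axioms lin lc_S lc_S])
    (use into bd sum.seminorm_compose[OF sum.continuous_seminormsD lin]
      in \<open>auto simp: topspace_S continuous_seminorms_S[of "\<lambda>x. _ (L x)"]\<close>)

text \<open>Every element has finite support, so the seminorms \<open>r n\<close> may grow with
  \<open>n\<close> as fast as desired.\<close>

lemma weighted_sum_seminorm:
  assumes r: "\<And>n. r n \<in> continuous_seminorms s (X n)"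
  shows "(\<lambda>x. \<Sum>n\<in>Poly_Mapping.keys x. r n (lookup x n)) \<in> continuous_seminorms d S"
proof -
  let ?q = "\<lambda>x. \<Sum>n\<in>Poly_Mapping.keys x. r n (lookup x n)"
  note sr = continuous_seminormsD[OF r]
  have ext: "?q x = (\<Sum>n\<in>A. r n (lookup x n))" if "finite A" "Poly_Mapping.keys x \<subseteq> A" for A x
    by (rule sum.mono_neutral_left) (use that seminorm_zero[OF sr] in \<open>auto simp: in_keys_iff\<close>)
  have "seminorm d ?q"
    unfolding seminorm_def
  proof (intro conjI allI)
    fix x y :: "nat \<Rightarrow>\<^sub>0 'a"
    let ?A = "Poly_Mapping.keys x \<union> Poly_Mapping.keys y"
    have "?q (x + y) = (\<Sum>n\<in>?A. r n (lookup x n + lookup y n))"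
      using ext[of ?A "x + y"] Poly_Mapping.keys_add[of x y] by (simp add: lookup_add)
    also have "\<dots> \<le> (\<Sum>n\<in>?A. r n (lookup x n) + r n (lookup y n))"
      by (intro sum_mono seminorm_add[OF sr])
    also have "\<dots> = ?q x + ?q y"
      using ext[of ?A x] ext[of ?A y] by (simp add: sum.distrib)
    finally show "?q (x + y) \<le> ?q x + ?q y" .
  next
    fix c and x :: "nat \<Rightarrow>\<^sub>0 'a"
    have "Poly_Mapping.keys (d c x) \<subseteq> Poly_Mapping.keys x"
      by (auto simp: in_keys_iff lookup_d)
    then have "?q (d c x) = (\<Sum>n\<in>Poly_Mapping.keys x. r n (lookup (d c x) n))"
      by (intro ext) auto
    then show "?q (d c x) = norm c * ?q x"
      by (simp add: lookup_d seminorm_scale[OF sr] sum_distrib_left)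
  qed
  moreover have "?q (single n x) = r n x" for n x
    using ext[of "{n}" "single n x"] by (simp add: lookup_single)
  ultimately show ?thesis using r by (simp add: continuous_seminorms_S)
qed

end

section \<open>Finitely many infinite-dimensional summands\<close>

context rc_vector_space
begin

lemma exists_functional_one:
  assumes "independent B"
  obtains l where "functional l" "\<And>x. x \<in> B \<Longrightarrow> l x = 1"
proof -
  interpret pair: vector_space_pair scale "(*) :: 'k \<Rightarrow> 'k \<Rightarrow> 'k"
    by (intro vector_space_pair.intro vector_space_axioms vector_space_mult)
  show ?thesis
    using pair.linear_independent_extend[OF assms, of "\<lambda>_. 1"] that by auto
qed

lemma exists_functional_vanishing:
  assumes b: "b \<notin> span E"
  obtains l where "functional l" "l b = 1" "\<And>x. x \<in> span E \<Longrightarrow> l x = 0"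
proof -
  interpret pair: vector_space_pair scale "(*) :: 'k \<Rightarrow> 'k \<Rightarrow> 'k"
    by (intro vector_space_pair.intro vector_space_axioms vector_space_mult)
  obtain B where B: "B \<subseteq> E" "independent B" "E \<subseteq> span B"
    using maximal_independent_subset[of E] by blast
  have sp: "span B = span E"
    using B(1,3) by (metis span_mono span_span subset_antisym)
  have "independent (insert b B)" using B(2) b sp by (simp add: independent_insert)
  then obtain l where l: "functional l" "\<And>x. x \<in> insert b B \<Longrightarrow> l x = (if x = b then 1 else 0)"
    using pair.linear_independent_extend[of "insert b B" "\<lambda>x. if x = b then 1 else 0"] by blast
  have "l x = 0" if "x \<in> B" for x
    using l(2)[of x] that b sp span_base[of x B] by auto
  then have "l x = 0" if "x \<in> span B" for x
    using pair.linear_eq_0_on_span[OF l(1)] that by blast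
  then show ?thesis using that l sp by simp
qed

text \<open>By induction on the size of a spanning set: a bounded functional \<open>f\<close> with
  \<open>f b = 1\<close> splits off the line of \<open>b\<close>, and the other generators, moved
  into the kernel of \<open>f\<close>, span what remains.\<close>

lemma functional_bounded_of_finite_dimensional:
  fixes p :: "nat \<Rightarrow> 'b \<Rightarrow> real"
  assumes p: "\<And>m. seminorm scale (p m)" and mono: "\<And>m n x. m \<le> n \<Longrightarrow> p m x \<le> p n x"
    and l: "functional l" and B: "finite B"
    and sep: "\<And>x. x \<in> span B \<Longrightarrow> (\<And>m. p m x = 0) \<Longrightarrow> x = 0"
  shows "\<exists>C m. 0 \<le> C \<and> (\<forall>x\<in>span B. norm (l x) \<le> C * p m x)"
proof -
  have "\<exists>C m. 0 \<le> C \<and> (\<forall>x\<in>span B. norm (l x) \<le> C * p m x)"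
    if "finite B" "card B \<le> n" "\<And>x. x \<in> span B \<Longrightarrow> (\<And>m. p m x = 0) \<Longrightarrow> x = 0" for B n
    using that
  proof (induction n arbitrary: B)
    case 0
    then have "B = {}" by simp
    then show ?case using functional_zero[OF l] by (intro exI[of _ 0]) auto
  next
    case (Suc n)
    show ?case
    proof (cases "B \<subseteq> {0}")
      case True
      then have "span B \<subseteq> {0}" using span_minimal[OF True subspace_single_0] by simp
      then show ?thesis using functional_zero[OF l] by (intro exI[of _ 0]) auto
    next
      case False
      then obtain b where b: "b \<in> B" "b \<noteq> 0" by blast
      then obtain m where "p m b \<noteq> 0" using Suc.prems(3)[of b] span_base by blast
      then obtain f D where f: "functional f" "f b = 1" and D: "\<And>x. norm (f x) \<le> D * p m x"
        using Hahn_Banach[OF p] by blast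
      define r where "r x = x - scale (f x) b" for x
      have r: "Vector_Spaces.linear scale scale r"
        by (auto simp: linear_to_iff[OF vector_space_axioms] r_def functional_add[OF f(1)]
            functional_scale[OF f(1)] scale_left_distrib scale_right_diff_distrib)
      define B' where "B' = r ` (B - {b})"
      have rb: "r b = 0" by (simp add: r_def f)
      have "r ` B \<subseteq> insert 0 B'" using rb by (auto simp: B'_def)
      then have "span (r ` B) \<subseteq> span B'" using span_mono span_insert_0 by metis
      then have rB: "r x \<in> span B'" if "x \<in> span B" for x
        using module_hom.span_image[OF Vector_Spaces.linear.axioms(3)[OF r], of B] that by blast
      have B'B: "span B' \<subseteq> span B"
        by (rule span_minimal) (auto simp: B'_def r_def b intro!: span_diff span_scale intro: span_base)
      have "card B' \<le> card (B - {b})" unfolding B'_def using Suc.prems(1) by (intro card_image_le) auto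
      then have card: "card B' \<le> n" using Suc.prems(1,2) b(1) by simp
      have "finite B'" using Suc.prems(1) by (simp add: B'_def)
      then obtain C m' where C: "0 \<le> C" and Cb: "\<And>x. x \<in> span B' \<Longrightarrow> norm (l x) \<le> C * p m' x"
        using Suc.IH[OF _ card] Suc.prems(3) B'B by blast
      define M where "M = max m m'"
      have D': "norm (f x) \<le> \<bar>D\<bar> * p M x" for x
      proof -
        have "norm (f x) \<le> \<bar>D\<bar> * p m x"
          by (rule order_trans[OF D mult_right_mono]) (simp_all add: seminorm_nonneg[OF p])
        also have "\<dots> \<le> \<bar>D\<bar> * p M x" by (intro mult_left_mono mono) (auto simp: M_def)
        finally show ?thesis .
      qed
      let ?K = "\<bar>D\<bar> * norm (l b) + C * (1 + \<bar>D\<bar> * p m' b)"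
      have "norm (l x) \<le> ?K * p M x" if "x \<in> span B" for x
      proof -
        have "l x = f x * l b + l (r x)"
          using functional_diff[OF l] functional_scale[OF l] by (simp add: r_def)
        then have "norm (l x) \<le> norm (f x) * norm (l b) + norm (l (r x))"
          by (metis norm_mult norm_triangle_ineq)
        also have "norm (l (r x)) \<le> C * p m' (r x)" by (rule Cb[OF rB[OF that]])
        also have "p m' (r x) \<le> p m' x + norm (f x) * p m' b"
          unfolding r_def using seminorm_diff[OF p, of m' x "scale (f x) b"] by (simp add: seminorm_scale[OF p])
        also have "p m' x \<le> p M x" by (rule mono) (simp add: M_def)
        finally have "norm (l x) \<le> norm (f x) * norm (l b) + C * (p M x + norm (f x) * p m' b)"
          using C by (simp add: mult_left_mono)
        also have "\<dots> \<le> (\<bar>D\<bar> * p M x) * norm (l b) + C * (p M x + (\<bar>D\<bar> * p M x) * p m' b)"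
          using D'[of x] C seminorm_nonneg[OF p, of m' b]
          by (intro add_mono mult_right_mono mult_left_mono) auto
        finally show ?thesis by (simp add: algebra_simps)
      qed
      moreover have "0 \<le> ?K" using C seminorm_nonneg[OF p, of m' b] by simp
      ultimately show ?thesis by blast
    qed
  qed
  then show ?thesis using B sep by blast
qed

text \<open>Among all independent sets contained in some \<open>N k\<close> there is one of maximal
  cardinality, since \<open>card B\<close> bounds them; it spans every later member of the
  chain.\<close>

lemma eventually_stable_subspaces:
  fixes N :: "nat \<Rightarrow> 'b set"
  assumes B: "finite B" and sub: "\<And>k. subspace (N k)" and NB: "\<And>k. N k \<subseteq> span B"
    and mono: "\<And>k l. k \<le> l \<Longrightarrow> N k \<subseteq> N l"
  obtains K where "\<And>k. k \<ge> K \<Longrightarrow> N k = N K"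
proof -
  let ?P = "\<lambda>(K, b). independent b \<and> b \<subseteq> N K"
  have bound: "finite b \<and> card b \<le> card B" if "independent b" "b \<subseteq> N k" for b k
    using independent_span_bound[OF B that(1)] that(2) NB by blast
  have "\<exists>x. ?P x \<and> (\<forall>y. ?P y \<longrightarrow> (card \<circ> snd) y \<le> (card \<circ> snd) x)"
    by (rule ex_has_greatest_nat[of _ "(0, {})" _ "Suc (card B)"])
      (use bound in \<open>auto simp: independent_empty less_Suc_eq_le\<close>)
  then obtain K b where b: "independent b" "b \<subseteq> N K"
    and max: "\<And>k c. independent c \<Longrightarrow> c \<subseteq> N k \<Longrightarrow> card c \<le> card b" by auto
  have "N k = N K" if k: "k \<ge> K" for k
  proof
    show "N k \<subseteq> N K"
    proof
      fix v assume v: "v \<in> N k"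
      have "v \<in> span b"
      proof (rule ccontr)
        assume nv: "v \<notin> span b"
        then have "v \<notin> b" using span_base by blast
        have "independent (insert v b)" using b(1) nv by (simp add: independent_insert)
        moreover have "insert v b \<subseteq> N k" using v b(2) mono[OF k] by blast
        ultimately have "card (insert v b) \<le> card b" by (rule max)
        then show False using \<open>v \<notin> b\<close> bound[OF b] by simp
      qed
      then show "v \<in> N K" using span_minimal[OF b(2) sub] by blast
    qed
  qed (rule mono[OF k])
  then show ?thesis by (rule that)
qed

text \<open>
  With \<open>E k\<close> the span of \<open>f\<^sup>j(B)\<close> for \<open>j < k\<close>, the subspaces \<open>{u \<in> span B. f\<^sup>k u \<in> E k}\<close> increase and
  hence stabilise. From then on a point outside \<open>E k\<close> is moved outside \<open>E (k + 1)\<close>, so the orbit climbs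
  one step of the filtration at a time and is eventually linearly independent.
\<close>

lemma perturbed_orbit_functional:
  assumes f: "Vector_Spaces.linear scale scale f" and B: "finite B"
    and g0: "g 0 \<in> span B" and gS: "\<And>k. g (Suc k) - f (g k) \<in> span B"
    and unb: "\<And>E. finite E \<Longrightarrow> \<exists>k. g k \<notin> span E"
  obtains l m where "functional l" "\<And>k. k \<ge> m \<Longrightarrow> l (g k) = 1"
proof -
  interpret f: Vector_Spaces.linear scale scale f by (rule f)
  have fk: "Vector_Spaces.linear scale scale (f ^^ k)" for k
    by (induction k) (auto simp: linear_to_iff[OF vector_space_axioms] f.add f.scale)
  have fmod: "module_hom scale scale (f ^^ k)" for k
    by (rule Vector_Spaces.linear.axioms(3)[OF fk])
  define U where "U k = (\<Union>j<k. (f ^^ j) ` B)" for k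
  define E where "E k = span (U k)" for k
  have Esub: "subspace (E k)" for k by (simp add: E_def)
  have Emono: "E k \<subseteq> E l" if "k \<le> l" for k l
    unfolding E_def U_def using that by (intro span_mono) (auto intro: order.strict_trans2)
  have BE: "span B \<subseteq> E (Suc k)" for k
    unfolding E_def U_def by (rule span_mono) (auto intro!: bexI[of _ 0])
  have fE: "f x \<in> E (Suc k)" if "x \<in> E k" for x k
  proof -
    have "f ` U k \<subseteq> U (Suc k)"
    proof (rule image_subsetI)
      fix y assume "y \<in> U k"
      then obtain j b where j: "j < k" "b \<in> B" "y = (f ^^ j) b" unfolding U_def by blast
      then have "f y \<in> (f ^^ Suc j) ` B" by simp
      then show "f y \<in> U (Suc k)" unfolding U_def using j(1) by blast
    qed
    then have "span (f ` U k) \<subseteq> E (Suc k)" unfolding E_def by (rule span_mono)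
    then show ?thesis using that f.span_image[of "U k"] unfolding E_def by blast
  qed
  have dec: "\<exists>u\<in>span B. \<exists>w\<in>E k. v = (f ^^ k) u + w" if "v \<in> E (Suc k)" for v k
  proof -
    have "U (Suc k) = (f ^^ k) ` B \<union> U k" unfolding U_def lessThan_Suc by (rule UN_insert)
    then have "v \<in> span ((f ^^ k) ` B \<union> U k)" using that by (simp add: E_def)
    then obtain a w where "a \<in> span ((f ^^ k) ` B)" "w \<in> E k" "v = a + w"
      unfolding span_Un E_def by blast
    moreover from this(1) obtain u where "u \<in> span B" "a = (f ^^ k) u"
      unfolding module_hom.span_image[OF fmod] by (rule imageE)
    ultimately show ?thesis by (intro bexI[of _ u] bexI[of _ w]) simp_all
  qed
  define N where "N k = {v \<in> span B. (f ^^ k) v \<in> E k}" for k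
  have Nsub: "subspace (N k)" for k
    unfolding N_def subspace_def
    by (auto simp: module_hom.add[OF fmod] module_hom.scale[OF fmod] module_hom.zero[OF fmod]
        intro: span_add span_scale span_zero subspace_add[OF Esub] subspace_scale[OF Esub] subspace_0[OF Esub])
  have "N k \<subseteq> N (Suc k)" for k using fE by (auto simp: N_def)
  then have Nmono: "N k \<subseteq> N l" if "k \<le> l" for k l using that by (rule lift_Suc_mono_le)
  obtain K where K: "\<And>k. k \<ge> K \<Longrightarrow> N k = N K"
    by (rule eventually_stable_subspaces[OF B Nsub _ Nmono]) (auto simp: N_def)
  \<comment> \<open>Writing \<open>v\<close> as \<open>(f ^^ k) u + w\<close> puts
    \<open>(f ^^ Suc k) u\<close> into \<open>E (Suc k)\<close>, so \<open>u\<close> lies in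
    \<open>N (Suc k)\<close>. By stability it lies in \<open>N k\<close>, which returns
    \<open>v\<close> to \<open>E k\<close>.\<close>
  have key: "v \<in> E k" if "k \<ge> K" "v \<in> E (Suc k)" "f v \<in> E (Suc k)" for v k
  proof -
    obtain u w where u: "u \<in> span B" and w: "w \<in> E k" and v: "v = (f ^^ k) u + w"
      using dec[OF \<open>v \<in> E (Suc k)\<close>] by blast
    have "(f ^^ Suc k) u = f v - f w" by (simp add: v f.add)
    also have "\<dots> \<in> E (Suc k)" by (rule subspace_diff[OF Esub that(3) fE[OF w]])
    finally have "u \<in> N (Suc k)" using u by (simp add: N_def)
    then have "u \<in> N k" using K[of k] K[of "Suc k"] that(1) by simp
    then show ?thesis unfolding v by (intro subspace_add[OF Esub] w) (simp add: N_def)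
  qed
  have gE: "g k \<in> E (Suc k)" for k
  proof (induction k)
    case 0
    then show ?case using g0 BE by blast
  next
    case (Suc k)
    have "f (g k) + (g (Suc k) - f (g k)) \<in> E (Suc (Suc k))"
      using gS[of k] BE by (intro subspace_add[OF Esub] fE Suc) blast
    then show ?case by simp
  qed
  have "finite (U K)" using B by (simp add: U_def)
  then obtain m where m: "g m \<notin> E K" using unb unfolding E_def by blast
  \<comment> \<open>The lowest step of the filtration that contains \<open>g m\<close>. As
    \<open>g m\<close> is outside \<open>E K\<close>, it lies above \<open>K\<close>, in the stable
    range.\<close>
  define k0 where "k0 = (LEAST k. g m \<in> E k)"
  have k0: "g m \<in> E k0" unfolding k0_def by (rule LeastI[of "\<lambda>k. g m \<in> E k", OF gE])
  have "k0 > K" using m k0 Emono[of k0 K] by (meson not_le subsetD)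
  then obtain k where k: "k0 = Suc k" "k \<ge> K" by (metis less_Suc_eq_le less_imp_Suc_add le_add1)
  have "g m \<notin> E k" using not_less_Least[of k "\<lambda>k. g m \<in> E k"] k by (simp add: k0_def)
  have step: "g (m + j) \<in> E (Suc (k + j)) \<and> g (m + j) \<notin> E (k + j)" for j
  proof (induction j)
    case 0
    then show ?case using k0 k \<open>g m \<notin> E k\<close> by simp
  next
    case (Suc j)
    define a where "a = g (Suc (m + j)) - f (g (m + j))"
    \<comment> \<open>The perturbation lies in every step of the filtration from the first on, so it
      cannot interfere with the climb.\<close>
    have a: "a \<in> E (Suc l)" for l using gS BE unfolding a_def by blast
    have eq: "g (m + Suc j) = f (g (m + j)) + a" by (simp add: a_def)
    have "g (m + Suc j) \<in> E (Suc (k + Suc j))"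
      unfolding eq using Suc fE a by (intro subspace_add[OF Esub]) auto
    moreover have "g (m + Suc j) \<notin> E (k + Suc j)"
    proof
      assume "g (m + Suc j) \<in> E (k + Suc j)"
      then have "(f (g (m + j)) + a) - a \<in> E (Suc (k + j))"
        unfolding eq[symmetric] by (intro subspace_diff[OF Esub] a) simp
      then have "g (m + j) \<in> E (k + j)" using Suc k(2) key[of "k + j" "g (m + j)"] by simp
      then show False using Suc by simp
    qed
    ultimately show ?case by simp
  qed
  define h where "h j = g (m + j)" for j
  have "independent (h ` {..<n})" for n
  proof (induction n)
    case 0
    then show ?case by (simp add: independent_empty)
  next
    case (Suc n)
    have "h ` {..<n} \<subseteq> E (k + n)"
    proof (rule image_subsetI)
      fix j assume "j \<in> {..<n}"
      then have "E (Suc (k + j)) \<subseteq> E (k + n)" by (intro Emono) auto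
      then show "h j \<in> E (k + n)" using step[of j] unfolding h_def by blast
    qed
    then have "span (h ` {..<n}) \<subseteq> E (k + n)" by (rule span_minimal[OF _ Esub])
    then have "h n \<notin> span (h ` {..<n})" using step[of n] unfolding h_def by blast
    then show ?case using Suc by (simp add: lessThan_Suc independent_insert)
  qed
  then have "independent (\<Union> (range (\<lambda>n. h ` {..<n})))"
  proof (intro independent_Union_directed)
    fix c d assume "c \<in> range (\<lambda>n. h ` {..<n})" "d \<in> range (\<lambda>n. h ` {..<n})"
    then obtain i j where "c = h ` {..<i}" "d = h ` {..<j}" by blast
    then show "c \<subseteq> d \<or> d \<subseteq> c"
      using image_mono[of "{..<i}" "{..<j}" h] image_mono[of "{..<j}" "{..<i}" h] by (cases "i \<le> j") auto
  qed auto
  moreover have "\<Union> (range (\<lambda>n. h ` {..<n})) = range h" by auto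
  ultimately obtain l where l: "functional l" "\<And>x. x \<in> range h \<Longrightarrow> l x = 1"
    using exists_functional_one by metis
  have "l (g j) = 1" if "j \<ge> m" for j
    using l(2)[OF rangeI, of "j - m"] that by (simp add: h_def)
  then show ?thesis using that l(1) by blast
qed

lemma seminorm_norm_functional: "functional f \<Longrightarrow> seminorm scale (\<lambda>x. norm (f x))"
  by (simp add: seminorm_def functional_add functional_scale norm_triangle_ineq norm_mult)

end

section \<open>Direct sums of Frechet spaces, with an increasing sequence of seminorms fixed on each
  summand\<close>

locale frechet_sequence = locally_convex_sequence s X
  for s :: "'k::real_or_complex \<Rightarrow> 'a::ab_group_add \<Rightarrow> 'a" and X :: "nat \<Rightarrow> 'a topology" +
  fixes P :: "nat \<Rightarrow> nat \<Rightarrow> 'a \<Rightarrow> real"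
  assumes P: "P n m \<in> continuous_seminorms s (X n)"
    and P_mono: "m \<le> m' \<Longrightarrow> P n m x \<le> P n m' x"
    and P_dominates: "p \<in> continuous_seminorms s (X n) \<Longrightarrow> \<exists>m. \<forall>x\<in>topspace (X n). p x \<le> P n m x"
    and P_separates: "x \<in> topspace (X n) \<Longrightarrow> (\<And>m. P n m x = 0) \<Longrightarrow> x = 0"
    and P_complete: "\<lbrakk>\<And>k. y k \<in> topspace (X n);
        \<And>m \<epsilon>. \<epsilon> > 0 \<Longrightarrow> \<exists>N. \<forall>i\<ge>N. \<forall>j\<ge>N. P n m (y i - y j) < \<epsilon>\<rbrakk> \<Longrightarrow>
       \<exists>l\<in>topspace (X n). \<forall>m. (\<lambda>k. P n m (y k - l)) \<longlonglongrightarrow> 0"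
    and nonzero: "topspace (X n) \<noteq> {0}"
begin

lemmas seminorm_P = continuous_seminormsD[OF P]

definition restrict_support :: "nat set \<Rightarrow> (nat \<Rightarrow>\<^sub>0 'a) \<Rightarrow> (nat \<Rightarrow>\<^sub>0 'a)" where
  "restrict_support A x = (\<Sum>n\<in>Poly_Mapping.keys x \<inter> A. single n (lookup x n))"

lemma lookup_restrict_support: "lookup (restrict_support A x) n = (if n \<in> A then lookup x n else 0)"
  by (auto simp: restrict_support_def lookup_sum lookup_single when_def sum.delta' sum.delta in_keys_iff)

lemma linear_restrict_support: "Vector_Spaces.linear d d (restrict_support A)"
  by (auto simp: sum.linear_to_iff[OF sum.vector_space_axioms] lookup_restrict_support lookup_add lookup_d
      intro!: poly_mapping_eqI)

lemma restrict_support_in_W: "x \<in> W \<Longrightarrow> restrict_support A x \<in> W"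
  using subspace_0[OF V] by (auto simp: direct_sum_def lookup_restrict_support)

text \<open>On a summand in \<open>A\<close> the functional is bounded by finite dimension, on any
  other the composite is 0. Testing on single summands then suffices, even for infinite
  \<open>A\<close>.\<close>

lemma continuous_functional_S:
  assumes l: "sum.functional l" and fd: "\<And>n. n \<in> A \<Longrightarrow> finite_dimensional_on s (V n)"
  shows "(\<lambda>x. norm (l (restrict_support A x))) \<in> continuous_seminorms d S"
proof -
  interpret r: Vector_Spaces.linear d d "restrict_support A" by (rule linear_restrict_support)
  have lr: "sum.functional (\<lambda>x. l (restrict_support A x))"
    using l by (simp add: sum.functional_iff r.add r.scale)
  have "(\<lambda>x. norm (l (restrict_support A (single n x)))) \<in> continuous_seminorms s (X n)" for n
  proof (cases "n \<in> A")
    case True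
    interpret sg: Vector_Spaces.linear s d "single n" by (rule linear_single)
    have fn: "functional (\<lambda>x. l (restrict_support A (single n x)))"
      using lr by (simp add: functional_iff sum.functional_iff sg.add sg.scale)
    obtain B where B: "finite B" "span B = V n"
      using fd[OF True] by (auto simp: finite_dimensional_on_def)
    obtain C m where C: "0 \<le> C" "\<And>x. x \<in> V n \<Longrightarrow> norm (l (restrict_support A (single n x))) \<le> C * P n m x"
      using functional_bounded_of_finite_dimensional[where p = "P n", OF seminorm_P P_mono fn B(1)] P_separates
      unfolding B(2) by blast
    show ?thesis
      by (rule continuous_seminorms_mono[OF continuous_seminorms_mult[OF tvs P C(1)]])
        (use C(2) seminorm_norm_functional[OF fn] in auto)
  next
    case False
    then have "restrict_support A (single n x) = 0" for x
      using False by (intro poly_mapping_eqI) (auto simp: lookup_restrict_support lookup_single when_def)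
    then show ?thesis using continuous_seminorms_zero[OF tvs] sum.functional_zero[OF l] by simp
  qed
  then show ?thesis
    using sum.seminorm_norm_functional[OF lr] by (simp add: continuous_seminorms_S)
qed

text \<open>If infinitely many coordinates of \<open>f\<close> were non-zero, a weighted sum seminorm with rapidly
  growing weights would not be dominated by any of the countably many seminorms of \<open>X i\<close>.\<close>

lemma finitely_many_coordinates:
  assumes f: "\<And>z. z \<in> V i \<Longrightarrow> f z \<in> W"
    and cont: "\<And>q. q \<in> continuous_seminorms d S \<Longrightarrow> (\<lambda>z. q (f z)) \<in> continuous_seminorms s (X i)"
  shows "finite {n. \<exists>z\<in>V i. lookup (f z) n \<noteq> 0}" (is "finite ?N")
proof (rule ccontr)
  assume inf: "infinite ?N"
  obtain z where z: "\<And>n. n \<in> ?N \<Longrightarrow> z n \<in> V i \<and> lookup (f (z n)) n \<noteq> 0"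
    using bchoice[of ?N "\<lambda>n z. z \<in> V i \<and> lookup (f z) n \<noteq> 0"] by blast
  have "\<exists>r\<in>continuous_seminorms s (X n). n \<in> ?N \<longrightarrow> r (lookup (f (z n)) n) \<noteq> 0" for n
  proof (cases "n \<in> ?N")
    case True
    then have "lookup (f (z n)) n \<in> V n" "lookup (f (z n)) n \<noteq> 0"
      using z f by (auto simp: direct_sum_def)
    then show ?thesis using continuous_seminorms_separating[OF lc] by metis
  qed (use continuous_seminorms_zero[OF tvs] in auto)
  then have "\<forall>n. \<exists>r. r \<in> continuous_seminorms s (X n) \<and> (n \<in> ?N \<longrightarrow> r (lookup (f (z n)) n) \<noteq> 0)" by blast
  from choice[OF this] obtain r where r: "\<And>n. r n \<in> continuous_seminorms s (X n)"
    and rz: "\<And>n. n \<in> ?N \<Longrightarrow> r n (lookup (f (z n)) n) \<noteq> 0" by blast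
  \<comment> \<open>The weight gives the \<open>n\<close>-th term at \<open>f (z n)\<close> the
    value \<open>P i n (z n) + 1\<close>, which \<open>P i m (z n)\<close> cannot reach when
    \<open>n \<ge> m\<close>.\<close>
  define c where "c n = (P i n (z n) + 1) / r n (lookup (f (z n)) n)" for n
  note nn = seminorm_nonneg[OF continuous_seminormsD[OF r]] seminorm_nonneg[OF seminorm_P]
  have c: "c n \<ge> 0" for n using nn by (simp add: c_def add_nonneg_nonneg)
  let ?q = "\<lambda>x. \<Sum>n\<in>Poly_Mapping.keys x. c n * r n (lookup x n)"
  have "?q \<in> continuous_seminorms d S"
    by (intro weighted_sum_seminorm[of "\<lambda>n x. c n * r n x"] continuous_seminorms_mult[OF tvs r c])
  then obtain m where m: "\<And>y. y \<in> V i \<Longrightarrow> ?q (f y) \<le> P i m y"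
    using P_dominates[OF cont] by blast
  obtain n where n: "n \<in> ?N" "n \<ge> m"
    using inf by (meson infinite_nat_iff_unbounded_le)
  have "P i n (z n) + 1 = c n * r n (lookup (f (z n)) n)"
    using rz[OF n(1)] by (simp add: c_def)
  also have "\<dots> \<le> ?q (f (z n))"
    by (rule member_le_sum) (use z[OF n(1)] nn c in \<open>auto simp: in_keys_iff\<close>)
  also have "\<dots> \<le> P i m (z n)" using m z[OF n(1)] by blast
  also have "\<dots> \<le> P i n (z n)" by (rule P_mono[OF n(2)])
  finally show False by simp
qed

theorem not_hypercyclic:
  assumes fin: "finite {n. \<not> finite_dimensional_on s (V n)}"
  shows "\<not> hypercyclic_operator d S L"
proof
  assume hyp: "hypercyclic_operator d S L"
  then have cont: "continuous_map S S L"
    and Ladd: "\<And>x y. x \<in> W \<Longrightarrow> y \<in> W \<Longrightarrow> L (x + y) = L x + L y"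
    and Lscale: "\<And>c x. x \<in> W \<Longrightarrow> L (d c x) = d c (L x)"
    by (auto simp: hypercyclic_operator_def topspace_S)
  obtain x where x: "x \<in> W" and dense: "S closure_of {(L ^^ k) x | k. True} = W"
    using hyp by (auto simp: hypercyclic_operator_def topspace_S)
  define I where "I = {n. \<not> finite_dimensional_on s (V n)}"
  have finI: "finite I" and fd: "\<And>n. n \<in> - I \<Longrightarrow> finite_dimensional_on s (V n)"
    using fin by (auto simp: I_def)
  have LW: "L y \<in> W" if "y \<in> W" for y
    using cont that by (auto simp: continuous_map_def topspace_S)
  \<comment> \<open>\<open>L\<close> is known to be linear only on \<open>W\<close>; composing it
    with a projection onto \<open>W\<close> gives a map linear on the ambient type that agrees with
    \<open>L\<close> along the orbit.\<close>
  obtain \<rho> where \<rho>: "Vector_Spaces.linear d d \<rho>" "\<And>x. \<rho> x \<in> W" "\<And>x. x \<in> W \<Longrightarrow> \<rho> x = x"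
    using sum.exists_linear_projection[OF subspace_W] by blast
  interpret \<rho>: Vector_Spaces.linear d d \<rho> by (rule \<rho>(1))
  define M where "M y = L (\<rho> y)" for y
  have M: "Vector_Spaces.linear d d M"
    by (simp add: sum.linear_to_iff[OF sum.vector_space_axioms] M_def \<rho>.add \<rho>.scale Ladd Lscale \<rho>(2))
  interpret M: Vector_Spaces.linear d d M by (rule M)
  have "continuous_map S S M"
    by (rule continuous_map_eq[OF cont]) (simp add: M_def topspace_S \<rho>)
  then have csn: "(\<lambda>y. q (M y)) \<in> continuous_seminorms d S" if "q \<in> continuous_seminorms d S" for q
    by (rule sum.continuous_seminorms_compose[OF sum.vector_space_axioms M _ tvs_S that])
  have MW: "M y \<in> W" for y using LW \<rho>(2) by (simp add: M_def)
  define u where "u k = (L ^^ k) x" for k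
  have uW: "u k \<in> W" for k by (induction k) (auto simp: u_def x LW)
  have uS: "u (Suc k) = M (u k)" for k using uW[of k] by (simp add: M_def \<rho> u_def)
  have approx: "\<exists>k. p (u k - y) < 1" if "y \<in> W" "p \<in> continuous_seminorms d S" for y p
  proof -
    have "{(L ^^ k) x | k. True} \<subseteq> topspace S" using uW by (auto simp: u_def topspace_S)
    moreover have "y \<in> S closure_of {(L ^^ k) x | k. True}" using that dense by simp
    ultimately show ?thesis
      using that(2) by (auto simp: sum.in_closure_of_seminorms[OF lc_S] u_def)
  qed
  let ?\<pi> = "restrict_support (- I)"
  interpret \<pi>: Vector_Spaces.linear d d ?\<pi> by (rule linear_restrict_support)
  define g where "g k = ?\<pi> (u k)" for k
  have gW: "g k \<in> W" for k using uW by (simp add: g_def restrict_support_in_W)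
  have \<pi>\<pi>: "?\<pi> (?\<pi> y) = ?\<pi> y" for y
    by (intro poly_mapping_eqI) (simp add: lookup_restrict_support)
  \<comment> \<open>Density in the form used below: composed with the projection, \<open>l\<close>
    is continuous, so some orbit point takes a value within 1 of that at \<open>y\<close>.\<close>
  have no_gap: False
    if l: "sum.functional l" and y: "y \<in> W" "?\<pi> y = y" and gap: "\<And>k. norm (l (g k) - l y) \<ge> 1" for l y
  proof -
    obtain k where "norm (l (?\<pi> (u k - y))) < 1"
      using approx[OF y(1) continuous_functional_S[OF l fd]] by blast
    then show False using gap[of k] y(2) by (simp add: \<pi>.diff sum.functional_diff[OF l] g_def)
  qed
  have unb: "\<exists>k. g k \<notin> sum.span E" if E: "finite E" for E
  proof (rule ccontr)
    assume all: "\<not> (\<exists>k. g k \<notin> sum.span E)"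
    define K where "K = (\<Union>y\<in>E. Poly_Mapping.keys y)"
    have "finite (K \<union> I)" using E finI by (simp add: K_def)
    \<comment> \<open>Neither \<open>E\<close> nor \<open>I\<close> uses the coordinate
      \<open>n\<close>. A non-zero vector there lies outside the span of \<open>E\<close>, and a
      functional vanishing on that span but equal to 1 at the vector leaves a gap.\<close>
    then obtain n where n: "n \<notin> K" "n \<notin> I" using ex_new_if_finite[OF infinite_UNIV_nat] by blast
    obtain w where w: "w \<in> V n" "w \<noteq> 0" using nonzero[of n] subspace_0[OF V] by blast
    have sK: "sum.subspace {y. lookup y n = 0}"
      by (auto simp: sum.subspace_def lookup_add lookup_d)
    have "sum.span E \<subseteq> {y. lookup y n = 0}"
      by (rule sum.span_minimal[OF _ sK]) (use n(1) in \<open>auto simp: K_def in_keys_iff\<close>)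
    then have "single n w \<notin> sum.span E" using w(2) by auto
    then obtain l where l: "sum.functional l" "l (single n w) = 1" "\<And>y. y \<in> sum.span E \<Longrightarrow> l y = 0"
      using sum.exists_functional_vanishing by blast
    have "?\<pi> (single n w) = single n w"
      using n(2) by (intro poly_mapping_eqI) (auto simp: lookup_restrict_support lookup_single when_def)
    then show False
      using no_gap[OF l(1) single_in_W[OF w(1)]] l(2,3) all by simp
  qed
  \<comment> \<open>\<open>J\<close> collects the coordinates reached from the infinite-dimensional
    summands. Being finite, it confines their influence on the finite-dimensional part to the
    coordinates in \<open>J - I\<close>.\<close>
  define J where "J = (\<Union>i\<in>I. {n. \<exists>z\<in>V i. lookup (M (single i z)) n \<noteq> 0})"
  have finJ: "finite J"
    unfolding J_def
  proof (intro finite_UN_I finI finitely_many_coordinates MW)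
    fix i q assume "q \<in> continuous_seminorms d S"
    then show "(\<lambda>z. q (M (single i z))) \<in> continuous_seminorms s (X i)"
      using csn[of q] by (simp add: continuous_seminorms_S)
  qed
  have "\<forall>n\<in>- I. \<exists>B. finite B \<and> span B = V n"
    using fd unfolding finite_dimensional_on_def by blast
  then obtain b where b: "\<And>n. n \<in> - I \<Longrightarrow> finite (b n) \<and> span (b n) = V n" by metis
  \<comment> \<open>\<open>g 0\<close> is included because the recursion has to start inside the
    span of \<open>B\<close>.\<close>
  define B where "B = insert (g 0) (\<Union>n\<in>J - I. single n ` b n)"
  have finB: "finite B" using finJ b by (auto simp: B_def)
  have inB: "?\<pi> (M (u k - g k)) \<in> sum.span B" for k
  proof -
    let ?y = "?\<pi> (M (u k - g k))"
    have "u k - g k = (\<Sum>i\<in>I. single i (lookup (u k) i))"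
      using finI by (intro poly_mapping_eqI)
        (simp add: g_def lookup_minus lookup_restrict_support lookup_sum lookup_single when_def sum.delta)
    then have eq: "M (u k - g k) = (\<Sum>i\<in>I. M (single i (lookup (u k) i)))" by (simp add: M.sum)
    have lM: "lookup (M (u k - g k)) n = 0" if "n \<notin> J" for n
      unfolding eq lookup_sum using that uW[of k] by (intro sum.neutral) (auto simp: J_def direct_sum_def)
    have "Poly_Mapping.keys ?y \<subseteq> J - I"
      by (rule subsetI, rule ccontr) (auto simp: in_keys_iff lookup_restrict_support lM split: if_splits)
    then have "?y = (\<Sum>n\<in>J - I. single n (lookup ?y n))"
      using finJ by (intro sum_single_lookup) auto
    also have "\<dots> \<in> sum.span B"
    proof (rule sum.span_sum)
      fix n assume n: "n \<in> J - I"
      have "lookup ?y n \<in> V n"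
        using restrict_support_in_W[OF MW] by (auto simp: direct_sum_def)
      then have "single n (lookup ?y n) \<in> single n ` span (b n)" using b n by blast
      also have "\<dots> = sum.span (single n ` b n)"
        using module_hom.span_image[OF Vector_Spaces.linear.axioms(3)[OF linear_single]] by blast
      also have "\<dots> \<subseteq> sum.span B" by (rule sum.span_mono) (use n in \<open>auto simp: B_def\<close>)
      finally show "single n (lookup ?y n) \<in> sum.span B" .
    qed
    finally show ?thesis .
  qed
  have lin: "Vector_Spaces.linear d d (\<lambda>y. ?\<pi> (M y))"
    by (simp add: sum.linear_to_iff[OF sum.vector_space_axioms] M.add M.scale \<pi>.add \<pi>.scale)
  obtain l m where l: "sum.functional l" and lm: "\<And>k. k \<ge> m \<Longrightarrow> l (g k) = 1"
  proof (rule sum.perturbed_orbit_functional[OF lin finB])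
    show "g 0 \<in> sum.span B" by (rule sum.span_base) (simp add: B_def)
    show "g (Suc k) - ?\<pi> (M (g k)) \<in> sum.span B" for k
      using inB[of k] by (simp add: g_def uS M.diff \<pi>.diff)
  qed (use unb in blast)+
  \<comment> \<open>\<open>c\<close> exceeds every \<open>norm (l (g k))\<close> by at least 1: the
    sum takes care of the initial part and the 2 of the constant value 1 on the tail. The value
    \<open>c\<close> is attained by \<open>l\<close> at a multiple of \<open>g m\<close>.\<close>
  define c where "c = 2 + (\<Sum>k<m. norm (l (g k)))"
  have "norm (l (g k) - l (d (of_real c) (g m))) \<ge> 1" for k
  proof -
    have lc: "l (d (of_real c) (g m)) = of_real c" by (simp add: sum.functional_scale[OF l] lm)
    have c2: "c \<ge> 2" by (simp add: c_def sum_nonneg)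
    have "norm (l (g k)) \<le> c - 1"
    proof (cases "k < m")
      case True
      then have "norm (l (g k)) \<le> (\<Sum>k<m. norm (l (g k)))" by (intro member_le_sum) auto
      then show ?thesis by (simp add: c_def)
    next
      case False
      then show ?thesis using lm[of k] c2 by simp
    qed
    moreover have "c - norm (l (g k)) \<le> norm (of_real c - l (g k))"
      using norm_triangle_ineq2[of "of_real c" "l (g k)"] c2 by simp
    ultimately show ?thesis by (simp add: lc norm_minus_commute)
  qed
  moreover have "?\<pi> (d (of_real c) (g m)) = d (of_real c) (g m)"
    by (simp add: \<pi>.scale g_def \<pi>\<pi>)
  ultimately show False
    using no_gap[OF l, of "d (of_real c) (g m)"] sum.subspace_scale[OF subspace_W gW] by blast
qed

end

section \<open>Infinitely many infinite-dimensional summands\<close>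

context rc_vector_space
begin

lemma seminorm_limit_unique:
  assumes p: "\<And>m. seminorm scale (p m)" and U: "subspace U"
    and sep: "\<And>x. x \<in> U \<Longrightarrow> (\<And>m. p m x = 0) \<Longrightarrow> x = 0"
    and l: "l \<in> U" "\<And>m. (\<lambda>k. p m (y k - l)) \<longlonglongrightarrow> 0"
    and l': "l' \<in> U" "\<And>m. (\<lambda>k. p m (y k - l')) \<longlonglongrightarrow> 0"
  shows "l = l'"
proof -
  have "p m (l - l') = 0" for m
  proof -
    have "(\<lambda>k. p m (y k - l) + p m (y k - l')) \<longlonglongrightarrow> 0 + 0"
      by (intro tendsto_add l(2) l'(2))
    moreover have "p m (l - l') \<le> p m (y k - l) + p m (y k - l')" for k
      using seminorm_triangle[OF p, of m l l' "y k"] seminorm_diff_commute[OF p, of m l "y k"] by simp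
    ultimately have "p m (l - l') \<le> 0 + 0" by (intro LIMSEQ_le_const) auto
    then show ?thesis using seminorm_nonneg[OF p, of m "l - l'"] by simp
  qed
  then show ?thesis using sep[OF subspace_diff[OF U l(1) l'(1)]] by simp
qed

lemma sum_half_powers: "l \<le> k \<Longrightarrow> (\<Sum>j\<in>{l..<k}. (1/2 :: real) ^ j) = 2 * (1/2) ^ l - 2 * (1/2) ^ k"
  by (induction k rule: dec_induct) (auto simp: sum.atLeastLessThan_Suc)

text \<open>Small coefficients alone do not make the series continuous, since the \<open>f j\<close>
  may need ever stronger seminorms of \<open>x\<close>. \<open>compat\<close> says that for each
  target seminorm one source seminorm controls all but finitely many of the terms on which it does
  not vanish.\<close>

lemma exists_series_operator:
  fixes p p' :: "nat \<Rightarrow> 'b \<Rightarrow> real" and f :: "nat \<Rightarrow> 'b \<Rightarrow> 'k" and e :: "nat \<Rightarrow> 'b"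
  assumes p: "\<And>m. seminorm scale (p m)" and p': "\<And>m. seminorm scale (p' m)"
    and mono: "\<And>m n x. m \<le> n \<Longrightarrow> p m x \<le> p n x" and mono': "\<And>m n x. m \<le> n \<Longrightarrow> p' m x \<le> p' n x"
    and f: "\<And>j. functional (f j)" and bd: "\<And>j. \<exists>C. \<forall>x. norm (f j x) \<le> C * p (\<mu> j) x"
    and U: "subspace U" and e: "\<And>j. e j \<in> U"
    and sep: "\<And>x. x \<in> U \<Longrightarrow> (\<And>m. p' m x = 0) \<Longrightarrow> x = 0"
    and complete: "\<And>y. (\<And>k. y k \<in> U) \<Longrightarrow> (\<And>m \<epsilon>. \<epsilon> > 0 \<Longrightarrow> \<exists>N. \<forall>i\<ge>N. \<forall>j\<ge>N. p' m (y i - y j) < \<epsilon>) \<Longrightarrow>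
       \<exists>l\<in>U. \<forall>m. (\<lambda>k. p' m (y k - l)) \<longlonglongrightarrow> 0"
    and compat: "\<And>m. \<exists>J m'. \<forall>j\<ge>J. \<mu> j \<le> m' \<or> p' m (e j) = 0"
  obtains a :: "nat \<Rightarrow> real" and R where "\<And>j. a j > 0" "Vector_Spaces.linear scale scale R"
    "\<And>x. R x \<in> U" "\<And>m. \<exists>C m'. 0 \<le> C \<and> (\<forall>x. p' m (R x) \<le> C * p m' x)"
    "\<And>x k. (\<And>j. j \<ge> k \<Longrightarrow> f j x = 0) \<Longrightarrow> R x = (\<Sum>j<k. scale (of_real (a j) * f j x) (e j))"
proof -
  have "\<exists>C\<ge>0. \<forall>x. norm (f j x) \<le> C * p (\<mu> j) x" for j
  proof -
    obtain C where C: "\<And>x. norm (f j x) \<le> C * p (\<mu> j) x" using bd by blast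
    have "norm (f j x) \<le> \<bar>C\<bar> * p (\<mu> j) x" for x
      by (rule order_trans[OF C mult_right_mono]) (simp_all add: seminorm_nonneg[OF p])
    then show ?thesis by (intro exI[of _ "\<bar>C\<bar>"]) simp
  qed
  then obtain C where C0: "\<And>j. C j \<ge> 0" and C: "\<And>j x. norm (f j x) \<le> C j * p (\<mu> j) x" by metis
  note nn = seminorm_nonneg[OF p] and nn' = seminorm_nonneg[OF p']
  \<comment> \<open>This bounds the \<open>j\<close>-th term by (1/2)^j times
    \<open>p (\<mu> j) x\<close> in \<open>p' j\<close>, and hence in every \<open>p' m\<close> with
    \<open>m \<le> j\<close>.\<close>
  define a where "a j = (1/2) ^ j / ((C j + 1) * (1 + p' j (e j)))" for j
  have den: "(C j + 1) * (1 + p' j (e j)) > 0" for j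
    using C0[of j] nn'[of j "e j"] by (intro mult_pos_pos) auto
  have a: "a j > 0" for j using den[of j] by (simp add: a_def)
  have aC: "a j * C j * p' j (e j) \<le> (1/2) ^ j" for j
  proof -
    have "C j * p' j (e j) \<le> (C j + 1) * (1 + p' j (e j))"
      using C0[of j] nn'[of j "e j"] by (intro mult_mono) auto
    then have "a j * (C j * p' j (e j)) \<le> a j * ((C j + 1) * (1 + p' j (e j)))"
      using a[of j] by (intro mult_left_mono) auto
    also have "\<dots> = (1/2) ^ j"
      by (simp only: a_def times_divide_eq_left nonzero_mult_div_cancel_right[OF less_imp_neq[OF den, symmetric]])
    finally show ?thesis by (simp add: mult.assoc)
  qed
  define t where "t j x = scale (of_real (a j) * f j x) (e j)" for j x
  have pt: "p' m (t j x) = a j * norm (f j x) * p' m (e j)" for m j x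
    using a[of j] by (simp add: t_def seminorm_scale[OF p'] norm_mult)
  have tail: "\<exists>J m'. \<forall>j\<ge>J. \<forall>x. p' m (t j x) \<le> (1/2) ^ j * p m' x" for m
  proof -
    obtain J m' where J: "\<And>j. j \<ge> J \<Longrightarrow> \<mu> j \<le> m' \<or> p' m (e j) = 0" using compat by blast
    have "p' m (t j x) \<le> (1/2) ^ j * p m' x" if j: "j \<ge> max J m" for j x
    proof (cases "p' m (e j) = 0")
      case True
      then show ?thesis using nn[of m' x] by (simp add: pt)
    next
      case False
      then have \<mu>: "\<mu> j \<le> m'" using J[of j] j by auto
      have "a j * norm (f j x) * p' m (e j) \<le> a j * (C j * p m' x) * p' j (e j)"
      proof (intro mult_mono)
        show "norm (f j x) \<le> C j * p m' x"
          by (rule order_trans[OF C mult_left_mono[OF mono[OF \<mu>] C0]])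
      qed (use a[of j] C0[of j] nn[of m' x] nn'[of m "e j"] mono'[of m j "e j"] j in auto)
      also have "\<dots> = (a j * C j * p' j (e j)) * p m' x" by simp
      also have "\<dots> \<le> (1/2) ^ j * p m' x" by (rule mult_right_mono[OF aC nn])
      finally show ?thesis by (simp add: pt)
    qed
    then show ?thesis by blast
  qed
  define Sm where "Sm k x = (\<Sum>j<k. t j x)" for k x
  have SmU: "Sm k x \<in> U" for k x
    unfolding Sm_def t_def by (intro subspace_sum[OF U] subspace_scale[OF U] e)
  have tadd: "t j (x + y) = t j x + t j y" and tscale: "t j (scale c x) = scale c (t j x)" for j x y c
    by (simp_all add: t_def functional_add[OF f] functional_scale[OF f] distrib_left scale_left_distrib ac_simps)
  have Sadd: "Sm k (x + y) = Sm k x + Sm k y" and Sscale: "Sm k (scale c x) = scale c (Sm k x)" for k x y c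
    by (simp_all add: Sm_def tadd tscale sum.distrib scale_sum_right)
  have gap: "p' m (Sm k x - Sm l x) \<le> 2 * (1/2) ^ l * p m' x"
    if t: "\<And>j. j \<ge> J \<Longrightarrow> p' m (t j x) \<le> (1/2) ^ j * p m' x" and kl: "J \<le> l" "l \<le> k" for m m' J k l x
  proof -
    have "Sm k x - Sm l x = (\<Sum>j\<in>{l..<k}. t j x)"
      unfolding Sm_def lessThan_atLeast0 by (rule sum_diff_nat_ivl) (use kl in auto)
    then have "p' m (Sm k x - Sm l x) \<le> (\<Sum>j\<in>{l..<k}. p' m (t j x))" using seminorm_sum[OF p'] by simp
    also have "\<dots> \<le> (\<Sum>j\<in>{l..<k}. (1/2) ^ j * p m' x)" by (rule sum_mono) (use t kl in auto)
    also have "\<dots> = (2 * (1/2) ^ l - 2 * (1/2) ^ k) * p m' x"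
      by (simp only: sum_distrib_right[symmetric] sum_half_powers[OF kl(2)])
    also have "\<dots> \<le> 2 * (1/2) ^ l * p m' x" by (rule mult_right_mono[OF _ nn]) simp
    finally show ?thesis .
  qed
  have "\<exists>l\<in>U. \<forall>m. (\<lambda>k. p' m (Sm k x - l)) \<longlonglongrightarrow> 0" for x
  proof (rule complete)
    fix m and \<epsilon> :: real assume \<epsilon>: "\<epsilon> > 0"
    obtain J m' where J: "\<And>j. j \<ge> J \<Longrightarrow> p' m (t j x) \<le> (1/2) ^ j * p m' x" using tail by blast
    have "(\<lambda>n. 2 * (1/2) ^ n * p m' x) \<longlonglongrightarrow> 2 * 0 * p m' x"
      by (intro tendsto_intros LIMSEQ_realpow_zero) auto
    then have "\<forall>\<^sub>F n in sequentially. 2 * (1/2) ^ n * p m' x < \<epsilon>"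
      using \<epsilon> by (intro order_tendstoD(2)) auto
    then obtain N where N: "\<And>n. n \<ge> N \<Longrightarrow> 2 * (1/2) ^ n * p m' x < \<epsilon>"
      unfolding eventually_sequentially by blast
    have lt: "p' m (Sm i x - Sm j x) < \<epsilon>" if "j \<ge> max N J" "i \<ge> j" for i j
      using gap[where J = J and m = m and m' = m' and x = x and l = j and k = i] J N[of j] that by fastforce
    have "p' m (Sm i x - Sm j x) < \<epsilon>" if "i \<ge> max N J" "j \<ge> max N J" for i j
      using lt[of i j] lt[of j i] that seminorm_diff_commute[OF p', of m "Sm i x" "Sm j x"] by (cases "i \<le> j") auto
    then show "\<exists>N. \<forall>i\<ge>N. \<forall>j\<ge>N. p' m (Sm i x - Sm j x) < \<epsilon>" by blast
  qed (rule SmU)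
  then obtain R where RU: "\<And>x. R x \<in> U" and R: "\<And>x m. (\<lambda>k. p' m (Sm k x - R x)) \<longlonglongrightarrow> 0" by metis
  have uniq: "R x = l" if "l \<in> U" "\<And>m. (\<lambda>k. p' m (Sm k x - l)) \<longlonglongrightarrow> 0" for x l
    by (rule seminorm_limit_unique[OF p' U sep RU R that])
  have "R (x + y) = R x + R y" for x y
  proof (rule uniq[OF subspace_add[OF U RU RU]])
    fix m
    show "(\<lambda>k. p' m (Sm k (x + y) - (R x + R y))) \<longlonglongrightarrow> 0"
    proof (rule tendsto_sandwich[OF _ _ tendsto_const])
      show "(\<lambda>k. p' m (Sm k x - R x) + p' m (Sm k y - R y)) \<longlonglongrightarrow> 0"
        using tendsto_add[OF R[of m x] R[of m y]] by simp
      have "Sm k (x + y) - (R x + R y) = (Sm k x - R x) + (Sm k y - R y)" for k by (simp add: Sadd)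
      then show "\<forall>\<^sub>F k in sequentially. p' m (Sm k (x + y) - (R x + R y)) \<le> p' m (Sm k x - R x) + p' m (Sm k y - R y)"
        using seminorm_add[OF p'] by (simp only: eventually_True)
    qed (simp add: nn')
  qed
  moreover have "R (scale c x) = scale c (R x)" for c x
  proof (rule uniq[OF subspace_scale[OF U RU]])
    fix m
    have "p' m (Sm k (scale c x) - scale c (R x)) = norm c * p' m (Sm k x - R x)" for k
      unfolding Sscale scale_right_diff_distrib[symmetric] by (rule seminorm_scale[OF p'])
    then show "(\<lambda>k. p' m (Sm k (scale c x) - scale c (R x))) \<longlonglongrightarrow> 0"
      using tendsto_mult_left[OF R, of "norm c" m x] by simp
  qed
  ultimately have lin: "Vector_Spaces.linear scale scale R"
    by (simp add: linear_to_iff[OF vector_space_axioms])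
  have bound: "\<exists>C m'. 0 \<le> C \<and> (\<forall>x. p' m (R x) \<le> C * p m' x)" for m
  proof -
    obtain J m' where J: "\<And>j x. j \<ge> J \<Longrightarrow> p' m (t j x) \<le> (1/2) ^ j * p m' x" using tail by blast
    \<comment> \<open>The terms before \<open>J\<close> are not covered by \<open>m'\<close>, but
      each has its own order; \<open>M\<close> dominates these finitely many orders as well.\<close>
    define M where "M = Max (insert m' (\<mu> ` {..<J}))"
    have M: "m' \<le> M" "\<And>j. j < J \<Longrightarrow> \<mu> j \<le> M" by (auto simp: M_def)
    define K where "K = (\<Sum>j<J. a j * C j * p' m (e j))"
    have K: "K \<ge> 0" unfolding K_def using a C0 nn' by (intro sum_nonneg mult_nonneg_nonneg) (auto intro: less_imp_le)
    have SJ: "p' m (Sm J x) \<le> K * p M x" for x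
    proof -
      have "p' m (Sm J x) \<le> (\<Sum>j<J. p' m (t j x))" unfolding Sm_def by (rule seminorm_sum[OF p'])
      also have "\<dots> \<le> (\<Sum>j<J. (a j * C j * p' m (e j)) * p M x)"
      proof (rule sum_mono)
        fix j assume "j \<in> {..<J}"
        then have "norm (f j x) \<le> C j * p M x"
          by (intro order_trans[OF C mult_left_mono[OF mono[OF M(2)] C0]]) simp
        then have "a j * norm (f j x) * p' m (e j) \<le> a j * (C j * p M x) * p' m (e j)"
          using a[of j] nn' by (intro mult_right_mono mult_left_mono) (auto intro: less_imp_le)
        then show "p' m (t j x) \<le> (a j * C j * p' m (e j)) * p M x" by (simp add: pt ac_simps)
      qed
      finally show ?thesis by (simp add: K_def sum_distrib_right)
    qed
    have "p' m (R x) \<le> (K + 2) * p M x" for x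
    proof -
      have "p' m (R x) \<le> (K + 2) * p M x + p' m (Sm k x - R x)" if k: "k \<ge> J" for k
      proof -
        have "p' m (R x) \<le> p' m (Sm k x) + p' m (Sm k x - R x)"
          using seminorm_diff[OF p', of m "Sm k x" "Sm k x - R x"] by simp
        also have "p' m (Sm k x) \<le> p' m (Sm J x) + p' m (Sm k x - Sm J x)"
          using seminorm_add[OF p', of m "Sm J x" "Sm k x - Sm J x"] by simp
        also have "p' m (Sm k x - Sm J x) \<le> 2 * (1/2) ^ J * p m' x" by (rule gap[where J = J]) (use J k in auto)
        also have "\<dots> \<le> 2 * p M x"
        proof (rule mult_mono)
          show "2 * (1/2) ^ J \<le> (2::real)" by (simp add: power_le_one)
        qed (use mono[OF M(1)] nn in auto)
        finally show ?thesis using SJ[of x] by (simp add: algebra_simps)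
      qed
      moreover have "(\<lambda>k. (K + 2) * p M x + p' m (Sm k x - R x)) \<longlonglongrightarrow> (K + 2) * p M x + 0"
        by (intro tendsto_add tendsto_const R)
      ultimately have "p' m (R x) \<le> (K + 2) * p M x + 0" by (intro LIMSEQ_le_const) auto
      then show ?thesis by simp
    qed
    then show ?thesis using K by (intro exI[of _ "K + 2"] exI[of _ M]) auto
  qed
  have finite: "R x = (\<Sum>j<k. scale (of_real (a j) * f j x) (e j))" if z: "\<And>j. j \<ge> k \<Longrightarrow> f j x = 0" for x k
  proof -
    have "Sm i x = Sm k x" if "i \<ge> k" for i
    proof -
      have "Sm i x - Sm k x = (\<Sum>j\<in>{k..<i}. t j x)"
        unfolding Sm_def lessThan_atLeast0 by (rule sum_diff_nat_ivl) (use that in auto)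
      also have "\<dots> = 0" by (rule sum.neutral) (simp add: t_def z)
      finally show ?thesis by simp
    qed
    then have "p' m (Sm i x - Sm k x) = 0" if "i \<ge> k" for i m
      using that seminorm_zero[OF p'] by (metis diff_self)
    then have "\<forall>\<^sub>F i in sequentially. p' m (Sm i x - Sm k x) = 0" for m
      unfolding eventually_sequentially by blast
    then have "R x = Sm k x" by (rule uniq[OF SmU tendsto_eventually])
    then show ?thesis by (simp add: Sm_def t_def)
  qed
  show ?thesis by (rule that[of a R]) (fact a lin RU bound finite)+
qed

text \<open>A rank one correction for each \<open>k\<close> in \<open>A\<close>. The sum runs only
  over the indices that see \<open>x\<close>, because \<open>A\<close> may be infinite and a sum
  over an infinite set is 0 by convention.\<close>

definition perturbed :: "('b \<Rightarrow> 'b) \<Rightarrow> nat set \<Rightarrow> (nat \<Rightarrow> 'b \<Rightarrow> 'k) \<Rightarrow> (nat \<Rightarrow> 'b) \<Rightarrow> 'b \<Rightarrow> 'b" where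
  "perturbed T A \<phi> v x = T x + (\<Sum>k | k \<in> A \<and> \<phi> k x \<noteq> 0. scale (\<phi> k x) (v k))"

lemma perturbed_eq:
  assumes "finite B" "B \<subseteq> A" "\<And>k. k \<in> A \<Longrightarrow> k \<notin> B \<Longrightarrow> \<phi> k x = 0"
  shows "perturbed T A \<phi> v x = T x + (\<Sum>k\<in>B. scale (\<phi> k x) (v k))"
proof -
  have "(\<Sum>k | k \<in> A \<and> \<phi> k x \<noteq> 0. scale (\<phi> k x) (v k)) = (\<Sum>k\<in>B. scale (\<phi> k x) (v k))"
    by (rule sum.mono_neutral_left) (use assms in auto)
  then show ?thesis by (simp add: perturbed_def)
qed

lemma linear_perturbed:
  assumes T: "Vector_Spaces.linear scale scale T" and \<phi>: "\<And>k. functional (\<phi> k)"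
    and fin: "\<And>x. finite {k \<in> A. \<phi> k x \<noteq> 0}"
  shows "Vector_Spaces.linear scale scale (perturbed T A \<phi> v)"
  unfolding linear_to_iff[OF vector_space_axioms]
proof (intro conjI allI)
  interpret T: Vector_Spaces.linear scale scale T by (rule T)
  fix x y
  let ?B = "{k \<in> A. \<phi> k x \<noteq> 0} \<union> {k \<in> A. \<phi> k y \<noteq> 0}"
  have B: "finite ?B" "?B \<subseteq> A" using fin by auto
  have "perturbed T A \<phi> v z = T z + (\<Sum>k\<in>?B. scale (\<phi> k z) (v k))" if "z \<in> {x, y, x + y}" for z
    by (rule perturbed_eq[OF B]) (use that in \<open>auto simp: functional_add[OF \<phi>]\<close>)
  then show "perturbed T A \<phi> v (x + y) = perturbed T A \<phi> v x + perturbed T A \<phi> v y"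
    by (simp add: T.add functional_add[OF \<phi>] scale_left_distrib sum.distrib)
next
  interpret T: Vector_Spaces.linear scale scale T by (rule T)
  fix c x
  let ?B = "{k \<in> A. \<phi> k x \<noteq> 0}"
  have B: "finite ?B" "?B \<subseteq> A" using fin by auto
  have "perturbed T A \<phi> v z = T z + (\<Sum>k\<in>?B. scale (\<phi> k z) (v k))" if "z \<in> {x, scale c x}" for z
    by (rule perturbed_eq[OF B]) (use that in \<open>auto simp: functional_scale[OF \<phi>]\<close>)
  then show "perturbed T A \<phi> v (scale c x) = scale c (perturbed T A \<phi> v x)"
    by (simp add: T.scale functional_scale[OF \<phi>] scale_right_distrib scale_sum_right)
qed

text \<open>
  The orbit up to time \<open>k \<in> A\<close> depends only on the \<open>v l\<close> with \<open>l < k\<close> and has a non-zero coefficient at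
  \<open>w k\<close>; hence \<open>v k\<close> can be chosen so that the next point of the orbit is the prescribed one.
\<close>

theorem exists_prescribed_orbit:
  fixes w :: "nat \<Rightarrow> 'b" and \<phi> :: "nat \<Rightarrow> 'b \<Rightarrow> 'k" and \<alpha> \<epsilon> :: "nat \<Rightarrow> 'k"
  assumes T: "Vector_Spaces.linear scale scale T" and \<phi>: "\<And>k. functional (\<phi> k)"
    and fin: "\<And>x. finite {k \<in> A. \<phi> k x \<noteq> 0}"
    and bi: "\<And>j k. \<phi> j (w k) = (if j = k then 1 else 0)"
    and TA: "\<And>k. k \<in> A \<Longrightarrow> T (w k) = 0"
    and TnA: "\<And>k. k \<notin> A \<Longrightarrow> T (w k) = scale (\<alpha> k) (w (Suc k))" "\<And>k. k \<notin> A \<Longrightarrow> \<alpha> k \<noteq> 0"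
    and y: "\<And>k. y k \<in> span (w ` {..k})" and \<epsilon>: "\<And>k. \<epsilon> k \<noteq> 0"
  obtains v where "\<And>k. v k \<in> span (range w)"
    "\<And>k. k \<in> A \<Longrightarrow> (perturbed T A \<phi> v ^^ Suc k) (w 0) = y k + scale (\<epsilon> k) (w (Suc k))"
proof -
  let ?Op = "perturbed T A \<phi>"
  note lin = linear_perturbed[OF T \<phi> fin]
  note opadd = lin[unfolded linear_to_iff[OF vector_space_axioms], THEN conjunct1, rule_format]
    and opscale = lin[unfolded linear_to_iff[OF vector_space_axioms], THEN conjunct2, rule_format]
  \<comment> \<open>The equation for the next orbit point solved for \<open>v k\<close>: the defect
    of the image under the truncated operator, divided by the coefficient of the current point at
    \<open>w k\<close>.\<close>
  define H where "H u k = scale (inverse (\<phi> k ((?Op u ^^ k) (w 0))))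
    (y k + scale (\<epsilon> k) (w (Suc k)) - ?Op u ((?Op u ^^ k) (w 0)))" for u k
  \<comment> \<open>Truncation makes the recursion well founded. Its value 0 at \<open>k\<close>
    means that the truncated operator computes the next point without the contribution of
    \<open>v k\<close>.\<close>
  define cut where "cut v k = (\<lambda>l. if l < k then v l else 0)" for v :: "nat \<Rightarrow> 'b" and k :: nat
  have "\<exists>v. \<forall>k. v k = H (cut v k) k"
  proof (rule dependent_wellorder_choice)
    fix r :: 'b and f g :: "nat \<Rightarrow> 'b" and k :: nat assume "\<And>l. l < k \<Longrightarrow> f l = g l"
    then have "cut f k = cut g k" by (auto simp: cut_def)
    then show "(r = H (cut f k) k) = (r = H (cut g k) k)" by simp
  qed blast
  then obtain v where v: "\<And>k. v k = H (cut v k) k" by blast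
  define x where "x k = (?Op v ^^ k) (w 0)" for k
  have xS: "x (Suc k) = ?Op v (x k)" for k by (simp add: x_def)
  define E where "E k = span (w ` {..<k})" for k
  have Esub: "subspace (E k)" for k by (simp add: E_def)
  have Emono: "E k \<subseteq> E l" if "k \<le> l" for k l
    unfolding E_def by (rule span_mono) (use that in auto)
  have wE: "w k \<in> E l" if "k < l" for k l unfolding E_def by (rule span_base) (use that in auto)
  have \<phi>E: "\<phi> j z = 0" if "z \<in> E k" "k \<le> j" for j k z
  proof -
    have sub: "subspace {z. \<phi> j z = 0}"
      by (auto simp: subspace_def functional_add[OF \<phi>] functional_scale[OF \<phi>] functional_zero[OF \<phi>])
    have "E k \<subseteq> {z. \<phi> j z = 0}"
      unfolding E_def by (rule span_minimal[OF _ sub]) (use that(2) in \<open>auto simp: bi\<close>)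
    then show ?thesis using that(1) by blast
  qed
  have split: "z - scale (\<phi> k z) (w k) \<in> E k" if "z \<in> E (Suc k)" for z k
  proof -
    have "\<exists>c. z - scale c (w k) \<in> E k"
      using that unfolding E_def lessThan_Suc image_insert span_breakdown_eq .
    then obtain c where c: "z - scale c (w k) \<in> E k" by blast
    then have "\<phi> k (z - scale c (w k)) = 0" by (rule \<phi>E) simp
    then have "c = \<phi> k z" by (simp add: functional_diff[OF \<phi>] functional_scale[OF \<phi>] bi)
    then show ?thesis using c by simp
  qed
  have Opw: "?Op u (w k) = (if k \<in> A then u k else scale (\<alpha> k) (w (Suc k)))" for u k
  proof (cases "k \<in> A")
    case True
    then have "?Op u (w k) = T (w k) + (\<Sum>j\<in>{k}. scale (\<phi> j (w k)) (u j))"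
      by (intro perturbed_eq) (auto simp: bi)
    then show ?thesis using True by (simp add: TA bi)
  next
    case False
    then have "?Op u (w k) = T (w k) + (\<Sum>j\<in>{}. scale (\<phi> j (w k)) (u j))"
      by (intro perturbed_eq) (auto simp: bi)
    then show ?thesis using False by (simp add: TnA)
  qed
  have OpE: "?Op u z \<in> E (Suc k)" if u: "\<And>l. l < k \<Longrightarrow> u l \<in> E (Suc (Suc l))" and z: "z \<in> E k" for u z k
  proof -
    have "?Op u (w l) \<in> E (Suc k)" if "l < k" for l
      using u[OF that] Emono[of "Suc (Suc l)" "Suc k"] that
      by (auto simp: Opw intro!: subspace_scale[OF Esub] wE)
    then have "span (?Op u ` (w ` {..<k})) \<subseteq> E (Suc k)" by (intro span_minimal[OF _ Esub]) auto
    then show ?thesis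
      using z module_hom.span_image[OF Vector_Spaces.linear.axioms(3)[OF lin]] unfolding E_def by blast
  qed
  have agree: "?Op (cut v k) z = ?Op v z" if "z \<in> E k" for z k
  proof -
    have "k' < k" if "\<phi> k' z \<noteq> 0" for k' using \<phi>E[OF \<open>z \<in> E k\<close>, of k'] that by (meson not_le)
    then show ?thesis unfolding perturbed_def by (intro arg_cong2[where f = "(+)"] sum.cong) (auto simp: cut_def)
  qed
  \<comment> \<open>The non-zero coefficient at the leading vector propagates: off \<open>A\<close>
    it is multiplied by \<open>\<alpha> k\<close>, and on \<open>A\<close> the new one is
    \<open>\<epsilon> k\<close>. This is why a target is hit only up to a multiple of
    \<open>w (Suc k)\<close>.\<close>
  have main: "(\<forall>l\<le>k. x l \<in> E (Suc l)) \<and> \<phi> k (x k) \<noteq> 0 \<and>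
    (\<forall>l<k. v l \<in> E (Suc (Suc l)) \<and> (l \<in> A \<longrightarrow> x (Suc l) = y l + scale (\<epsilon> l) (w (Suc l))))" for k
  proof (induction k)
    case 0
    then show ?case using wE[of 0 1] by (simp add: x_def bi)
  next
    case (Suc k)
    then have xE: "\<And>l. l \<le> k \<Longrightarrow> x l \<in> E (Suc l)" and nz: "\<phi> k (x k) \<noteq> 0"
      and vE: "\<And>l. l < k \<Longrightarrow> v l \<in> E (Suc (Suc l))" by auto
    let ?u = "cut v k"
    \<comment> \<open>Before time \<open>k\<close> the orbit stays in \<open>E k\<close>, where only
      the \<open>v l\<close> with \<open>l < k\<close> act, so truncation does not change
      it.\<close>
    have same: "(?Op ?u ^^ l) (w 0) = x l" if "l \<le> k" for l
      using that
    proof (induction l)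
      case (Suc l)
      then have "x l \<in> E k" using xE[of l] Emono[of "Suc l" k] by auto
      then show ?case using Suc agree by (simp add: xS)
    qed (simp add: x_def)
    define c z where "c = \<phi> k (x k)" and "z = x k - scale c (w k)"
    have xk: "x k = z + scale c (w k)" and zE: "z \<in> E k"
      using split[OF xE[OF order_refl]] by (auto simp: z_def c_def)
    have Opx: "?Op u (x k) = ?Op u z + scale c (?Op u (w k))" for u
      unfolding xk by (simp add: opadd opscale)
    have OpzE: "?Op v z \<in> E (Suc k)" by (rule OpE[OF vE zE])
    have Opuz: "?Op ?u z = ?Op v z" by (rule agree[OF zE])
    have vk: "scale c (v k) = y k + scale (\<epsilon> k) (w (Suc k)) - ?Op ?u (x k)"
      using v[of k] nz by (simp add: H_def same c_def)
    have yE: "y k \<in> E (Suc k)" using y[of k] by (simp add: E_def lessThan_Suc_atMost)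
    have up: "E (Suc k) \<subseteq> E (Suc (Suc k))" by (rule Emono) simp
    have OpuE: "?Op ?u (x k) \<in> E (Suc (Suc k))"
      unfolding Opx Opuz Opw using OpzE up
      by (auto simp: cut_def intro!: subspace_add[OF Esub] subspace_scale[OF Esub] wE subspace_0[OF Esub])
    have "scale c (v k) \<in> E (Suc (Suc k))"
      unfolding vk using yE up OpuE
      by (intro subspace_diff[OF Esub] subspace_add[OF Esub] subspace_scale[OF Esub] wE) auto
    then have "scale (inverse c) (scale c (v k)) \<in> E (Suc (Suc k))" by (rule subspace_scale[OF Esub])
    then have vkE: "v k \<in> E (Suc (Suc k))" using nz by (simp add: c_def)
    have inA: "x (Suc k) = y k + scale (\<epsilon> k) (w (Suc k))" if "k \<in> A"
    proof -
      have "x (Suc k) = ?Op v z + scale c (v k)" unfolding xS Opx using that by (simp add: Opw)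
      also have "?Op ?u (x k) = ?Op v z" unfolding Opx Opuz using that by (simp add: Opw cut_def)
      then have "?Op v z + scale c (v k) = y k + scale (\<epsilon> k) (w (Suc k))" unfolding vk by simp
      finally show ?thesis .
    qed
    have notA: "x (Suc k) = ?Op v z + scale (c * \<alpha> k) (w (Suc k))" if "k \<notin> A"
      unfolding xS Opx using that by (simp add: Opw)
    have "x (Suc k) \<in> E (Suc (Suc k)) \<and> \<phi> (Suc k) (x (Suc k)) \<noteq> 0"
    proof (cases "k \<in> A")
      case True
      then show ?thesis
        using \<phi>E[OF yE, of "Suc k"] \<epsilon> yE up
        by (auto simp: inA functional_add[OF \<phi>] functional_scale[OF \<phi>] bi
            intro!: subspace_add[OF Esub] subspace_scale[OF Esub] wE)
    next
      case False
      then show ?thesis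
        using \<phi>E[OF OpzE, of "Suc k"] TnA(2) nz OpzE up
        by (auto simp: notA c_def functional_add[OF \<phi>] functional_scale[OF \<phi>] bi
            intro!: subspace_add[OF Esub] subspace_scale[OF Esub] wE)
    qed
    then show ?case using Suc vkE inA by (auto simp: le_Suc_eq less_Suc_eq)
  qed
  have "v k \<in> span (range w)" for k
  proof -
    have "v k \<in> E (Suc (Suc k))" using main[of "Suc k"] by simp
    also have "\<dots> \<subseteq> span (range w)" unfolding E_def by (rule span_mono) auto
    finally show ?thesis .
  qed
  moreover have "(?Op v ^^ Suc k) (w 0) = y k + scale (\<epsilon> k) (w (Suc k))" if "k \<in> A" for k
    using main[of "Suc k"] that by (simp add: x_def)
  ultimately show ?thesis by (rule that)
qed

end

text \<open>The Cantor enumeration runs along antidiagonals; inside one, its successor step is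
  exactly the index change made by the unperturbed operator.\<close>

lemma Suc_prod_encode: "Suc (prod_encode (m, Suc n)) = prod_encode (Suc m, n)"
  by (simp add: prod_encode_def)

text \<open>The end of an antidiagonal is followed by the start of the next one, whose first entry
  is 0; therefore all errors fall into block \<open>0\<close>.\<close>

lemma Suc_prod_encode_0: "Suc (prod_encode (m, 0)) = prod_encode (0, Suc m)"
  by (simp add: prod_encode_def)

lemma (in vector_space) span_range_initial:
  fixes w :: "nat \<Rightarrow> 'b"
  assumes "z \<in> span (range w)"
  shows "\<exists>K. z \<in> span (w ` {..K})"
  using assms
proof (induction rule: span_induct_alt)
  case base
  then show ?case using span_zero by blast
next
  case (step c x y)
  then obtain i K where i: "x = w i" and K: "y \<in> span (w ` {..K})" by blast
  have "span (w ` {..K}) \<subseteq> span (w ` {..max i K})" by (intro span_mono image_mono) auto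
  then have "c *s x + y \<in> span (w ` {..max i K})"
    using K unfolding i by (intro span_add span_scale) (auto intro: span_base)
  then show ?case by blast
qed

section \<open>Finite blocks of summands and their seminorms\<close>

context frechet_sequence
begin

definition block :: "nat set \<Rightarrow> (nat \<Rightarrow>\<^sub>0 'a) set" where
  "block A = {x \<in> W. \<forall>i. i \<notin> A \<longrightarrow> lookup x i = 0}"

definition block_seminorm :: "nat set \<Rightarrow> nat \<Rightarrow> (nat \<Rightarrow>\<^sub>0 'a) \<Rightarrow> real" where
  "block_seminorm A m x = (\<Sum>i\<in>A. P i m (lookup x i))"

lemma seminorm_block: "seminorm d (block_seminorm A m)"
  unfolding block_seminorm_def[abs_def]
  by (intro sum.seminorm_sum_fun sum.seminorm_compose[OF seminorm_P linear_lookup])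

lemma block_seminorm_mono: "m \<le> m' \<Longrightarrow> block_seminorm A m x \<le> block_seminorm A m' x"
  unfolding block_seminorm_def by (intro sum_mono P_mono)

lemma P_le_block_seminorm: "finite A \<Longrightarrow> i \<in> A \<Longrightarrow> P i m (lookup x i) \<le> block_seminorm A m x"
  unfolding block_seminorm_def by (rule member_le_sum) (auto simp: seminorm_nonneg[OF seminorm_P])

lemma block_seminorm_single:
  "finite A \<Longrightarrow> block_seminorm A m (single i z) = (if i \<in> A then P i m z else 0)"
proof -
  assume A: "finite A"
  have "block_seminorm A m (single i z) = (\<Sum>j\<in>A. if j = i then P i m z else 0)"
    unfolding block_seminorm_def
    by (rule sum.cong) (auto simp: lookup_single when_def seminorm_zero[OF seminorm_P])
  then show ?thesis using A by simp
qed

lemma block_seminorm_disjoint: "x \<in> block A \<Longrightarrow> A \<inter> B = {} \<Longrightarrow> block_seminorm B m x = 0"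
  unfolding block_seminorm_def block_def
  by (rule sum.neutral) (auto simp: seminorm_zero[OF seminorm_P])

lemma block_in_W: "x \<in> block A \<Longrightarrow> x \<in> W"
  by (simp add: block_def)

lemma subspace_block: "sum.subspace (block A)"
  using subspace_W unfolding block_def sum.subspace_def by (auto simp: lookup_add lookup_d)

lemma single_in_block: "i \<in> A \<Longrightarrow> z \<in> V i \<Longrightarrow> single i z \<in> block A"
  by (auto simp: block_def single_in_W lookup_single when_def)

lemma block_lookup: "x \<in> block A \<Longrightarrow> lookup x i \<in> V i"
  by (simp add: block_def direct_sum_def)

lemma block_sum_single: "finite A \<Longrightarrow> x \<in> block A \<Longrightarrow> x = (\<Sum>i\<in>A. single i (lookup x i))"
  by (rule sum_single_lookup) (auto simp: block_def in_keys_iff)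

lemma block_separates:
  assumes "finite A" "x \<in> block A" "\<And>m. block_seminorm A m x = 0"
  shows "x = 0"
proof (rule poly_mapping_eqI)
  fix i
  show "lookup x i = lookup 0 i"
  proof (cases "i \<in> A")
    case True
    have "P i m (lookup x i) = 0" for m
      using P_le_block_seminorm[OF assms(1) True, of m x] assms(3)[of m]
        seminorm_nonneg[OF seminorm_P, of i m "lookup x i"] by simp
    then have "lookup x i = 0" by (rule P_separates[OF block_lookup[OF assms(2)]])
    then show ?thesis by simp
  qed (use assms(2) in \<open>simp add: block_def\<close>)
qed

lemma block_complete:
  assumes A: "finite A" and y: "\<And>k. y k \<in> block A"
    and cau: "\<And>m \<epsilon>. \<epsilon> > 0 \<Longrightarrow> \<exists>N. \<forall>i\<ge>N. \<forall>j\<ge>N. block_seminorm A m (y i - y j) < \<epsilon>"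
  shows "\<exists>l\<in>block A. \<forall>m. (\<lambda>k. block_seminorm A m (y k - l)) \<longlonglongrightarrow> 0"
proof -
  have "\<exists>l\<in>V i. \<forall>m. (\<lambda>k. P i m (lookup (y k) i - l)) \<longlonglongrightarrow> 0" if i: "i \<in> A" for i
  proof (rule P_complete)
    show "lookup (y k) i \<in> V i" for k by (rule block_lookup[OF y])
    fix m and \<epsilon> :: real assume "\<epsilon> > 0"
    then obtain N where N: "\<And>a b. a \<ge> N \<Longrightarrow> b \<ge> N \<Longrightarrow> block_seminorm A m (y a - y b) < \<epsilon>"
      using cau by blast
    have "P i m (lookup (y a) i - lookup (y b) i) < \<epsilon>" if "a \<ge> N" "b \<ge> N" for a b
      using P_le_block_seminorm[OF A i, of m "y a - y b"] N[OF that] by (simp add: lookup_minus)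
    then show "\<exists>N. \<forall>a\<ge>N. \<forall>b\<ge>N. P i m (lookup (y a) i - lookup (y b) i) < \<epsilon>" by blast
  qed
  then obtain l where l: "\<And>i. i \<in> A \<Longrightarrow> l i \<in> V i"
    and lim: "\<And>i m. i \<in> A \<Longrightarrow> (\<lambda>k. P i m (lookup (y k) i - l i)) \<longlonglongrightarrow> 0" by metis
  define x where "x = (\<Sum>i\<in>A. single i (l i))"
  have lx: "lookup x i = (if i \<in> A then l i else 0)" for i
    using A by (simp add: x_def lookup_sum lookup_single when_def)
  have "x \<in> block A"
    unfolding x_def by (intro sum.subspace_sum[OF subspace_block] single_in_block l)
  moreover have "(\<lambda>k. block_seminorm A m (y k - x)) \<longlonglongrightarrow> 0" for m
  proof -
    have "(\<lambda>k. \<Sum>i\<in>A. P i m (lookup (y k) i - l i)) \<longlonglongrightarrow> (\<Sum>i\<in>A. 0)"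
      by (intro tendsto_sum lim)
    moreover have "block_seminorm A m (y k - x) = (\<Sum>i\<in>A. P i m (lookup (y k) i - l i))" for k
      unfolding block_seminorm_def by (rule sum.cong) (simp_all add: lookup_minus lx)
    ultimately show ?thesis by simp
  qed
  ultimately show ?thesis by blast
qed

lemma block_infinite_dimensional:
  assumes i: "i \<in> A" "\<not> finite_dimensional_on s (V i)"
  shows "\<not> finite_dimensional_on d (block A)"
proof
  assume "finite_dimensional_on d (block A)"
  then obtain B where B: "finite B" "B \<subseteq> block A" "sum.span B = block A"
    by (auto simp: finite_dimensional_on_def)
  have "span ((\<lambda>x. lookup x i) ` B) = (\<lambda>x. lookup x i) ` block A"
    using module_hom.span_image[OF Vector_Spaces.linear.axioms(3)[OF linear_lookup]] B(3) by metis
  also have "\<dots> = V i"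
  proof
    show "V i \<subseteq> (\<lambda>x. lookup x i) ` block A"
    proof
      fix z assume "z \<in> V i"
      then show "z \<in> (\<lambda>x. lookup x i) ` block A"
        using single_in_block[OF i(1)] by (intro image_eqI[of _ _ "single i z"]) auto
    qed
  qed (use block_lookup in auto)
  finally have "finite_dimensional_on s (V i)"
    unfolding finite_dimensional_on_def using B(1,2) block_lookup
    by (intro exI[of _ "(\<lambda>x. lookup x i) ` B"]) auto
  then show False using i(2) by simp
qed

lemma block_dense:
  assumes A: "finite A" and sep: "\<And>n. separable_space (X n)"
  obtains D where "countable D" "D \<subseteq> block A"
    "\<And>x m \<epsilon>. x \<in> block A \<Longrightarrow> \<epsilon> > 0 \<Longrightarrow> \<exists>y\<in>D. block_seminorm A m (x - y) < \<epsilon>"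
proof -
  have "\<exists>D. countable D \<and> D \<subseteq> V i \<and> (\<forall>x\<in>V i. \<forall>m. \<forall>\<epsilon>>0. \<exists>y\<in>D. P i m (x - y) < \<epsilon>)" for i
    using separable_seminorm_dense[OF lc sep, of i] P[of i] by metis
  then obtain D where D: "\<And>i. countable (D i)" "\<And>i. D i \<subseteq> V i"
    "\<And>i x m \<epsilon>. x \<in> V i \<Longrightarrow> \<epsilon> > 0 \<Longrightarrow> \<exists>y\<in>D i. P i m (x - y) < \<epsilon>" by metis
  let ?D = "(\<lambda>y. \<Sum>i\<in>A. single i (y i)) ` Pi\<^sub>E A D"
  show ?thesis
  proof (rule that[of ?D])
    show "countable ?D" using A D(1) by (intro countable_image countable_PiE)
    show "?D \<subseteq> block A"
      using D(2) by (auto intro!: sum.subspace_sum[OF subspace_block] single_in_block simp: PiE_iff)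
    fix x m and \<epsilon> :: real assume x: "x \<in> block A" and \<epsilon>: "\<epsilon> > 0"
    define \<delta> where "\<delta> = \<epsilon> / (real (card A) + 1)"
    have \<delta>: "\<delta> > 0" using \<epsilon> by (simp add: \<delta>_def)
    have "\<exists>y\<in>D i. P i m (lookup x i - y) < \<delta>" for i by (rule D(3)[OF block_lookup[OF x] \<delta>])
    then obtain y where y: "\<And>i. y i \<in> D i" "\<And>i. P i m (lookup x i - y i) < \<delta>" by metis
    let ?y = "\<Sum>i\<in>A. single i (restrict y A i)"
    have "block_seminorm A m (x - ?y) \<le> (\<Sum>i\<in>A. \<delta>)"
      unfolding block_seminorm_def
      by (rule sum_mono) (use y(2) A in \<open>simp add: lookup_minus lookup_sum lookup_single when_def less_imp_le\<close>)
    also have "\<dots> < \<epsilon>" using \<epsilon> by (simp add: \<delta>_def field_simps)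
    finally show "\<exists>y\<in>?D. block_seminorm A m (x - y) < \<epsilon>"
      using y(1) by (intro bexI[of _ ?y]) (auto intro!: image_eqI[of _ _ "restrict y A"])
  qed
qed

text \<open>Each of the finitely many summands has its own dominating index, and the maximum of
  these serves the block.\<close>

lemma dominated_on_block:
  assumes A: "finite A" and q: "q \<in> continuous_seminorms d S"
  shows "\<exists>m. \<forall>x\<in>block A. q x \<le> block_seminorm A m x"
proof -
  have "\<exists>m. \<forall>z\<in>V i. q (single i z) \<le> P i m z" for i
    using q by (intro P_dominates) (simp add: continuous_seminorms_S)
  then obtain m where m: "\<And>i z. z \<in> V i \<Longrightarrow> q (single i z) \<le> P i (m i) z" by metis
  define M where "M = Max (insert 0 (m ` A))"
  have M: "m i \<le> M" if "i \<in> A" for i using A that by (auto simp: M_def)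
  have "q x \<le> block_seminorm A M x" if x: "x \<in> block A" for x
  proof -
    have "q x = q (\<Sum>i\<in>A. single i (lookup x i))" using block_sum_single[OF A x] by simp
    also have "\<dots> \<le> (\<Sum>i\<in>A. q (single i (lookup x i)))"
      by (rule sum.seminorm_sum[OF sum.continuous_seminormsD[OF q]])
    also have "\<dots> \<le> (\<Sum>i\<in>A. P i M (lookup x i))"
      by (intro sum_mono order_trans[OF m[OF block_lookup[OF x]] P_mono] M)
    finally show ?thesis by (simp add: block_seminorm_def)
  qed
  then show ?thesis by blast
qed

text \<open>
  For infinite-dimensional \<open>X i\<close>, being thick means not being isomorphic to the space of all scalar
  sequences. In a biorthogonal system of a block the orders \<open>\<mu>\<close> are bounded if the block has a thick
  member and tend to infinity otherwise. A continuous operator from a thin block to a normed space has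
  finite rank, so thin blocks must be followed by thin blocks.
\<close>

definition thick :: "nat \<Rightarrow> bool" where
  "thick i \<longleftrightarrow> (\<exists>m. \<forall>F. finite F \<longrightarrow> \<not> V i \<subseteq> {x. \<exists>y\<in>span F. P i m (x - y) = 0})"

lemma thick_imp_infinite_dimensional: "thick i \<Longrightarrow> \<not> finite_dimensional_on s (V i)"
proof
  assume "thick i" "finite_dimensional_on s (V i)"
  then obtain m B where m: "\<And>F. finite F \<Longrightarrow> \<not> V i \<subseteq> {x. \<exists>y\<in>span F. P i m (x - y) = 0}"
    and B: "finite B" "span B = V i" by (auto simp: thick_def finite_dimensional_on_def)
  have "\<exists>y\<in>span B. P i m (x - y) = 0" if "x \<in> V i" for x
    using that B(2) seminorm_zero[OF seminorm_P] by (intro bexI[of _ x]) auto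
  then show False using m[OF B(1)] by blast
qed

text \<open>If an order exceeded \<open>m\<close>, the remainders at that stage would be null for
  the \<open>m\<close>-th seminorm, so the \<open>i\<close>-th coordinates of finitely many
  \<open>e l\<close> would span \<open>V i\<close> up to null vectors, against thickness.\<close>

lemma thick_order_bounded:
  assumes A: "finite A" and i: "i \<in> A" "thick i"
    and rem: "\<And>k m x. x \<in> block A \<Longrightarrow> m < \<mu> k \<Longrightarrow> block_seminorm A m (sum.remainder e f k x) = 0"
  shows "\<exists>m. \<forall>k. \<mu> k \<le> m"
proof -
  obtain m where m: "\<And>F. finite F \<Longrightarrow> \<not> V i \<subseteq> {x. \<exists>y\<in>span F. P i m (x - y) = 0}"
    using i(2) by (auto simp: thick_def)
  have "\<mu> k \<le> m" for k
  proof (rule ccontr)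
    assume "\<not> \<mu> k \<le> m"
    then have k: "m < \<mu> k" by simp
    let ?F = "(\<lambda>l. lookup (e l) i) ` {..<k}"
    have "\<exists>y\<in>span ?F. P i m (z - y) = 0" if z: "z \<in> V i" for z
    proof -
      let ?y = "\<Sum>l<k. s (f l (single i z)) (lookup (e l) i)"
      have "P i m (lookup (sum.remainder e f k (single i z)) i) \<le> 0"
        using P_le_block_seminorm[OF A i(1)] rem[OF single_in_block[OF i(1) z] k] by metis
      moreover have "lookup (sum.remainder e f k (single i z)) i = z - ?y"
        by (simp add: sum.remainder_def lookup_minus lookup_sum lookup_d)
      ultimately have "P i m (z - ?y) = 0" using seminorm_nonneg[OF seminorm_P, of i m "z - ?y"] by simp
      moreover have "?y \<in> span ?F" by (intro span_sum span_scale span_base) auto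
      ultimately show ?thesis by blast
    qed
    then show False using m[of ?F] by blast
  qed
  then show ?thesis by blast
qed

text \<open>If all orders were at most \<open>m\<close>, every \<open>f k\<close> would factor
  through the block modulo the null vectors of its \<open>m\<close>-th seminorm. For a block without
  thick members this quotient is finite-dimensional, too small for an infinite biorthogonal
  system.\<close>

lemma not_thick_order_unbounded:
  fixes e :: "nat \<Rightarrow> (nat \<Rightarrow>\<^sub>0 'a)" and f :: "nat \<Rightarrow> (nat \<Rightarrow>\<^sub>0 'a) \<Rightarrow> 'k"
  assumes A: "finite A" and thin: "\<And>i. i \<in> A \<Longrightarrow> \<not> thick i"
    and e: "\<And>k. e k \<in> block A" and f: "\<And>k. sum.functional (f k)"
    and bd: "\<And>k. \<exists>C. \<forall>x. norm (f k x) \<le> C * block_seminorm A (\<mu> k) x"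
    and bi: "\<And>j k. f j (e k) = (if j = k then 1 else 0)"
  shows "\<exists>k. m < \<mu> k"
proof (rule ccontr)
  assume "\<not> (\<exists>k. m < \<mu> k)"
  then have \<mu>: "\<mu> k \<le> m" for k by (simp add: not_less)
  have "\<forall>i\<in>A. \<exists>F. finite F \<and> V i \<subseteq> {x. \<exists>y\<in>span F. P i m (x - y) = 0}"
    using thin unfolding thick_def by blast
  from bchoice[OF this] obtain F where F: "\<And>i. i \<in> A \<Longrightarrow> finite (F i)"
    "\<And>i x. i \<in> A \<Longrightarrow> x \<in> V i \<Longrightarrow> \<exists>y\<in>span (F i). P i m (x - y) = 0" by blast
  define G where "G = (\<Union>i\<in>A. single i ` F i)"
  have G: "finite G" using A F(1) by (simp add: G_def)
  have "\<exists>u\<in>sum.span G. block_seminorm A m (x - u) = 0" if x: "x \<in> block A" for x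
  proof -
    have "\<forall>i\<in>A. \<exists>y. y \<in> span (F i) \<and> P i m (lookup x i - y) = 0" using F(2) block_lookup[OF x] by blast
    then obtain y where y: "\<And>i. i \<in> A \<Longrightarrow> y i \<in> span (F i)" "\<And>i. i \<in> A \<Longrightarrow> P i m (lookup x i - y i) = 0" by metis
    let ?u = "\<Sum>i\<in>A. single i (y i)"
    have "?u \<in> sum.span G"
    proof (rule sum.span_sum)
      fix i assume i: "i \<in> A"
      have "single i (y i) \<in> single i ` span (F i)" using y(1)[OF i] by blast
      also have "\<dots> = sum.span (single i ` F i)"
        using module_hom.span_image[OF Vector_Spaces.linear.axioms(3)[OF linear_single]] by metis
      also have "\<dots> \<subseteq> sum.span G" by (rule sum.span_mono) (use i in \<open>auto simp: G_def\<close>)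
      finally show "single i (y i) \<in> sum.span G" .
    qed
    moreover have "block_seminorm A m (x - ?u) = 0"
      unfolding block_seminorm_def using A y(2)
      by (intro sum.neutral) (simp add: lookup_minus lookup_sum lookup_single when_def)
    ultimately show ?thesis by blast
  qed
  \<comment> \<open>Each \<open>e k\<close> is replaced by a representative in the
    finite-dimensional span of \<open>G\<close>; the functionals do not notice, so the
    representatives are still independent.\<close>
  then have "\<forall>k. \<exists>u. u \<in> sum.span G \<and> block_seminorm A m (e k - u) = 0" using e by blast
  from choice[OF this] obtain u
    where u: "\<And>k. u k \<in> sum.span G" "\<And>k. block_seminorm A m (e k - u k) = 0" by blast
  have fu: "f j (u k) = (if j = k then 1 else 0)" for j k
  proof -
    obtain C where "norm (f j (e k - u k)) \<le> C * block_seminorm A (\<mu> j) (e k - u k)" using bd by blast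
    moreover have "block_seminorm A (\<mu> j) (e k - u k) = 0"
      using block_seminorm_mono[OF \<mu>[of j], where A = A and x = "e k - u k"] u(2)[of k]
        sum.seminorm_nonneg[OF seminorm_block[of A "\<mu> j"], of "e k - u k"] by simp
    ultimately have "f j (e k - u k) = 0" by simp
    then show ?thesis using bi[of j k] by (simp add: sum.functional_diff[OF f])
  qed
  have inj: "inj u"
    by (rule injI) (metis fu zero_neq_one)
  have "sum.independent (u ` {..<n})" for n
  proof (induction n)
    case (Suc n)
    have sub: "sum.subspace {x. f n x = 0}"
      by (auto simp: sum.subspace_def sum.functional_add[OF f] sum.functional_scale[OF f] sum.functional_zero[OF f])
    have "sum.span (u ` {..<n}) \<subseteq> {x. f n x = 0}"
      by (rule sum.span_minimal[OF _ sub]) (auto simp: fu)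
    then have "u n \<notin> sum.span (u ` {..<n})" using fu[of n n] by auto
    then show ?case using Suc by (simp add: lessThan_Suc sum.independent_insert)
  qed (simp add: sum.independent_empty)
  from sum.independent_span_bound[OF G this, of "Suc (card G)"]
  have "card (u ` {..<Suc (card G)}) \<le> card G" using u(1) by blast
  then show False using card_image[OF inj_on_subset[OF inj subset_UNIV], of "{..<Suc (card G)}"] by simp
qed

text \<open>\<open>\<beta>\<close> assigns to each summand its block. \<open>compat\<close> links
  consecutive blocks only, because the unperturbed operator maps block \<open>n\<close> into block
  \<open>Suc n\<close>.\<close>

lemma exists_hypercyclic_of_systems:
  fixes \<beta> :: "nat \<Rightarrow> nat" and e :: "nat \<Rightarrow> nat \<Rightarrow> (nat \<Rightarrow>\<^sub>0 'a)" and f :: "nat \<Rightarrow> nat \<Rightarrow> (nat \<Rightarrow>\<^sub>0 'a) \<Rightarrow> 'k"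
    and \<mu> :: "nat \<Rightarrow> nat \<Rightarrow> nat"
  defines "B \<equiv> \<lambda>n. \<beta> -` {n}"
  assumes fin: "\<And>n. finite (B n)"
    and e: "\<And>n j. e n j \<in> block (B n)" and f: "\<And>n j. sum.functional (f n j)"
    and bd: "\<And>n j. \<exists>C. \<forall>x. norm (f n j x) \<le> C * block_seminorm (B n) (\<mu> n j) x"
    and bi: "\<And>n j k. f n j (e n k) = (if j = k then 1 else 0)"
    and Z: "\<And>n. countable (Z n)" "\<And>n. Z n \<subseteq> sum.span (range (e n))"
    and Zdense: "\<And>n x m \<epsilon>. x \<in> block (B n) \<Longrightarrow> \<epsilon> > 0 \<Longrightarrow> \<exists>z\<in>Z n. block_seminorm (B n) m (x - z) < \<epsilon>"
    and compat: "\<And>n m. \<exists>J m'. \<forall>j\<ge>J. \<mu> n (Suc j) \<le> m' \<or> block_seminorm (B (Suc n)) m (e (Suc n) j) = 0"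
  shows "\<exists>L. hypercyclic_operator d S L"
proof -
  let ?p = "\<lambda>n. block_seminorm (B n)"
  \<comment> \<open>The shift to \<open>Suc j\<close> leaves \<open>f n 0\<close> out of the series,
    so that \<open>R\<close> kills \<open>e n 0\<close> and the perturbation alone determines its
    image.\<close>
  define Q where "Q n a R \<longleftrightarrow> (\<forall>j. a j > 0) \<and> Vector_Spaces.linear d d R \<and> (\<forall>x. R x \<in> block (B (Suc n))) \<and>
    (\<forall>m. \<exists>C m'. 0 \<le> C \<and> (\<forall>x. ?p (Suc n) m (R x) \<le> C * ?p n m' x)) \<and>
    (\<forall>x k. (\<forall>j\<ge>k. f n (Suc j) x = 0) \<longrightarrow> R x = (\<Sum>j<k. d (of_real (a j) * f n (Suc j) x) (e (Suc n) j)))"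
    for n and a :: "nat \<Rightarrow> real" and R
  have "\<exists>a R. Q n a R" for n
  proof (rule sum.exists_series_operator[where p = "?p n" and p' = "?p (Suc n)" and f = "\<lambda>j. f n (Suc j)"
        and \<mu> = "\<lambda>j. \<mu> n (Suc j)" and U = "block (B (Suc n))" and e = "e (Suc n)"])
    fix a R
    assume "\<And>j. a j > 0" "Vector_Spaces.linear d d R" "\<And>x. R x \<in> block (B (Suc n))"
      "\<And>m. \<exists>C m'. 0 \<le> C \<and> (\<forall>x. ?p (Suc n) m (R x) \<le> C * ?p n m' x)"
      "\<And>x k. (\<And>j. j \<ge> k \<Longrightarrow> f n (Suc j) x = 0) \<Longrightarrow> R x = (\<Sum>j<k. d (of_real (a j) * f n (Suc j) x) (e (Suc n) j))"
    then have "Q n a R" unfolding Q_def by blast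
    then show ?thesis by blast
  qed (fact seminorm_block block_seminorm_mono f bd subspace_block e compat
      | (rule block_separates[OF fin]; assumption) | (rule block_complete[OF fin]; assumption))+
  then obtain a R where Q: "\<And>n. Q n (a n) (R n)" by metis
  have a: "a n j > 0" and Rlin: "Vector_Spaces.linear d d (R n)" and Rin: "R n x \<in> block (B (Suc n))"
    and Rbd: "\<exists>C m'. 0 \<le> C \<and> (\<forall>x. ?p (Suc n) m (R n x) \<le> C * ?p n m' x)" for n j x m
    using Q[of n] unfolding Q_def by blast+
  have Rfin: "R n x = (\<Sum>j<k. d (of_real (a n j) * f n (Suc j) x) (e (Suc n) j))"
    if "\<And>j. j \<ge> k \<Longrightarrow> f n (Suc j) x = 0" for n x k
    using Q[of n] that unfolding Q_def by blast
  note Radd = Rlin[unfolded sum.linear_to_iff[OF sum.vector_space_axioms], THEN conjunct1, rule_format]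
    and Rscale = Rlin[unfolded sum.linear_to_iff[OF sum.vector_space_axioms], THEN conjunct2, rule_format]
    and R0 = module_hom.zero[OF Vector_Spaces.linear.axioms(3)[OF Rlin]]
    and Rsum = module_hom.sum[OF Vector_Spaces.linear.axioms(3)[OF Rlin]]
  define T where "T x = (\<Sum>i\<in>Poly_Mapping.keys x. R (\<beta> i) (single i (lookup x i)))" for x
  have Text: "T x = (\<Sum>i\<in>F. R (\<beta> i) (single i (lookup x i)))" if "finite F" "Poly_Mapping.keys x \<subseteq> F" for F x
    unfolding T_def by (rule sum.mono_neutral_left) (use that in \<open>auto simp: in_keys_iff R0\<close>)
  have "T (x + y) = T x + T y" for x y
  proof -
    let ?F = "Poly_Mapping.keys x \<union> Poly_Mapping.keys y"
    have "T z = (\<Sum>i\<in>?F. R (\<beta> i) (single i (lookup z i)))" if "z \<in> {x, y, x + y}" for z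
      using that Poly_Mapping.keys_add[of x y] by (intro Text) auto
    then show ?thesis by (simp add: lookup_add single_add Radd sum.distrib)
  qed
  moreover have "T (d c x) = d c (T x)" for c x
  proof -
    have "T (d c x) = (\<Sum>i\<in>Poly_Mapping.keys x. R (\<beta> i) (single i (lookup (d c x) i)))"
      by (intro Text) (auto simp: in_keys_iff lookup_d)
    also have "\<dots> = (\<Sum>i\<in>Poly_Mapping.keys x. d c (R (\<beta> i) (single i (lookup x i))))"
      using linear_single by (simp add: lookup_d linear_to_iff[OF sum.vector_space_axioms] Rscale)
    finally show ?thesis by (simp add: T_def sum.scale_sum_right)
  qed
  ultimately have Tlin: "Vector_Spaces.linear d d T"
    by (simp add: sum.linear_to_iff[OF sum.vector_space_axioms])
  have Tsingle: "T (single i z) = R (\<beta> i) (single i z)" for i z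
    using Text[of "{i}" "single i z"] by simp
  have TW: "T x \<in> W" for x
    unfolding T_def by (intro sum.subspace_sum[OF subspace_W] block_in_W[OF Rin])
  have Tblock: "T x = R n x" if x: "x \<in> block (B n)" for x n
  proof -
    have "T x = (\<Sum>i\<in>B n. R (\<beta> i) (single i (lookup x i)))"
      by (rule Text[OF fin]) (use x in \<open>auto simp: block_def in_keys_iff\<close>)
    also have "\<dots> = (\<Sum>i\<in>B n. R n (single i (lookup x i)))"
      by (rule sum.cong) (auto simp: B_def)
    also have "\<dots> = R n x"
      using block_sum_single[OF fin x] by (simp add: Rsum[symmetric])
    finally show ?thesis .
  qed
  have disj: "B n \<inter> B n' = {}" if "n \<noteq> n'" for n n' using that by (auto simp: B_def)
  have f0: "f n j x = 0" if "\<And>m. ?p n m x = 0" for n j x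
  proof -
    obtain C where "norm (f n j x) \<le> C * ?p n (\<mu> n j) x" using bd by blast
    then show ?thesis using that[of "\<mu> n j"] by simp
  qed
  have bi2: "f n j (e n' j') = (if (n, j) = (n', j') then 1 else 0)" for n j n' j'
    using bi[of n j j'] f0[of n "e n' j'" j] block_seminorm_disjoint[OF e disj] by (cases "n = n'") auto
  define w \<phi> where "w k = e (fst (prod_decode k)) (snd (prod_decode k))"
    and "\<phi> k = f (fst (prod_decode k)) (snd (prod_decode k))" for k
  have wenc: "w (prod_encode (n, j)) = e n j" and \<phi>enc: "\<phi> (prod_encode (n, j)) = f n j" for n j
    by (simp_all add: w_def \<phi>_def)
  define A where "A = range (\<lambda>n. prod_encode (n, 0))"
  have biw: "\<phi> j (w k) = (if j = k then 1 else 0)" for j k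
    unfolding \<phi>_def w_def bi2 by simp
  \<comment> \<open>An element meets only finitely many blocks, and \<open>f n 0\<close> vanishes on
    elements without support in block \<open>n\<close>.\<close>
  have finA: "finite {k \<in> A. \<phi> k x \<noteq> 0}" for x
  proof (rule finite_subset)
    show "{k \<in> A. \<phi> k x \<noteq> 0} \<subseteq> (\<lambda>n. prod_encode (n, 0)) ` \<beta> ` Poly_Mapping.keys x"
    proof (clarsimp simp: A_def \<phi>enc)
      fix n assume "f n 0 x \<noteq> 0"
      then obtain m where "?p n m x \<noteq> 0" using f0 by blast
      then obtain i where "i \<in> B n" "P i m (lookup x i) \<noteq> 0"
        unfolding block_seminorm_def by (meson sum.not_neutral_contains_not_neutral)
      then have "i \<in> Poly_Mapping.keys x" "\<beta> i = n"
        using seminorm_zero[OF seminorm_P] by (auto simp: B_def in_keys_iff)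
      then show "prod_encode (n, 0) \<in> (\<lambda>n. prod_encode (n, 0)) ` \<beta> ` Poly_Mapping.keys x" by blast
    qed
  qed simp
  \<comment> \<open>Off \<open>A\<close> the second entry is positive and its predecessor is the
    index of the coefficient in the series; on \<open>A\<close> the truncated subtraction yields a
    harmless default.\<close>
  define \<alpha> :: "nat \<Rightarrow> 'k" where "\<alpha> k = of_real (a (fst (prod_decode k)) (snd (prod_decode k) - 1))" for k
  have TA: "T (w k) = 0" if k: "k \<in> A" for k
  proof -
    obtain n where n: "k = prod_encode (n, 0)" using k by (auto simp: A_def)
    have "T (e n 0) = R n (e n 0)" by (rule Tblock[OF e])
    also have "\<dots> = 0" using Rfin[of 0 n "e n 0"] by (simp add: bi)
    finally show ?thesis by (simp add: n wenc)
  qed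
  have TnA: "T (w k) = d (\<alpha> k) (w (Suc k))" if k: "k \<notin> A" for k
  proof -
    obtain n j' where nj': "k = prod_encode (n, j')" by (metis prod_decode_inverse surj_pair)
    then have "j' \<noteq> 0" using k by (auto simp: A_def)
    then obtain j where j: "k = prod_encode (n, Suc j)" using nj' not0_implies_Suc by blast
    have "T (e n (Suc j)) = R n (e n (Suc j))" by (rule Tblock[OF e])
    also have "\<dots> = (\<Sum>l<Suc j. d (of_real (a n l) * f n (Suc l) (e n (Suc j))) (e (Suc n) l))"
      by (rule Rfin) (simp add: bi)
    also have "\<dots> = d (of_real (a n j)) (e (Suc n) j)" by (simp add: bi)
    finally show ?thesis by (simp add: j wenc Suc_prod_encode \<alpha>_def)
  qed
  have \<alpha>: "\<alpha> k \<noteq> 0" for k using a[of "fst (prod_decode k)" "snd (prod_decode k) - 1"] by (simp add: \<alpha>_def)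
  \<comment> \<open>Finite sums of elements of the \<open>Z n\<close> are dense because an element
    of the direct sum meets finitely many blocks; writing them as lists gives countability.\<close>
  define D where "D = sum_list ` lists (\<Union>n. Z n)"
  have "countable D" unfolding D_def using Z(1) by (intro countable_image countable_lists) auto
  have Zw: "z \<in> sum.span (range w)" if "z \<in> Z n" for z n
  proof -
    have "range (e n) \<subseteq> range w" using wenc by (metis image_subsetI rangeI)
    then show ?thesis using that Z(2) sum.span_mono by blast
  qed
  have Dspan: "y \<in> sum.span (range w)" if "y \<in> D" for y
  proof -
    have "sum_list zs \<in> sum.span (range w)" if "zs \<in> lists (\<Union>n. Z n)" for zs
      using that by induction (auto intro: sum.span_zero sum.span_add Zw)
    then show ?thesis using that by (auto simp: D_def)
  qed
  have Ddense: "\<exists>y\<in>D. q (x - y) < 1 / 2" if x: "x \<in> W" and q: "q \<in> continuous_seminorms d S" for x q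
  proof -
    define N where "N = \<beta> ` Poly_Mapping.keys x"
    have N: "finite N" by (simp add: N_def)
    define \<delta> where "\<delta> = 1 / (2 * (real (card N) + 1))"
    have \<delta>: "\<delta> > 0" by (simp add: \<delta>_def)
    have xn: "restrict_support (B n) x \<in> block (B n)" for n
      using restrict_support_in_W[OF x] by (simp add: block_def lookup_restrict_support)
    have "\<exists>z\<in>Z n. q (restrict_support (B n) x - z) < \<delta>" for n
    proof -
      obtain m where m: "\<And>x. x \<in> block (B n) \<Longrightarrow> q x \<le> ?p n m x" using dominated_on_block[OF fin q] by blast
      obtain z where z: "z \<in> Z n" "?p n m (restrict_support (B n) x - z) < \<delta>" using Zdense[OF xn \<delta>] by blast
      have "sum.span (range (e n)) \<subseteq> block (B n)" by (rule sum.span_minimal[OF _ subspace_block]) (use e in auto)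
      then have "restrict_support (B n) x - z \<in> block (B n)"
        using z(1) Z(2) by (intro sum.subspace_diff[OF subspace_block xn]) blast
      then show ?thesis using m z by (intro bexI[of _ z]) (auto intro: le_less_trans)
    qed
    then obtain z where z: "\<And>n. z n \<in> Z n" "\<And>n. q (restrict_support (B n) x - z n) < \<delta>" by metis
    have "x = (\<Sum>n\<in>N. restrict_support (B n) x)"
    proof (rule poly_mapping_eqI)
      fix i
      have "(\<Sum>n\<in>N. lookup (restrict_support (B n) x) i) = (\<Sum>n\<in>N. if n = \<beta> i then lookup x i else 0)"
        by (rule sum.cong) (auto simp: lookup_restrict_support B_def)
      also have "\<dots> = lookup x i" using N by (auto simp: N_def in_keys_iff)
      finally show "lookup x i = lookup (\<Sum>n\<in>N. restrict_support (B n) x) i" by (simp add: lookup_sum)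
    qed
    then have "q (x - (\<Sum>n\<in>N. z n)) = q (\<Sum>n\<in>N. restrict_support (B n) x - z n)" by (simp add: sum_subtractf)
    also have "\<dots> \<le> (\<Sum>n\<in>N. q (restrict_support (B n) x - z n))"
      by (rule sum.seminorm_sum[OF sum.continuous_seminormsD[OF q]])
    also have "\<dots> \<le> (\<Sum>n\<in>N. \<delta>)" by (intro sum_mono less_imp_le z)
    also have "\<dots> < 1 / 2" by (simp add: \<delta>_def field_simps)
    finally have "q (x - (\<Sum>n\<in>N. z n)) < 1 / 2" .
    moreover have "(\<Sum>n\<in>N. z n) \<in> D"
    proof -
      obtain xs where xs: "set xs = N" "distinct xs" using finite_distinct_list[OF N] by blast
      then have "(\<Sum>n\<in>N. z n) = sum_list (map z xs)" by (simp add: sum_list_distinct_conv_sum_set)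
      moreover have "map z xs \<in> lists (\<Union>n. Z n)" using z(1) unfolding in_lists_conv_set by fastforce
      ultimately show ?thesis by (simp add: D_def)
    qed
    ultimately show ?thesis by blast
  qed
  \<comment> \<open>For \<open>k = prod_encode (n, 0)\<close> the target is chosen by the first
    entry of the decoded \<open>n\<close>, so every element of \<open>D\<close> is aimed at for
    infinitely many \<open>n\<close>.\<close>
  define y0 where "y0 k = from_nat_into D (fst (prod_decode (fst (prod_decode k))))" for k
  \<comment> \<open>A target outside the span of the vectors up to \<open>w k\<close> is replaced by
    0; it comes up again when \<open>k\<close> is large enough.\<close>
  define y where "y k = (if y0 k \<in> sum.span (w ` {..k}) then y0 k else 0)" for k
  \<comment> \<open>Keeps \<open>\<eta> n\<close> times \<open>e 0 (Suc n)\<close> below (1/2)^n in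
    the \<open>n\<close>-th seminorm of block \<open>0\<close>, and hence in all weaker
    ones.\<close>
  define \<eta> where "\<eta> n = inverse (2 ^ n * (1 + ?p 0 n (e 0 (Suc n))))" for n
  have pe: "?p 0 n (e 0 (Suc n)) \<ge> 0" for n by (rule sum.seminorm_nonneg[OF seminorm_block])
  have \<eta>: "\<eta> n > 0" for n using pe[of n] by (simp add: \<eta>_def add_pos_nonneg)
  obtain v where vspan: "\<And>k. v k \<in> sum.span (range w)"
    and orbit: "\<And>k. k \<in> A \<Longrightarrow> (sum.perturbed T A \<phi> v ^^ Suc k) (w 0)
      = y k + d (of_real (\<eta> (fst (prod_decode k)))) (w (Suc k))"
  proof (rule sum.exists_prescribed_orbit[where T = T and \<phi> = \<phi> and A = A and w = w and \<alpha> = \<alpha> and y = y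
        and \<epsilon> = "\<lambda>k. of_real (\<eta> (fst (prod_decode k)))"])
    show "sum.functional (\<phi> k)" for k unfolding \<phi>_def by (rule f)
    show "y k \<in> sum.span (w ` {..k})" for k by (simp add: y_def sum.span_zero)
    show "of_real (\<eta> (fst (prod_decode k))) \<noteq> (0::'k)" for k using \<eta>[of "fst (prod_decode k)"] by simp
  qed (use Tlin finA biw TA TnA \<alpha> in blast)+
  let ?L = "sum.perturbed T A \<phi> v"
  have Llin: "Vector_Spaces.linear d d ?L"
    by (rule sum.linear_perturbed[OF Tlin _ finA]) (simp add: \<phi>_def f)
  have wW: "w k \<in> W" for k unfolding w_def by (rule block_in_W[OF e])
  have "sum.span (range w) \<subseteq> W" by (rule sum.span_minimal[OF _ subspace_W]) (use wW in auto)
  then have vW: "v k \<in> W" for k using vspan by blast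
  have LW: "?L x \<in> W" for x
    unfolding sum.perturbed_def
    by (intro sum.subspace_add[OF subspace_W] TW sum.subspace_sum[OF subspace_W] sum.subspace_scale[OF subspace_W] vW)
  have cont: "continuous_map S S ?L"
  proof (rule continuous_map_S[OF Llin LW])
    fix q i assume q: "q \<in> continuous_seminorms d S"
    note sq = sum.continuous_seminormsD[OF q]
    define n k where "n = \<beta> i" and "k = prod_encode (n, 0)"
    have i: "i \<in> B n" by (simp add: n_def B_def)
    \<comment> \<open>On a summand of block \<open>n\<close> only the perturbation attached to
      \<open>e n 0\<close> acts, so a single \<open>v k\<close> enters the estimate and its size
      does not matter.\<close>
    have Lsingle: "?L (single i z) = R n (single i z) + d (f n 0 (single i z)) (v k)" for z
    proof -
      have "?L (single i z) = T (single i z) + (\<Sum>k\<in>{k}. d (\<phi> k (single i z)) (v k))"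
      proof (rule sum.perturbed_eq)
        fix k' assume "k' \<in> A" "k' \<notin> {k}"
        then obtain n' where n': "k' = prod_encode (n', 0)" "n' \<noteq> n" by (auto simp: A_def k_def)
        have "i \<notin> B n'" using n'(2) by (simp add: n_def B_def)
        then have "f n' 0 (single i z) = 0" by (intro f0) (simp add: block_seminorm_single[OF fin])
        then show "\<phi> k' (single i z) = 0" by (simp add: n'(1) \<phi>enc)
      qed (auto simp: A_def k_def)
      then show ?thesis by (simp add: Tsingle k_def \<phi>enc n_def)
    qed
    obtain m where m: "\<And>x. x \<in> block (B (Suc n)) \<Longrightarrow> q x \<le> ?p (Suc n) m x" using dominated_on_block[OF fin q] by blast
    obtain C m' where C: "0 \<le> C" "\<And>x. ?p (Suc n) m (R n x) \<le> C * ?p n m' x" using Rbd by blast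
    obtain C' where C': "\<And>x. norm (f n 0 x) \<le> C' * ?p n (\<mu> n 0) x" using bd by blast
    let ?K = "\<bar>C'\<bar> * q (v k)"
    have K: "?K \<ge> 0" using sum.seminorm_nonneg[OF sq] by simp
    have le: "q (?L (single i z)) \<le> C * P i m' z + ?K * P i (\<mu> n 0) z" for z
    proof -
      have "q (?L (single i z)) \<le> q (R n (single i z)) + norm (f n 0 (single i z)) * q (v k)"
        unfolding Lsingle using sum.seminorm_add[OF sq, of "R n (single i z)" "d (f n 0 (single i z)) (v k)"]
        by (simp add: sum.seminorm_scale[OF sq])
      also have "q (R n (single i z)) \<le> C * ?p n m' (single i z)"
        by (rule order_trans[OF m[OF Rin] C(2)])
      also have "?p n m' (single i z) = P i m' z" by (simp add: block_seminorm_single[OF fin] i)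
      also have "norm (f n 0 (single i z)) * q (v k) \<le> (\<bar>C'\<bar> * ?p n (\<mu> n 0) (single i z)) * q (v k)"
        by (intro mult_right_mono order_trans[OF C' mult_right_mono] sum.seminorm_nonneg[OF sq]
            sum.seminorm_nonneg[OF seminorm_block]) simp
      also have "?p n (\<mu> n 0) (single i z) = P i (\<mu> n 0) z" by (simp add: block_seminorm_single[OF fin] i)
      finally show ?thesis by (simp add: algebra_simps)
    qed
    show "(\<lambda>z. q (?L (single i z))) \<in> continuous_seminorms s (X i)"
    proof (rule continuous_seminorms_mono)
      show "(\<lambda>z. C * P i m' z + ?K * P i (\<mu> n 0) z) \<in> continuous_seminorms s (X i)"
        by (intro continuous_seminorms_add[OF tvs] continuous_seminorms_mult[OF tvs P] C(1) K)
      have "seminorm d (\<lambda>x. q (?L x))" by (rule sum.seminorm_compose[OF sq Llin])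
      then show "seminorm s (\<lambda>z. q (?L (single i z)))" by (rule seminorm_compose[OF _ linear_single])
    qed (rule le)
  qed
  let ?O = "{(?L ^^ k) (w 0) | k. True}"
  have OW: "(?L ^^ k) (w 0) \<in> W" for k by (induction k) (auto simp: wW LW)
  have near: "\<exists>a\<in>?O. q (a - x) < 1" if x: "x \<in> W" and q: "q \<in> continuous_seminorms d S" for x q
  proof -
    note sq = sum.continuous_seminormsD[OF q]
    obtain z where z: "z \<in> D" "q (x - z) < 1 / 2" using Ddense[OF x q] by blast
    obtain l where l: "from_nat_into D l = z" using from_nat_into_surj[OF \<open>countable D\<close> z(1)] by blast
    obtain m where m: "\<And>x. x \<in> block (B 0) \<Longrightarrow> q x \<le> ?p 0 m x" using dominated_on_block[OF fin q] by blast
    obtain K where K: "z \<in> sum.span (w ` {..K})" using sum.span_range_initial[OF Dspan[OF z(1)]] by blast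
    \<comment> \<open>The second entry is large enough to make the target available at time
      \<open>k\<close>, to have \<open>n \<ge> m\<close>, and to push the error below 1/2.\<close>
    define n where "n = prod_encode (l, Suc (Suc (max K m)))"
    have n: "n \<ge> Suc (Suc (max K m))" unfolding n_def by (rule le_prod_encode_2)
    define k where "k = prod_encode (n, 0)"
    have k: "k \<ge> n" unfolding k_def by (rule le_prod_encode_1)
    have "y0 k = z" by (simp add: y0_def k_def n_def l)
    moreover have "z \<in> sum.span (w ` {..k})"
    proof -
      have "sum.span (w ` {..K}) \<subseteq> sum.span (w ` {..k})" by (rule sum.span_mono) (use n k in auto)
      then show ?thesis using K by blast
    qed
    ultimately have yk: "y k = z" by (simp add: y_def)
    have "(?L ^^ Suc k) (w 0) = z + d (of_real (\<eta> n)) (e 0 (Suc n))"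
      using orbit[of k] by (simp add: A_def k_def yk[unfolded k_def] Suc_prod_encode_0 wenc del: funpow.simps)
    moreover have "q (d (of_real (\<eta> n)) (e 0 (Suc n))) < 1 / 2"
    proof -
      have "q (e 0 (Suc n)) \<le> ?p 0 m (e 0 (Suc n))" by (rule m[OF e])
      also have "\<dots> \<le> ?p 0 n (e 0 (Suc n))" by (rule block_seminorm_mono) (use n in simp)
      finally have "q (e 0 (Suc n)) \<le> 1 + ?p 0 n (e 0 (Suc n))" by simp
      then have "\<eta> n * q (e 0 (Suc n)) \<le> \<eta> n * (1 + ?p 0 n (e 0 (Suc n)))"
        using \<eta>[of n] by (intro mult_left_mono) auto
      also have "\<dots> = inverse (2 ^ n)"
      proof -
        define c where "c = 1 + ?p 0 n (e 0 (Suc n))"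
        have "c \<noteq> 0" using pe[of n] by (simp add: c_def)
        then show ?thesis by (simp add: \<eta>_def c_def[symmetric])
      qed
      also have "\<dots> < 1 / 2"
      proof -
        have "(2::real) ^ 1 < 2 ^ n" by (rule power_strict_increasing) (use n in auto)
        then show ?thesis by (simp add: field_simps)
      qed
      finally show ?thesis using \<eta>[of n] by (simp add: sum.seminorm_scale[OF sq])
    qed
    ultimately have "q ((?L ^^ Suc k) (w 0) - z) < 1 / 2" by simp
    then have "q ((?L ^^ Suc k) (w 0) - x) < 1"
      using sum.seminorm_triangle[OF sq, of "(?L ^^ Suc k) (w 0)" x z] sum.seminorm_diff_commute[OF sq, of x z] z(2)
      by linarith
    then show ?thesis by blast
  qed
  have "S closure_of ?O = W"
  proof
    show "S closure_of ?O \<subseteq> W" using closure_of_subset_topspace[of S] by (simp add: topspace_S)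
    have "?O \<subseteq> topspace S" using OW by (auto simp: topspace_S)
    then show "W \<subseteq> S closure_of ?O"
      using near by (auto simp: sum.in_closure_of_seminorms[OF lc_S] topspace_S)
  qed
  then have "hypercyclic_operator d S ?L"
    unfolding hypercyclic_operator_def topspace_S
    using cont Llin wW[of 0] by (auto simp: sum.linear_to_iff[OF sum.vector_space_axioms])
  then show ?thesis by blast
qed

end

text \<open>The rank is constant from just after one element of \<open>C\<close> up to and including
  the next, so the fibres are finite intervals, each ending in an element of
  \<open>C\<close>.\<close>

lemma rank_function_fibres:
  fixes C :: "nat set"
  assumes C: "infinite C"
  defines "\<beta> \<equiv> \<lambda>i. card {c \<in> C. c < i}"
  shows "finite (\<beta> -` {n})" "\<exists>c\<in>C. \<beta> c = n"
proof -
  let ?c = "enumerate C"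
  have inj: "inj_on ?c A" for A by (rule inj_on_subset[OF inj_enumerate[OF C] subset_UNIV])
  have "{c \<in> C. c < ?c n} = ?c ` {..<n}"
  proof (intro equalityI subsetI)
    fix x assume x: "x \<in> {c \<in> C. c < ?c n}"
    then obtain k where k: "x = ?c k" using enumerate_Ex[OF C, of x] by auto
    then show "x \<in> ?c ` {..<n}" using x enumerate_mono_iff[OF C] by auto
  qed (use enumerate_mono_iff[OF C] enumerate_in_set[OF C] in auto)
  then have "\<beta> (?c n) = n" by (simp add: \<beta>_def card_image[OF inj])
  then show "\<exists>c\<in>C. \<beta> c = n" using enumerate_in_set[OF C] by blast
  have "\<beta> -` {n} \<subseteq> {..?c n}"
  proof (intro subsetI, rule ccontr)
    fix i assume i: "i \<in> \<beta> -` {n}" "i \<notin> {..?c n}"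
    have "?c ` {..n} \<subseteq> {c \<in> C. c < i}"
    proof (rule image_subsetI)
      fix k assume "k \<in> {..n}"
      then have "?c k \<le> ?c n" using enumerate_mono_iff[OF C, of k n] by (cases "k = n") auto
      then show "?c k \<in> {c \<in> C. c < i}" using i(2) enumerate_in_set[OF C] by auto
    qed
    then have "card (?c ` {..n}) \<le> card {c \<in> C. c < i}" by (rule card_mono[rotated]) simp
    then show False using i(1) by (simp add: \<beta>_def card_image[OF inj])
  qed
  then show "finite (\<beta> -` {n})" by (rule finite_subset) simp
qed

context frechet_sequence
begin

theorem exists_hypercyclic:
  assumes sep: "\<And>n. separable_space (X n)"
    and inf: "infinite {n. \<not> finite_dimensional_on s (V n)}"
  shows "\<exists>L. hypercyclic_operator d S L"
proof -
  define I where "I = {n. \<not> finite_dimensional_on s (V n)}"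
  \<comment> \<open>\<open>C\<close> consists of the last indices of the blocks. With infinitely
    many thick summands every block is made to end in one; otherwise \<open>C\<close> begins beyond
    all thick indices, which then fall into block \<open>0\<close>.\<close>
  have "\<exists>C. infinite C \<and> C \<subseteq> I \<and> ((\<forall>c\<in>C. thick c) \<or> (\<forall>i c. thick i \<longrightarrow> c \<in> C \<longrightarrow> i < c))"
  proof (cases "infinite {i. thick i}")
    case True
    then show ?thesis
      using thick_imp_infinite_dimensional by (intro exI[of _ "{i. thick i}"]) (auto simp: I_def)
  next
    case False
    then obtain N where N: "{i. thick i} \<subseteq> {..N}" using finite_nat_iff_bounded_le by blast
    have "infinite (I - {..N})" using inf by (simp add: I_def)
    then show ?thesis using N by (intro exI[of _ "I - {..N}"]) force
  qed
  then obtain C where C: "infinite C" "C \<subseteq> I"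
    and alt: "(\<forall>c\<in>C. thick c) \<or> (\<forall>i c. thick i \<longrightarrow> c \<in> C \<longrightarrow> i < c)" by blast
  define \<beta> where "\<beta> i = card {c \<in> C. c < i}" for i
  define B where "B n = \<beta> -` {n}" for n
  have fin: "finite (B n)" and CB: "\<exists>c\<in>C. c \<in> B n" for n
    using rank_function_fibres[OF C(1), of n] by (auto simp: B_def \<beta>_def[abs_def])
  let ?p = "\<lambda>n. block_seminorm (B n)"
  define Sys where "Sys n e f \<mu> Z \<longleftrightarrow> (\<forall>k. e k \<in> block (B n)) \<and> (\<forall>k. sum.functional (f k)) \<and>
    (\<forall>k. \<exists>C. \<forall>x. norm (f k x) \<le> C * ?p n (\<mu> k) x) \<and>
    (\<forall>j k. f j (e k) = (if j = k then 1 else 0)) \<and> mono \<mu> \<and>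
    (\<forall>x\<in>block (B n). \<forall>k. \<forall>m<\<mu> k. ?p n m (sum.remainder e f k x) = 0) \<and>
    countable Z \<and> Z \<subseteq> sum.span (range e) \<and>
    (\<forall>x\<in>block (B n). \<forall>m. \<forall>\<epsilon>>0. \<exists>z\<in>Z. ?p n m (x - z) < \<epsilon>)"
    for n and e :: "nat \<Rightarrow> (nat \<Rightarrow>\<^sub>0 'a)" and f :: "nat \<Rightarrow> (nat \<Rightarrow>\<^sub>0 'a) \<Rightarrow> 'k" and \<mu> :: "nat \<Rightarrow> nat" and Z
  have "\<exists>e f \<mu> Z. Sys n e f \<mu> Z" for n
  proof -
    obtain c where c: "c \<in> B n" "\<not> finite_dimensional_on s (V c)" using CB C(2) by (auto simp: I_def)
    obtain D where D: "countable D" "D \<subseteq> block (B n)"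
      "\<And>x m \<epsilon>. x \<in> block (B n) \<Longrightarrow> \<epsilon> > 0 \<Longrightarrow> \<exists>y\<in>D. ?p n m (x - y) < \<epsilon>"
      using block_dense[OF fin sep] by blast
    show ?thesis
    proof (rule sum.exists_biorthogonal_system[OF subspace_block seminorm_block block_seminorm_mono
          block_separates[OF fin] block_infinite_dimensional[OF c] D])
      fix e f \<mu> Z
      assume "\<And>k. e k \<in> block (B n)" "\<And>k. sum.functional (f k)"
        "\<And>k. \<exists>C. \<forall>x. norm (f k x) \<le> C * ?p n (\<mu> k) x"
        "\<And>j k. f j (e k) = (if j = k then 1 else 0)" "mono \<mu>"
        "\<And>k m x. x \<in> block (B n) \<Longrightarrow> m < \<mu> k \<Longrightarrow> ?p n m (sum.remainder e f k x) = 0"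
        "countable Z" "Z \<subseteq> sum.span (range e)"
        "\<And>x m \<epsilon>. x \<in> block (B n) \<Longrightarrow> \<epsilon> > 0 \<Longrightarrow> \<exists>z\<in>Z. ?p n m (x - z) < \<epsilon>"
      then have "Sys n e f \<mu> Z" unfolding Sys_def by simp
      then show ?thesis by blast
    qed
  qed
  then obtain e f \<mu> Z where sys: "\<And>n. Sys n (e n) (f n) (\<mu> n) (Z n)" by metis
  have e: "e n k \<in> block (B n)" and f: "sum.functional (f n k)"
    and bd: "\<exists>C. \<forall>x. norm (f n k x) \<le> C * ?p n (\<mu> n k) x"
    and bi: "f n j (e n k) = (if j = k then 1 else 0)" and mono: "mono (\<mu> n)"
    and Z: "countable (Z n)" "Z n \<subseteq> sum.span (range (e n))" for n j k
    using sys[of n] unfolding Sys_def by simp_all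
  have rem: "?p n m (sum.remainder (e n) (f n) k x) = 0" if "x \<in> block (B n)" "m < \<mu> n k" for n m k x
    using sys[of n] that unfolding Sys_def by blast
  have Zd: "\<exists>z\<in>Z n. ?p n m (x - z) < \<epsilon>" if "x \<in> block (B n)" "\<epsilon> > 0" for n m x \<epsilon>
    using sys[of n] that unfolding Sys_def by blast
  \<comment> \<open>Either a thick member of block \<open>n\<close> bounds the orders of its
    functionals, or block \<open>Suc n\<close> has no thick member and its vectors are eventually
    null for each seminorm.\<close>
  have compat: "\<exists>J m'. \<forall>j\<ge>J. \<mu> n (Suc j) \<le> m' \<or> ?p (Suc n) m (e (Suc n) j) = 0" for n m
    using alt
  proof
    assume "\<forall>c\<in>C. thick c"
    then obtain c where "c \<in> B n" "thick c" using CB by blast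
    then obtain m' where "\<And>k. \<mu> n k \<le> m'" using thick_order_bounded[OF fin _ _ rem] by blast
    then show ?thesis by blast
  next
    assume thin: "\<forall>i c. thick i \<longrightarrow> c \<in> C \<longrightarrow> i < c"
    have "\<not> thick i" if "i \<in> B (Suc n)" for i
    proof
      assume "thick i"
      \<comment> \<open>A thick index precedes all of \<open>C\<close>, so its rank is 0 and it
        cannot lie in a later block.\<close>
      then have "{c \<in> C. c < i} = {}" using thin by (auto dest: less_asym)
      then have "\<beta> i = 0" unfolding \<beta>_def by (simp only: card.empty)
      then show False using that by (simp add: B_def)
    qed
    from not_thick_order_unbounded[OF fin this e f bd bi]
    obtain J where J: "m < \<mu> (Suc n) J" by blast
    have "?p (Suc n) m (e (Suc n) j) = 0" if "j \<ge> J" for j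
    proof -
      have "m < \<mu> (Suc n) j" using J monoD[OF mono that] by (rule less_le_trans)
      \<comment> \<open>By biorthogonality \<open>e (Suc n) j\<close> is its own remainder at stage
        \<open>j\<close>, hence null below the order of that stage.\<close>
      from rem[OF e this, of j] show ?thesis by (simp add: sum.remainder_def bi)
    qed
    then show ?thesis by blast
  qed
  show ?thesis
    by (rule exists_hypercyclic_of_systems[of \<beta> e f \<mu> Z, folded B_def]) (fact fin e f bd bi Z Zd compat)+
qed

end

theorem theorem1p13:
  fixes s :: "'k::real_or_complex \<Rightarrow> 'a::ab_group_add \<Rightarrow> 'a"
    and X :: "nat \<Rightarrow> 'a topology"
  assumes frechet: "\<And>n. frechet_space s (X n)"
    and separable: "\<And>n. separable_space (X n)"
    and nonzero: "\<And>n. topspace (X n) \<noteq> {0}"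
  shows "(\<exists>L. hypercyclic_operator (direct_sum_scale s) (direct_sum_topology s X) L) \<longleftrightarrow>
         infinite {n. \<not> finite_dimensional_on s (topspace (X n))}"
proof -
  have lc: "locally_convex_space s (X n)" for n
    using frechet by (simp add: frechet_space_def)
  then have "vector_space s" unfolding locally_convex_space_def topological_vector_space_def by blast
  then interpret rc_vector_space s by (simp add: rc_vector_space_def)
  \<comment> \<open>The properties are bundled so that a single choice over \<open>n\<close>
    produces the seminorms of all summands.\<close>
  define Q where "Q n P \<longleftrightarrow> (\<forall>m. P m \<in> continuous_seminorms s (X n)) \<and>
    (\<forall>m m' x. m \<le> m' \<longrightarrow> P m x \<le> P m' x) \<and>
    (\<forall>p\<in>continuous_seminorms s (X n). \<exists>m. \<forall>x\<in>topspace (X n). p x \<le> P m x) \<and>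
    (\<forall>x\<in>topspace (X n). (\<forall>m. P m x = 0) \<longrightarrow> x = 0) \<and>
    (\<forall>y. (\<forall>k. y k \<in> topspace (X n)) \<longrightarrow> (\<forall>m. \<forall>\<epsilon>>0. \<exists>N. \<forall>i\<ge>N. \<forall>j\<ge>N. P m (y i - y j) < \<epsilon>) \<longrightarrow>
       (\<exists>l\<in>topspace (X n). \<forall>m. (\<lambda>k. P m (y k - l)) \<longlonglongrightarrow> 0))"
    for n and P :: "nat \<Rightarrow> 'a \<Rightarrow> real"
  have "\<exists>P. Q n P" for n
    by (rule frechet_seminorms[OF frechet[of n]], unfold Q_def) blast
  then obtain P where P: "\<And>n. Q n (P n)" by metis
  note Q = P[unfolded Q_def]
  interpret frechet_sequence s X P
  proof (intro frechet_sequence.intro locally_convex_sequence.intro locally_convex_sequence_axioms.intro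
      frechet_sequence_axioms.intro lc nonzero rc_vector_space_axioms)
    show "P n m \<in> continuous_seminorms s (X n)" for n m
      by (rule Q[THEN conjunct1, rule_format])
    show "P n m x \<le> P n m' x" if "m \<le> m'" for n m m' x
      using that by (rule Q[THEN conjunct2, THEN conjunct1, rule_format])
    show "\<exists>m. \<forall>x\<in>topspace (X n). p x \<le> P n m x" if "p \<in> continuous_seminorms s (X n)" for n p
      using that by (rule Q[THEN conjunct2, THEN conjunct2, THEN conjunct1, rule_format])
    show "x = 0" if "x \<in> topspace (X n)" "\<And>m. P n m x = 0" for n x
      using that by (rule Q[THEN conjunct2, THEN conjunct2, THEN conjunct2, THEN conjunct1, rule_format])
    show "\<exists>l\<in>topspace (X n). \<forall>m. (\<lambda>k. P n m (y k - l)) \<longlonglongrightarrow> 0"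
      if "\<And>k. y k \<in> topspace (X n)"
        "\<And>m \<epsilon>. \<epsilon> > 0 \<Longrightarrow> \<exists>N. \<forall>i\<ge>N. \<forall>j\<ge>N. P n m (y i - y j) < \<epsilon>" for n y
      using Q[THEN conjunct2, THEN conjunct2, THEN conjunct2, THEN conjunct2, of n] that by simp
  qed
  show ?thesis
    using exists_hypercyclic[OF separable] not_hypercyclic by blast
qed

end
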